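(* Let $b\ge0$, $\rho\in(0,1)$, and assume that the eigenvalues $\mu_1,\dots,\mu_m$ of $-Q$ are pairwise different. For $\delta\in\mathbb{C}_+\setminus Sp(-Q)$ put $\alpha_\delta=\rho\,\alpha(-\delta I-Q)^{-1}e^{(\delta I+Q)b+\psi_2(-Q)}$ and, for $x<b$, $$h_\delta(x)=\alpha_\delta e^{\phi(-\lambda Q)}\sum_{n=1}^\infty e^{-x\lambda^nQ-\phi(-\lambda^nQ)}\rho^{n-1}\,q,$$ $$\eta_{\delta,i}=e^{\delta b}\Big(e_i+\alpha\, e^{Qb+\psi_2(-Q)+\phi(-\lambda Q)}\sum_{n=1}^\infty e^{-b\lambda^nQ-\phi(-\lambda^nQ)+\psi^i(-\lambda^nQ)}\rho^n\Big)(-\delta I-Q)^{-1}q ,\quad i=1,\dots,m.$$ Then each $\eta_{\delta,i}$ is a rational function of $\delta$ with poles in $Sp(-Q)$, and $h_\delta(x)$ is rational in $\delta$ with the same poles, so that partial fraction decomposition yields the representations $$\eta_{\delta,i}=\sum_{j=1}^m\frac{a_{i,j}}{\mu_j-\delta},\qquad h_\delta(x)=\sum_{j=1}^m\frac{c_j(x)}{\mu_j-\delta}$$ for some $a_{i,1},\dots,a_{i,m}$ and $c_1(x),\dots,c_m(x)$. Let $A$ be the $m\times m$ matrix whose entry in row $j$ and column $i$ is $a_{i,j}$, and let $c(x)=(c_1(x),\dots,c_m(x))^{\top}$. If $A$ is invertible, then the column vector $\Phi(x)=(\Phi_1(x),\dots,\Phi_m(x))^\top$, where $\Phi_i(x)=E_x(\rho^{\tau_b}\mathbf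 1_{G_i})$ and $\tau_b=\inf\{k\in\mathbb{N}_0:X_k\ge b\}$ (the integrand being $0$ on $\{\tau_b=\infty\}$), is given by $$\Phi(x)=A^{-1}c(x)\qquad\text{for all }x<b.$$
   Context: $\mathbb{N}=\{1,2,\dots\}$, $\mathbb{N}_0=\mathbb{N}\cup\{0\}$, $\mathbb{C}_+=\{z\in\mathbb{C}:\Re z\ge0\}$, $Sp(\cdot)$ is the spectrum (set of eigenvalues) of a matrix, $I$ the $m\times m$ identity, $e_i$ the $i$-th unit (row) vector. Phasetype distributions: let $m\in\mathbb{N}$, $E=\{1,\dots,m\}$, $\Delta=m+1$, and consider continuous-time Markov chains on $E\cup\{\Delta\}$ in which $1,\dots,m$ are transient and $\Delta$ is absorbing, with generator $\hat Q=\begin{pmatrix}Q&-Q\mathbf 1\\0&0\end{pmatrix}$, where $Q$ is an $m\times m$ matrix and $\mathbf 1$ is the all-ones column vector; put $q=-Q\mathbf 1$. For a probability row vector $\alpha$, $PH(Q,\alpha)$ denotes the distribution of the absorption time $\inf\{t\ge0:J_t=\Delta\}$ of such a chain started with initial distribution $(\alpha,0)$. Process: let $0<\lambda<1$ and $X_n=\lambda X_{n-1}+Z_n$, $n\in\mathbb{N}$, where the innovations $Z_n=S_n-T_n$ are i.i.d., $S_n,T_n\ge 0$ are independent, $S_n$ is $PH(Q,\alpha)$-distributed and $T_n$ has an arbitrary distribution on $[0,\infty)$ subject to $E(\log(1+|Z_1|))<\infty$. $P_x,E_x$ refer to $X_0=x$. For each $n$ let $S_n$ be realized as the absorption time of a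 Markov chain $(J^{(n)}_t)_{t\ge0}$ with generator $\hat Q$ and initial distribution $(\alpha,0)$; the chains $J^{(n)}$ and the variables $T_n$, $n\in\mathbb{N}$, are all independent, the $J^{(n)}$ being identically distributed and the $T_n$ being identically distributed. Embedding: for $t\ge0$ put $n_t=\max\{n\in\mathbb{N}_0:\sum_{k=1}^nS_k\le t\}$, $J_t=J^{(n_t+1)}_{t-\sum_{k=1}^{n_t}S_k}$, $Y_t=\lambda X_{n_t}-T_{n_t+1}+t-\sum_{k=1}^{n_t}S_k$, $\hat\tau=\inf\{t\ge0:Y_t\ge b\}$, and $G_i=\{\hat\tau<\infty,\ J_{\hat\tau}=i\}$ for $i\in E$. Standing assumption: $Sp(\lambda^nQ)\cap Sp(Q)=\emptyset$ for all $n\in\mathbb{N}$. Transforms: $e^{\psi_1(u)}=\alpha(-uI-Q)^{-1}q$ (the rational extension of $E(e^{uS_1})$), $e^{\psi_2(u)}=E(e^{-uT_1})$ for $u\in\mathbb{C}_+$, $\psi=\psi_1+\psi_2$ on $\mathbb{C}_+\setminus Sp(-Q)$, $\phi(u)=\sum_{k=0}^\infty\psi(\lambda^ku)$, i.e. $e^{\phi(u)}=\prod_{k=0}^\infty e^{\psi_1(\lambda^ku)}e^{\psi_2(\lambda^ku)}$, for $u\in\mathbb{C}_+\setminus\bigcup_{n\in\mathbb{N}_0}Sp(-\lambda^{-n}Q)$, and $e^{\psi^i(u)}=e_i(-uI-Q)^{-1}q$ (the extension of the transform of $PH(Q,e_i)$). Functions of matrices are understood via the holomorphic functional calculus; e.g.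 $e^{\psi_2(-Q)}=E(e^{QT_1})$, and $e^{-\phi(M)}$ is $1/e^{\phi}$ applied to $M$. It is presupposed that $\phi$ is defined at the matrices where it is evaluated, i.e. that $e^{\phi}$ does not vanish at the eigenvalues of $-\lambda^nQ$, $n\in\mathbb{N}$.
   Formalization: For b>0 the factor e^{δb} makes η_{δ,i} and h_δ(x) non-rational in δ; rationality and the partial fractions are therefore stated for e^{-δb}η_{δ,i} and e^{-δb}h_δ(x), whose coefficients define A and c(x). For b=0 nothing changes. *)

theory Defs
  imports "HOL-Probability.Probability" "HOL-Complex_Analysis.Complex_Analysis"
begin

section \<open>Matrices and the holomorphic functional calculus\<close>

text \<open>
  The transient states are the elements of a finite type \<open>'m\<close>. Multiplication
  \<open>*\<close> and powers on \<open>real ^ 'm ^ 'm\<close> are entrywise, so the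
  exponential series below is written with the matrix product \<open>**\<close>.
\<close>

definition matrix_exp :: "real ^ 'n ^ 'n \<Rightarrow> real ^ 'n ^ 'n" where
  "matrix_exp A = (\<Sum>k. (1 / fact k) *\<^sub>R (((**) A ^^ k) (mat 1)))"

definition spectrum :: "complex ^ 'n ^ 'n \<Rightarrow> complex set" where
  "spectrum M = {z. \<exists>v. v \<noteq> 0 \<and> M *v v = z *s v}"

abbreviation cmat :: "real ^ 'n ^ 'm \<Rightarrow> complex ^ 'n ^ 'm" where
  "cmat \<equiv> map_matrix complex_of_real"

definition cvec :: "real ^ 'n \<Rightarrow> complex ^ 'n" where
  "cvec v = (\<chi> i. complex_of_real (v $ i))"

text \<open>
  \<open>f(M) = 1/(2\<pi>i) \<integral>\<^sub>\<Gamma> f(w) (wI - M)\<^sup>-\<^sup>1 dw\<close> for \<open>f\<close> holomorphic near the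
  spectrum of \<open>M\<close>, where \<open>\<Gamma>\<close> is the union of sufficiently small circles
  around the eigenvalues; \<open>residue\<close> is by definition the integral over one
  such circle, divided by \<open>2\<pi>i\<close>.
\<close>

definition fun_calc :: "(complex \<Rightarrow> complex) \<Rightarrow> complex ^ 'n ^ 'n \<Rightarrow> complex ^ 'n ^ 'n" where
  "fun_calc f M =
     (\<chi> i j. \<Sum>z\<in>spectrum M. residue (\<lambda>w. f w * matrix_inv (mat w - M) $ i $ j) z)"

definition rational_with_poles :: "complex set \<Rightarrow> complex set \<Rightarrow> (complex \<Rightarrow> complex) \<Rightarrow> bool" where
  "rational_with_poles P D f \<longleftrightarrow>
     (\<exists>p r :: complex poly. r \<noteq> 0 \<and> {z. poly r z = 0} \<subseteq> P \<and> (\<forall>z\<in>D. f z = poly p z / poly r z))"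


section \<open>Markov chains and phasetype distributions\<close>

definition is_generator :: "real ^ 'n ^ 'n \<Rightarrow> bool" where
  "is_generator G \<longleftrightarrow> (\<forall>i j. i \<noteq> j \<longrightarrow> 0 \<le> G $ i $ j) \<and> (\<forall>i. (\<Sum>j\<in>UNIV. G $ i $ j) = 0)"

text \<open>
  A state is transient if the expected total time spent in it, starting from it,
  is finite.
\<close>

definition transient_state :: "real ^ 'n ^ 'n \<Rightarrow> 'n \<Rightarrow> bool" where
  "transient_state G i \<longleftrightarrow>
     (\<integral>\<^sup>+ t. ennreal (matrix_exp (t *\<^sub>R G) $ i $ i) * indicator {0..} t \<partial>lborel) < \<infinity>"

definition exit_rates :: "real ^ 'm ^ 'm \<Rightarrow> real ^ 'm" where
  "exit_rates Q = - (Q *v 1)"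

text \<open>State space \<open>'m option\<close>: \<open>Some i\<close> is the state \<open>i\<close>, and \<open>None\<close> is the cemetery \<open>\<Delta>\<close>.\<close>

definition hat_generator :: "real ^ 'm ^ 'm \<Rightarrow> real ^ ('m option) ^ ('m option)" where
  "hat_generator Q = (\<chi> i j. case i of None \<Rightarrow> 0
       | Some k \<Rightarrow> (case j of None \<Rightarrow> exit_rates Q $ k | Some l \<Rightarrow> Q $ k $ l))"

definition hat_initial :: "real ^ 'm \<Rightarrow> real ^ ('m option)" where
  "hat_initial \<alpha> = (\<chi> i. case i of None \<Rightarrow> 0 | Some k \<Rightarrow> \<alpha> $ k)"

definition phasetype_matrix :: "real ^ 'm ^ 'm \<Rightarrow> bool" where
  "phasetype_matrix Q \<longleftrightarrow>
     is_generator (hat_generator Q) \<and> (\<forall>i. transient_state (hat_generator Q) (Some i))"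

definition prob_vector :: "real ^ 'n \<Rightarrow> bool" where
  "prob_vector v \<longleftrightarrow> (\<forall>i. 0 \<le> v $ i) \<and> (\<Sum>i\<in>UNIV. v $ i) = 1"

text \<open>
  \<open>(J\<^sub>t)\<^sub>t\<^sub>\<ge>\<^sub>0\<close> is a continuous-time Markov chain with generator \<open>G\<close> and initial
  distribution \<open>\<nu>\<close>: right-continuous paths (in the discrete topology), and
  finite-dimensional distributions given by the semigroup \<open>exp (tG)\<close>.
\<close>

definition markov_chain ::
  "'w measure \<Rightarrow> real ^ 'n ^ 'n \<Rightarrow> real ^ 'n \<Rightarrow> (real \<Rightarrow> 'w \<Rightarrow> 'n) \<Rightarrow> bool" where
  "markov_chain M G \<nu> J \<longleftrightarrow>
     (\<forall>t\<ge>0. J t \<in> measurable M (count_space UNIV)) \<and>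
     (\<forall>\<omega>\<in>space M. \<forall>t\<ge>0. \<exists>e>0. \<forall>s\<in>{t..<t + e}. J s \<omega> = J t \<omega>) \<and>
     (\<forall>n (t :: nat \<Rightarrow> real) s. t 0 = 0 \<and> (\<forall>k<n. t k \<le> t (Suc k)) \<longrightarrow>
        measure M {\<omega>\<in>space M. \<forall>k\<le>n. J (t k) \<omega> = s k} =
        \<nu> $ s 0 * (\<Prod>k<n. matrix_exp ((t (Suc k) - t k) *\<^sub>R G) $ s k $ s (Suc k)))"

text \<open>
  The infimum is taken in the extended reals; on the null set where \<open>\<Delta>\<close> is never
  reached, \<open>real_of_ereal\<close> turns the value \<open>\<infinity>\<close> into \<open>0\<close>.
\<close>

definition absorption_time :: "(real \<Rightarrow> 'w \<Rightarrow> 'm option) \<Rightarrow> 'w \<Rightarrow> real" where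
  "absorption_time J \<omega> = real_of_ereal (INF t\<in>{t. 0 \<le> t \<and> J t \<omega> = None}. ereal t)"


section \<open>The autoregressive process and its embedding\<close>

text \<open>
  The index \<open>n\<close> of \<open>J\<close>, \<open>T\<close> and of the innovations runs through \<open>1, 2, \<dots>\<close>; the
  entries with index \<open>0\<close> are never used. Independence is stated for the generated
  \<open>\<sigma>\<close>-algebras since \<open>indep_vars\<close> does not allow chains (as random elements of the
  path space) and real random variables in one family.
\<close>

definition chains_indep ::
  "'w measure \<Rightarrow> (nat \<Rightarrow> real \<Rightarrow> 'w \<Rightarrow> 'm option) \<Rightarrow> (nat \<Rightarrow> 'w \<Rightarrow> real) \<Rightarrow> bool" where
  "chains_indep M J T \<longleftrightarrow>
     prob_space.indep_sets M
       (\<lambda>k. case k of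
          Inl n \<Rightarrow> {(\<lambda>\<omega>. restrict (\<lambda>t. J n t \<omega>) {0..}) -` B \<inter> space M |B.
                     B \<in> sets (Pi\<^sub>M {0..} (\<lambda>_. count_space UNIV))}
        | Inr n \<Rightarrow> {T n -` B \<inter> space M |B. B \<in> sets borel})
       (Inl ` {1..} \<union> Inr ` {1..})"

definition innovation ::
  "(nat \<Rightarrow> real \<Rightarrow> 'w \<Rightarrow> 'm option) \<Rightarrow> (nat \<Rightarrow> 'w \<Rightarrow> real) \<Rightarrow> nat \<Rightarrow> 'w \<Rightarrow> real" where
  "innovation J T n \<omega> = absorption_time (J n) \<omega> - T n \<omega>"

primrec ar_process ::
  "real \<Rightarrow> (nat \<Rightarrow> real \<Rightarrow> 'w \<Rightarrow> 'm option) \<Rightarrow> (nat \<Rightarrow> 'w \<Rightarrow> real) \<Rightarrow> real \<Rightarrow> nat \<Rightarrow> 'w \<Rightarrow> real" where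
  "ar_process lam J T x 0 \<omega> = x"
| "ar_process lam J T x (Suc n) \<omega> = lam * ar_process lam J T x n \<omega> + innovation J T (Suc n) \<omega>"

definition renewal_sum :: "(nat \<Rightarrow> real \<Rightarrow> 'w \<Rightarrow> 'm option) \<Rightarrow> nat \<Rightarrow> 'w \<Rightarrow> real" where
  "renewal_sum J n \<omega> = (\<Sum>k=1..n. absorption_time (J k) \<omega>)"

definition renewal_count :: "(nat \<Rightarrow> real \<Rightarrow> 'w \<Rightarrow> 'm option) \<Rightarrow> real \<Rightarrow> 'w \<Rightarrow> nat" where
  "renewal_count J t \<omega> = Max {n. renewal_sum J n \<omega> \<le> t}"

definition embedded_state :: "(nat \<Rightarrow> real \<Rightarrow> 'w \<Rightarrow> 'm option) \<Rightarrow> real \<Rightarrow> 'w \<Rightarrow> 'm option" where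
  "embedded_state J t \<omega> =
     (let n = renewal_count J t \<omega> in J (Suc n) (t - renewal_sum J n \<omega>) \<omega>)"

definition embedded_process ::
  "real \<Rightarrow> (nat \<Rightarrow> real \<Rightarrow> 'w \<Rightarrow> 'm option) \<Rightarrow> (nat \<Rightarrow> 'w \<Rightarrow> real) \<Rightarrow> real \<Rightarrow> real \<Rightarrow> 'w \<Rightarrow> real" where
  "embedded_process lam J T x t \<omega> =
     (let n = renewal_count J t \<omega>
      in lam * ar_process lam J T x n \<omega> - T (Suc n) \<omega> + t - renewal_sum J n \<omega>)"

definition crossing_event ::
  "'w measure \<Rightarrow> real \<Rightarrow> (nat \<Rightarrow> real \<Rightarrow> 'w \<Rightarrow> 'm option) \<Rightarrow> (nat \<Rightarrow> 'w \<Rightarrow> real) \<Rightarrow> real \<Rightarrow> real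
     \<Rightarrow> 'm \<Rightarrow> 'w set" where
  "crossing_event M lam J T b x i =
     {\<omega>\<in>space M. let H = {t. 0 \<le> t \<and> b \<le> embedded_process lam J T x t \<omega>}
                  in H \<noteq> {} \<and> embedded_state J (Inf H) \<omega> = Some i}"

definition crossing_transform ::
  "'w measure \<Rightarrow> real \<Rightarrow> (nat \<Rightarrow> real \<Rightarrow> 'w \<Rightarrow> 'm option) \<Rightarrow> (nat \<Rightarrow> 'w \<Rightarrow> real) \<Rightarrow> real \<Rightarrow> real
     \<Rightarrow> real \<Rightarrow> 'm \<Rightarrow> real" where
  "crossing_transform M lam J T b \<rho> x i =
     (\<integral>\<omega>. (let K = {k. b \<le> ar_process lam J T x k \<omega>}
            in if K = {} then 0 else \<rho> ^ Inf K) * indicator (crossing_event M lam J T b x i) \<omega> \<partial>M)"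


section \<open>Transforms\<close>

text \<open>
  Only the exponentials of \<open>\<psi>\<^sub>1\<close>, \<open>\<psi>\<^sub>2\<close>, \<open>\<phi>\<close> and \<open>\<psi>\<^sup>i\<close> are needed, so no branch of
  the logarithm is involved. They are given by total functions, which are meaningful on the
  domains of the transforms; the functional calculus evaluates them only there.
\<close>

abbreviation resolvent :: "real ^ 'm ^ 'm \<Rightarrow> complex \<Rightarrow> complex ^ 'm ^ 'm" where
  "resolvent Q u \<equiv> matrix_inv (mat (- u) - cmat Q)"

definition phasetype_transform :: "real ^ 'm ^ 'm \<Rightarrow> complex ^ 'm \<Rightarrow> complex \<Rightarrow> complex" where
  "phasetype_transform Q a u = scalar_product (a v* resolvent Q u) (cvec (exit_rates Q))"

definition exp_psi1 :: "real ^ 'm ^ 'm \<Rightarrow> real ^ 'm \<Rightarrow> complex \<Rightarrow> complex" where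
  "exp_psi1 Q \<alpha> = phasetype_transform Q (cvec \<alpha>)"

definition exp_psi2 :: "'w measure \<Rightarrow> (nat \<Rightarrow> 'w \<Rightarrow> real) \<Rightarrow> complex \<Rightarrow> complex" where
  "exp_psi2 M T u = (\<integral>\<omega>. exp (- u * complex_of_real (T 1 \<omega>)) \<partial>M)"

definition exp_psi_unit :: "real ^ 'm ^ 'm \<Rightarrow> 'm \<Rightarrow> complex \<Rightarrow> complex" where
  "exp_psi_unit Q i = phasetype_transform Q (axis i 1)"

definition exp_phi ::
  "'w measure \<Rightarrow> real \<Rightarrow> real ^ 'm ^ 'm \<Rightarrow> real ^ 'm \<Rightarrow> (nat \<Rightarrow> 'w \<Rightarrow> real) \<Rightarrow> complex \<Rightarrow> complex" where
  "exp_phi M lam Q \<alpha> T u = (\<Prod>k. exp_psi1 Q \<alpha> (of_real (lam ^ k) * u) * exp_psi2 M T (of_real (lam ^ k) * u))"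

text \<open>
  In the following two definitions each exponential whose exponent is a sum of functions of a
  single matrix \<open>- \<lambda>\<^sup>n Q\<close> is that function of the matrix, and the series index is shifted by one.
\<close>

definition h_fun ::
  "'w measure \<Rightarrow> real \<Rightarrow> real ^ 'm ^ 'm \<Rightarrow> real ^ 'm \<Rightarrow> (nat \<Rightarrow> 'w \<Rightarrow> real) \<Rightarrow> real \<Rightarrow> real
     \<Rightarrow> complex \<Rightarrow> real \<Rightarrow> complex" where
  "h_fun M lam Q \<alpha> T b \<rho> \<delta> x =
    (let \<alpha>\<delta> = \<rho> *\<^sub>R (cvec \<alpha> v*
           (resolvent Q \<delta> ** fun_calc (\<lambda>z. exp ((\<delta> - z) * of_real b) * exp_psi2 M T z) (- cmat Q)))
     in scalar_product
          (\<alpha>\<delta> v*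
            (fun_calc (exp_phi M lam Q \<alpha> T) (- (lam *\<^sub>R cmat Q)) **
             (\<Sum>n. \<rho> ^ n *\<^sub>R
                fun_calc (\<lambda>z. exp (of_real x * z) / exp_phi M lam Q \<alpha> T z) (- (lam ^ Suc n *\<^sub>R cmat Q)))))
          (cvec (exit_rates Q)))"

definition eta ::
  "'w measure \<Rightarrow> real \<Rightarrow> real ^ 'm ^ 'm \<Rightarrow> real ^ 'm \<Rightarrow> (nat \<Rightarrow> 'w \<Rightarrow> real) \<Rightarrow> real \<Rightarrow> real
     \<Rightarrow> complex \<Rightarrow> 'm \<Rightarrow> complex" where
  "eta M lam Q \<alpha> T b \<rho> \<delta> i =
     exp (\<delta> * of_real b) *
     scalar_product
       ((axis i 1 +
          cvec \<alpha> v*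
            (fun_calc (\<lambda>z. exp (- z * of_real b) * exp_psi2 M T z) (- cmat Q) **
             fun_calc (exp_phi M lam Q \<alpha> T) (- (lam *\<^sub>R cmat Q)) **
             (\<Sum>n. \<rho> ^ Suc n *\<^sub>R
                fun_calc (\<lambda>z. exp (of_real b * z) / exp_phi M lam Q \<alpha> T z * exp_psi_unit Q i z)
                  (- (lam ^ Suc n *\<^sub>R cmat Q)))))
        v* resolvent Q \<delta>)
       (cvec (exit_rates Q))"

text \<open>
  \<open>\<eta>\<close> and \<open>h\<close> both contain the factor \<open>exp (\<delta> b)\<close>, which is not rational in \<open>\<delta>\<close>
  unless \<open>b = 0\<close>. The rational functions that are decomposed are the cofactors of this common
  factor. It cancels in the linear system for \<open>\<Phi>(x)\<close>.
\<close>

definition partial_fractions ::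
  "'w measure \<Rightarrow> real \<Rightarrow> real ^ 'm ^ 'm \<Rightarrow> real ^ 'm \<Rightarrow> (nat \<Rightarrow> 'w \<Rightarrow> real) \<Rightarrow> real \<Rightarrow> real
     \<Rightarrow> ('m \<Rightarrow> complex) \<Rightarrow> ('m \<Rightarrow> 'm \<Rightarrow> complex) \<Rightarrow> (real \<Rightarrow> complex ^ 'm) \<Rightarrow> bool" where
  "partial_fractions M lam Q \<alpha> T b \<rho> \<mu> a c \<longleftrightarrow>
     (\<forall>\<delta>. 0 \<le> Re \<delta> \<and> \<delta> \<notin> spectrum (- cmat Q) \<longrightarrow>
        (\<forall>i. eta M lam Q \<alpha> T b \<rho> \<delta> i = exp (\<delta> * of_real b) * (\<Sum>j\<in>UNIV. a i j / (\<mu> j - \<delta>))) \<and>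
        (\<forall>x<b. h_fun M lam Q \<alpha> T b \<rho> \<delta> x = exp (\<delta> * of_real b) * (\<Sum>j\<in>UNIV. c x $ j / (\<mu> j - \<delta>))))"

end

theory Submission
  imports Defs
begin

text \<open>
  The process is followed only as long as it is below \<open>b\<close>. Let \<open>L\<^sub>n(v)\<close> be the mean of
  \<open>exp (v X\<^sub>n)\<close> on the event that \<open>X\<^sub>1, \<dots>, X\<^sub>n < b\<close>, and let \<open>p\<^sub>n(i)\<close> be the probability that the
  barrier is crossed during the jump number \<open>n + 1\<close> while the chain is in state \<open>i\<close>. Two relations
  between these numbers carry the proof.

  Given the past, the next jump has to cover a known distance \<open>c\<close> to reach \<open>b\<close>. The process survives
  if the jump ends before \<open>c\<close>, and otherwise it crosses in a state with the law \<open>\<alpha> exp (Qc)\<close>. The mean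
  of \<open>exp (v S)\<close> over the event \<open>S < c\<close> is an integral over a bounded interval. It equals the rational
  extension of the transform of \<open>S\<close> minus a boundary term for every \<open>v\<close> outside the spectrum of
  \<open>- Q\<close>, even where the full exponential moment diverges (\<open>exp_dens_has_integral\<close>). Therefore, with
  \<open>\<lambda>\<close> for the coefficient of the autoregression, for the regular points \<open>v\<close>,
  \<open>L\<^sub>n\<^sub>+\<^sub>1(v) = e\<^sup>\<psi>(v) L\<^sub>n(\<lambda> v) - exp (v b) \<Sum>\<^sub>i e\<^sup>\<psi>\<^sup>i(v) p\<^sub>n(i)\<close>
  (\<open>killed_transform_Suc\<close> and \<open>clock_transform\<close>).

  Since the eigenvalues \<open>\<mu>\<^sub>k\<close> of \<open>- Q\<close> are pairwise different, \<open>- Q = V diag(\<mu>) W\<close> with \<open>W\<close> inverse to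
  \<open>V\<close>, and \<open>\<alpha> exp (Qc) V\<close> has the entries \<open>(\<alpha>V)\<^sub>k exp (- c \<mu>\<^sub>k)\<close>. As \<open>c\<close> depends linearly on \<open>X\<^sub>n\<close> and on
  the jump downwards, the second relation (\<open>exit_prob_V\<close>) is
  \<open>\<Sum>\<^sub>i V\<^sub>i\<^sub>k p\<^sub>n(i) = (\<alpha>V)\<^sub>k exp (- b \<mu>\<^sub>k) e\<^sup>\<psi>\<^sup>2(\<mu>\<^sub>k) L\<^sub>n(\<lambda> \<mu>\<^sub>k)\<close>.

  Discounting by \<open>\<rho>\<close> and summing over \<open>n\<close> replaces \<open>p\<^sub>n(i)\<close> by the crossing transforms \<open>\<Phi>\<^sub>i(x)\<close>
  (\<open>crossing_transform_sums\<close>) and \<open>L\<^sub>n\<close> by its generating function \<open>G\<close>. The first relation then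
  determines \<open>G(\<lambda> \<mu>\<^sub>k)\<close> by iteration along \<open>\<lambda> \<mu>\<^sub>k, \<lambda>\<^sup>2 \<mu>\<^sub>k, \<dots>\<close>. The factors that accumulate are the
  quotients of \<open>e\<^sup>\<phi>\<close> in the series for \<open>\<eta>\<close> and \<open>h\<close> (\<open>disc_transform_solution\<close>). Inserted into the
  second relation, this is row \<open>k\<close> of the linear system for \<open>\<Phi>(x)\<close> (\<open>linear_system\<close>). On the other
  side, the functional calculus evaluates functions at the eigenvalues (\<open>fun_calc_D\<close>), so \<open>\<eta>\<close> and \<open>h\<close>
  are sums of simple fractions with these coefficients (\<open>eta_eq\<close>, \<open>h_fun_eq\<close>), and partial fractions
  are unique.

  For this to make sense, the eigenvalues must have positive real parts, which follows from
  transience (\<open>Re_eig_pos\<close>), and the product \<open>e\<^sup>\<phi>\<close> must converge to an analytic function, which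
  follows from the logarithmic moment (\<open>factor_bound\<close>, \<open>phi_analytic\<close>). The link with the
  embedded process is a statement about single paths (\<open>crossing_deterministic\<close>).
\<close>


section \<open>Matrices with pairwise different eigenvalues\<close>

text \<open>
  With \<open>W\<close> inverse to \<open>V\<close> this is \<open>V diag(f) W\<close>: the columns of \<open>V\<close> are right eigenvectors and
  the rows of \<open>W\<close> left eigenvectors, with eigenvalues \<open>f\<close>.
\<close>

definition eig_matrix ::
  "complex ^ 'n ^ 'n \<Rightarrow> complex ^ 'n ^ 'n \<Rightarrow> ('n \<Rightarrow> complex) \<Rightarrow> complex ^ 'n ^ 'n" where
  "eig_matrix V W f = (\<chi> i j. \<Sum>k\<in>UNIV. V $ i $ k * f k * W $ k $ j)"

text \<open>
  Applying \<open>N - \<mu> k0\<close> to a vanishing combination removes the term \<open>k0\<close> and multiplies every other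
  term by a nonzero factor, which reduces the number of terms.
\<close>

lemma eigenvectors_independent:
  fixes N :: "complex ^ 'n ^ 'n" and v :: "'i \<Rightarrow> complex ^ 'n"
  assumes fin: "finite F" and inj: "inj_on \<mu> F"
    and ev: "\<And>k. k \<in> F \<Longrightarrow> N *v v k = \<mu> k *s v k \<and> v k \<noteq> 0"
    and "(\<Sum>k\<in>F. a k *s v k) = 0"
  shows "\<forall>k\<in>F. a k = 0"
  using assms
proof (induction F arbitrary: a rule: finite_induct)
  case (insert k0 F)
  let ?S = "\<Sum>k\<in>F. a k *s v k"
  have s0: "a k0 *s v k0 + ?S = 0" using insert by simp
  have "N *v (a k0 *s v k0 + ?S) = a k0 *s (\<mu> k0 *s v k0) + (\<Sum>k\<in>F. a k *s (\<mu> k *s v k))"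
  proof -
    have "N *v ?S = (\<Sum>k\<in>F. N *v (a k *s v k))"
      using vec.linear_sum[OF matrix_vector_mul_linear_gen] by blast
    also have "\<dots> = (\<Sum>k\<in>F. a k *s (\<mu> k *s v k))"
      by (intro sum.cong) (use insert.prems(2) in \<open>auto simp: vector_scalar_commute\<close>)
    finally show ?thesis
      using insert.prems(2)[of k0] by (simp add: matrix_vector_right_distrib vector_scalar_commute)
  qed
  moreover have "\<mu> k0 *s (a k0 *s v k0 + ?S) = \<mu> k0 *s (a k0 *s v k0) + (\<Sum>k\<in>F. \<mu> k0 *s (a k *s v k))"
    by (simp add: vec.scale_right_distrib vec.scale_sum_right)
  ultimately have "(\<Sum>k\<in>F. a k *s (\<mu> k *s v k)) - (\<Sum>k\<in>F. \<mu> k0 *s (a k *s v k)) = 0"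
    using s0 by (simp add: mult.commute) (metis add_left_imp_eq)
  then have "(\<Sum>k\<in>F. (a k * (\<mu> k - \<mu> k0)) *s v k) = 0"
    by (simp add: sum_subtractf[symmetric] vec.scale_left_diff_distrib algebra_simps)
  then have "\<forall>k\<in>F. a k * (\<mu> k - \<mu> k0) = 0"
    using insert.IH[of "\<lambda>k. a k * (\<mu> k - \<mu> k0)"] insert.prems by (auto simp: inj_on_def)
  moreover have "\<mu> k \<noteq> \<mu> k0" if "k \<in> F" for k
    using insert.prems(1) insert.hyps that by (auto simp: inj_on_def)
  ultimately have z: "\<forall>k\<in>F. a k = 0" by auto
  then have "?S = 0" by simp
  with s0 insert.prems(2)[of k0] have "a k0 = 0" by simp
  with z show ?case by simp
qed simp

lemma eig_matrix_exists:
  fixes N :: "complex ^ 'n ^ 'n"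
  assumes inj: "inj \<mu>" and spec: "range \<mu> = spectrum N"
  obtains V W :: "complex ^ 'n ^ 'n" where "V ** W = mat 1" "W ** V = mat 1" "N = eig_matrix V W \<mu>"
proof -
  have "\<forall>k. \<exists>v. v \<noteq> 0 \<and> N *v v = \<mu> k *s v"
    using spec by (force simp: spectrum_def)
  then obtain v where v: "\<And>k. v k \<noteq> 0" "\<And>k. N *v v k = \<mu> k *s v k" by metis
  define V where "V = (\<chi> i k. v k $ i)"
  have Vx: "V *v x = (\<Sum>k\<in>UNIV. x $ k *s v k)" for x
    by (simp add: V_def vec_eq_iff matrix_vector_mult_def mult.commute)
  have "x = 0" if "V *v x = 0" for x
    using eigenvectors_independent[of UNIV \<mu> N v "\<lambda>k. x $ k"] that v inj
    by (simp add: Vx vec_eq_iff)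
  then have "\<exists>W. W ** V = mat 1"
    by (simp add: matrix_left_invertible_ker)
  then obtain W where W: "W ** V = mat 1" by blast
  then have W': "V ** W = mat 1" by (simp add: matrix_left_right_inverse)
  have "(N ** V) $ i $ k = \<mu> k * v k $ i" for i k
    using v(2)[of k] by (simp add: V_def matrix_matrix_mult_def matrix_vector_mult_def vec_eq_iff)
  then have "(N ** V) ** W = eig_matrix V W \<mu>"
    by (subst matrix_matrix_mult_def) (simp add: eig_matrix_def V_def vec_eq_iff mult.commute)
  then have "N = eig_matrix V W \<mu>"
    by (simp add: matrix_mul_assoc[symmetric] W')
  with W W' that show thesis by blast
qed

lemma matrix_inv_eqI:
  assumes "A ** B = mat 1" "B ** A = mat (1 :: 'a :: semiring_1)"
  shows "matrix_inv A = B"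
proof -
  have "A ** matrix_inv A = mat 1 \<and> matrix_inv A ** A = mat 1"
    unfolding matrix_inv_def by (rule someI[of _ B]) (use assms in blast)
  then have "(matrix_inv A ** A) ** B = B" by simp
  then show ?thesis by (simp add: matrix_mul_assoc[symmetric] assms)
qed

locale eigenbasis =
  fixes V W :: "complex ^ 'n ^ 'n"
  assumes VW: "V ** W = mat 1" and WV: "W ** V = mat 1"
begin

abbreviation D where "D \<equiv> eig_matrix V W"

lemma VW_nth: "(\<Sum>k\<in>UNIV. V $ i $ k * W $ k $ j) = (if i = j then 1 else 0)"
  using VW by (simp add: vec_eq_iff matrix_matrix_mult_def mat_def)

lemma WV_nth: "(\<Sum>i\<in>UNIV. W $ k $ i * V $ i $ l) = (if k = l then 1 else 0)"
  using WV by (simp add: vec_eq_iff matrix_matrix_mult_def mat_def)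

lemma D_nth: "D f $ i $ j = (\<Sum>k\<in>UNIV. V $ i $ k * f k * W $ k $ j)"
  by (simp add: eig_matrix_def)

lemma D_mult: "D f ** D g = D (\<lambda>k. f k * g k)"
proof -
  have "(D f ** D g) $ i $ j = D (\<lambda>k. f k * g k) $ i $ j" for i j
  proof -
    have "(D f ** D g) $ i $ j =
        (\<Sum>l\<in>UNIV. \<Sum>k\<in>UNIV. \<Sum>k'\<in>UNIV. (V $ i $ k * f k) * (W $ k $ l * V $ l $ k') * (g k' * W $ k' $ j))"
      by (simp add: matrix_matrix_mult_def D_nth sum_product mult_ac)
    also have "\<dots> = (\<Sum>k\<in>UNIV. \<Sum>k'\<in>UNIV. \<Sum>l\<in>UNIV. (V $ i $ k * f k) * (W $ k $ l * V $ l $ k') * (g k' * W $ k' $ j))"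
      by (subst sum.swap) (intro sum.cong refl sum.swap)
    also have "\<dots> = (\<Sum>k\<in>UNIV. \<Sum>k'\<in>UNIV. (V $ i $ k * f k) * (\<Sum>l\<in>UNIV. W $ k $ l * V $ l $ k') * (g k' * W $ k' $ j))"
      by (simp add: sum_distrib_left sum_distrib_right)
    also have "\<dots> = (\<Sum>k\<in>UNIV. V $ i $ k * (f k * g k) * W $ k $ j)"
      unfolding WV_nth by (simp add: if_distrib if_distribR mult_ac cong: if_cong)
    finally show ?thesis by (simp add: D_nth)
  qed
  then show ?thesis by (simp add: vec_eq_iff)
qed

lemma D_const: "D (\<lambda>_. c) = mat c"
proof -
  have "(\<Sum>k\<in>UNIV. V $ i $ k * c * W $ k $ j) = c * (\<Sum>k\<in>UNIV. V $ i $ k * W $ k $ j)" for i j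
    by (simp add: sum_distrib_left mult_ac)
  then show ?thesis by (simp add: vec_eq_iff D_nth VW_nth mat_def)
qed

lemma D_diff: "D f - D g = D (\<lambda>k. f k - g k)"
  by (simp add: vec_eq_iff D_nth sum_subtractf algebra_simps)

lemma D_uminus: "- D f = D (\<lambda>k. - f k)"
  by (simp add: vec_eq_iff D_nth sum_negf)

lemma D_scaleR: "r *\<^sub>R D f = D (\<lambda>k. of_real r * f k)"
  by (simp add: vec_eq_iff D_nth scaleR_sum_right) (simp add: scaleR_conv_of_real mult_ac)

lemma D_inv:
  assumes "\<And>k. f k \<noteq> 0"
  shows "matrix_inv (D f) = D (\<lambda>k. 1 / f k)"
proof -
  have "D f ** D (\<lambda>k. 1 / f k) = mat 1" "D (\<lambda>k. 1 / f k) ** D f = mat 1"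
    by (simp_all add: D_mult assms D_const)
  then show ?thesis
    by (rule matrix_inv_eqI)
qed

lemma D_sums:
  assumes "\<And>k. (\<lambda>n. f n k) sums g k"
  shows "(\<lambda>n. D (f n)) sums D g"
proof -
  have *: "(\<lambda>N. \<Sum>n<N. D (f n) $ i $ j) \<longlonglongrightarrow> D g $ i $ j" for i j
    unfolding sums_def[symmetric] D_nth
    by (intro sums_sum sums_mult sums_mult2 assms)
  show ?thesis unfolding sums_def
    by (intro vec_tendstoI) (simp add: *)
qed

lemma spectrum_D: "spectrum (D f) = range f"
proof (intro equalityI subsetI)
  fix z assume "z \<in> spectrum (D f)"
  then obtain v where v: "v \<noteq> 0" "D f *v v = z *s v" by (auto simp: spectrum_def)
  show "z \<in> range f"
  proof (rule ccontr)
    assume z: "z \<notin> range f"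
    have "D (\<lambda>k. f k - z) *v v = D f *v v - mat z *v v"
      by (simp add: D_diff[symmetric] D_const matrix_vector_mult_diff_rdistrib)
    also have "mat z *v v = z *s v"
      by (simp add: vec_eq_iff matrix_vector_mult_def mat_def if_distrib if_distribR cong: if_cong)
    finally have 0: "D (\<lambda>k. f k - z) *v v = 0" using v by simp
    have "v = (D (\<lambda>k. 1 / (f k - z)) ** D (\<lambda>k. f k - z)) *v v"
    proof -
      have "f k - z \<noteq> 0" for k using z by auto
      then show ?thesis by (simp add: D_mult D_const)
    qed
    also have "\<dots> = 0" using 0 by (simp add: matrix_vector_mul_assoc[symmetric])
    finally show False using v by simp
  qed
next
  fix z assume "z \<in> range f"
  then obtain k where k: "z = f k" by auto
  have Vk: "(V *v axis k 1) $ i = V $ i $ k" for i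
    by (simp add: matrix_vector_mult_def axis_def if_distrib cong: if_cong)
  have "D f *v (V *v axis k 1) = z *s (V *v axis k 1)"
  proof -
    have "(D f *v (V *v axis k 1)) $ i = z * V $ i $ k" for i
    proof -
      have "(D f *v (V *v axis k 1)) $ i = (\<Sum>j\<in>UNIV. \<Sum>l\<in>UNIV. V $ i $ l * f l * (W $ l $ j * V $ j $ k))"
        by (simp add: Vk matrix_vector_mult_def[of "D f"] D_nth sum_distrib_right mult.assoc)
      also have "\<dots> = (\<Sum>l\<in>UNIV. V $ i $ l * f l * (\<Sum>j\<in>UNIV. W $ l $ j * V $ j $ k))"
        by (subst sum.swap) (simp add: sum_distrib_left)
      also have "\<dots> = z * V $ i $ k"
        by (simp add: WV_nth if_distrib k cong: if_cong)
      finally show ?thesis .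
    qed
    then show ?thesis
      by (simp add: vec_eq_iff Vk)
  qed
  moreover have "V *v axis k 1 \<noteq> (0::complex^'n)"
  proof
    assume "V *v axis k 1 = (0::complex^'n)"
    then have "(W ** V) *v axis k 1 = (0::complex^'n)"
      by (simp add: matrix_vector_mul_assoc[symmetric])
    then show False by (simp add: WV)
  qed
  ultimately show "z \<in> spectrum (D f)" by (auto simp: spectrum_def)
qed

text \<open>
  In the eigenbasis the entries of the resolvent are sums of the simple fractions
  \<open>V i k W k j / (w - f k)\<close>. Each residue in the functional calculus therefore comes from a simple
  pole and evaluates \<open>F\<close> at an eigenvalue.
\<close>

lemma fun_calc_D:
  assumes inj: "inj f" and an: "\<And>k. F analytic_on {f k}"
  shows "fun_calc F (D f) = D (\<lambda>k. F (f k))"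
proof -
  have res: "residue (\<lambda>w. F w * matrix_inv (mat w - D f) $ i $ j) (f k) = V $ i $ k * F (f k) * W $ k $ j"
    for i j k
  proof -
    obtain r where r: "r > 0" "F holomorphic_on ball (f k) r"
      using an[of k] by (auto simp: analytic_on_def)
    have "open (- f ` (- {k}))" by (simp add: finite_imp_closed open_Compl)
    moreover have "f k \<in> - f ` (- {k})" using inj by (auto simp: inj_def)
    ultimately have op: "open (ball (f k) r \<inter> - f ` (- {k}))" and mem: "f k \<in> ball (f k) r \<inter> - f ` (- {k})"
      using r by auto
    define g where "g w = F w * (V $ i $ k * W $ k $ j + (w - f k) * (\<Sum>l\<in>-{k}. V $ i $ l * W $ l $ j / (w - f l)))" for w
    have hol: "g holomorphic_on (ball (f k) r \<inter> - f ` (- {k}))"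
      unfolding g_def
      by (intro holomorphic_intros holomorphic_on_subset[OF r(2)]) auto
    have "eventually (\<lambda>w. w \<in> (ball (f k) r \<inter> - f ` (- {k})) - {f k}) (at (f k))"
      using op mem by (rule eventually_at_in_open)
    then have "eventually (\<lambda>w. F w * matrix_inv (mat w - D f) $ i $ j = g w / (w - f k)) (at (f k))"
    proof eventually_elim
      case (elim w)
      then have ne: "w - f l \<noteq> 0" for l by (cases "l = k") auto
      have "matrix_inv (mat w - D f) = D (\<lambda>l. 1 / (w - f l))"
        using D_inv[of "\<lambda>l. w - f l"] ne by (simp add: D_diff[symmetric] D_const)
      then have "matrix_inv (mat w - D f) $ i $ j = (\<Sum>l\<in>UNIV. V $ i $ l * W $ l $ j / (w - f l))"
        by (simp add: D_nth)
      also have "\<dots> = V $ i $ k * W $ k $ j / (w - f k) + (\<Sum>l\<in>-{k}. V $ i $ l * W $ l $ j / (w - f l))"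
        by (subst sum.remove[of _ k]) (auto simp: Compl_eq_Diff_UNIV)
      finally have "F w * matrix_inv (mat w - D f) $ i $ j =
        F w * (V $ i $ k * W $ k $ j / (w - f k) + (\<Sum>l\<in>-{k}. V $ i $ l * W $ l $ j / (w - f l)))"
        by simp
      also have "\<dots> = g w / (w - f k)"
        using ne[of k] by (simp add: g_def add_divide_distrib distrib_left)
      finally show ?case .
    qed
    then have "residue (\<lambda>w. F w * matrix_inv (mat w - D f) $ i $ j) (f k) = residue (\<lambda>w. g w / (w - f k)) (f k)"
      by (rule residue_cong) simp
    also have "\<dots> = g (f k)"
      by (rule residue_simple[OF op mem hol])
    finally show ?thesis by (simp add: g_def)
  qed
  have "(\<Sum>z\<in>range f. residue (\<lambda>w. F w * matrix_inv (mat w - D f) $ i $ j) z) = D (\<lambda>k. F (f k)) $ i $ j" for i j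
    by (subst sum.reindex[OF inj]) (simp add: res D_nth)
  then show ?thesis
    by (simp add: fun_calc_def spectrum_D vec_eq_iff)
qed

lemma trace_D: "trace (D f) = (\<Sum>k\<in>UNIV. f k)"
proof -
  have "trace (D f) = (\<Sum>i\<in>UNIV. \<Sum>k\<in>UNIV. f k * (W $ k $ i * V $ i $ k))"
    by (simp add: trace_def D_nth mult_ac)
  also have "\<dots> = (\<Sum>k\<in>UNIV. f k * (\<Sum>i\<in>UNIV. W $ k $ i * V $ i $ k))"
    by (subst sum.swap) (simp add: sum_distrib_left)
  finally show ?thesis by (simp add: WV_nth)
qed

end


section \<open>The phase-type semigroup\<close>

lemma matrix_pow_entry_bound:
  fixes A :: "real ^ 'n ^ 'n"
  shows "\<bar>((**) A ^^ k) (mat 1) $ i $ j\<bar> \<le> (\<Sum>i\<in>UNIV. \<Sum>l\<in>UNIV. \<bar>A $ i $ l\<bar>) ^ k"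
proof (induction k arbitrary: i)
  case (Suc k)
  let ?c = "\<Sum>i\<in>UNIV. \<Sum>l\<in>UNIV. \<bar>A $ i $ l\<bar>"
  have "\<bar>((**) A ^^ Suc k) (mat 1) $ i $ j\<bar> \<le> (\<Sum>l\<in>UNIV. \<bar>A $ i $ l\<bar> * ?c ^ k)"
    unfolding funpow.simps o_def
    by (subst matrix_matrix_mult_def)
       (auto intro!: order_trans[OF sum_abs] sum_mono mult_left_mono Suc simp: abs_mult)
  also have "\<dots> = (\<Sum>l\<in>UNIV. \<bar>A $ i $ l\<bar>) * ?c ^ k" by (simp add: sum_distrib_right)
  also have "\<dots> \<le> ?c * ?c ^ k"
    by (intro mult_right_mono zero_le_power sum_nonneg member_le_sum[where f = "\<lambda>i. \<Sum>l\<in>UNIV. \<bar>A $ i $ l\<bar>"]) auto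
  finally show ?case by simp
qed (simp add: mat_def)

text \<open>
  Limits of matrices are taken entrywise, and each entry of the series is dominated by a scalar
  exponential series.
\<close>

lemma matrix_exp_nth_sums:
  fixes A :: "real ^ 'n ^ 'n"
  shows "(\<lambda>k. ((**) A ^^ k) (mat 1) $ i $ j / fact k) sums (matrix_exp A $ i $ j)"
proof -
  let ?t = "\<lambda>i j k. ((**) A ^^ k) (mat 1) $ i $ j / fact k"
  define c where "c = (\<Sum>i\<in>UNIV. \<Sum>l\<in>UNIV. \<bar>A $ i $ l\<bar>)"
  have "summable (?t i j)" for i j
  proof (rule summable_comparison_test')
    show "summable (\<lambda>k. c ^ k / fact k)"
      using summable_exp[of c] by (simp add: field_simps)
    show "norm (?t i j k) \<le> c ^ k / fact k" if "k \<ge> 0" for k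
      using matrix_pow_entry_bound[where A = A and k = k and i = i and j = j] by (simp add: c_def divide_right_mono)
  qed
  then have *: "(\<lambda>N. \<Sum>k<N. ?t i j k) \<longlonglongrightarrow> suminf (?t i j)" for i j
    using summable_sums sums_def by blast
  have "(\<lambda>k. (1 / fact k) *\<^sub>R (((**) A ^^ k) (mat 1))) sums (\<chi> i j. suminf (?t i j))"
    unfolding sums_def
    by (intro vec_tendstoI) (use * in \<open>simp add: divide_inverse mult.commute\<close>)
  then have "matrix_exp A = (\<chi> i j. suminf (?t i j))"
    unfolding matrix_exp_def by (rule sums_unique[symmetric])
  then show ?thesis
    using * by (simp add: sums_def)
qed

lemma matrix_exp_nonneg:
  fixes A :: "real ^ 'n ^ 'n"
  assumes "\<And>i j. 0 \<le> A $ i $ j"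
  shows "0 \<le> matrix_exp A $ i $ j"
proof -
  have "0 \<le> ((**) A ^^ k) (mat 1) $ i $ j" for k i
  proof (induction k arbitrary: i)
    case (Suc k)
    then show ?case unfolding funpow.simps o_def
      by (subst matrix_matrix_mult_def) (auto intro!: sum_nonneg mult_nonneg_nonneg assms)
  qed (simp add: mat_def)
  then show ?thesis
    by (intro sums_le[OF _ sums_zero matrix_exp_nth_sums]) simp
qed

lemma hat_generator_nth:
  "hat_generator A $ None $ j = 0"
  "hat_generator A $ Some k $ None = exit_rates A $ k"
  "hat_generator A $ Some k $ Some l = A $ k $ l"
  by (simp_all add: hat_generator_def)

text \<open>
  The row of the absorbing state vanishes, so the powers are block triangular.
\<close>

lemma hat_generator_pow:
  "((**) (hat_generator A) ^^ k) (mat 1) $ Some i $ Some j = ((**) A ^^ k) (mat 1) $ i $ j"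
  "((**) (hat_generator A) ^^ k) (mat 1) $ None $ Some j = 0"
proof (induction k arbitrary: i)
  case (Suc k)
  { case 1 show ?case unfolding funpow.simps o_def
      by (subst (1 2) matrix_matrix_mult_def)
         (simp add: Suc UNIV_option_conv sum.reindex hat_generator_nth) }
  { case 2 show ?case unfolding funpow.simps o_def
      by (subst matrix_matrix_mult_def) (simp add: hat_generator_nth) }
qed (simp_all add: mat_def)

lemma hat_generator_scaleR: "t *\<^sub>R hat_generator A = hat_generator (t *\<^sub>R A)"
  by (simp add: vec_eq_iff hat_generator_def exit_rates_def matrix_vector_mult_def sum_distrib_left
      split: option.split)

lemma matrix_exp_hat_generator:
  "matrix_exp (t *\<^sub>R hat_generator A) $ Some i $ Some j = matrix_exp (t *\<^sub>R A) $ i $ j"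
  "matrix_exp (t *\<^sub>R hat_generator A) $ None $ Some j = 0"
  using matrix_exp_nth_sums[of "hat_generator (t *\<^sub>R A)" "Some i" "Some j"]
    matrix_exp_nth_sums[of "t *\<^sub>R A" i j]
    matrix_exp_nth_sums[of "hat_generator (t *\<^sub>R A)" None "Some j"]
  by (auto simp: hat_generator_pow hat_generator_scaleR intro: sums_unique2)

context eigenbasis
begin

lemma matrix_exp_D:
  assumes "cmat A = D f"
  shows "complex_of_real (matrix_exp A $ i $ j) = D (\<lambda>k. exp (f k)) $ i $ j"
proof -
  have pow: "complex_of_real (((**) A ^^ n) (mat 1) $ i $ j) = D (\<lambda>k. f k ^ n) $ i $ j" for n i j
  proof (induction n arbitrary: i)
    case 0
    show ?case by (simp add: D_const) (simp add: mat_def)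
  next
    case (Suc n)
    have A: "complex_of_real (A $ i $ j) = D f $ i $ j" for i j
      using assms by (simp add: vec_eq_iff)
    have "complex_of_real (((**) A ^^ Suc n) (mat 1) $ i $ j) = (D f ** D (\<lambda>k. f k ^ n)) $ i $ j"
      unfolding funpow.simps o_def
      by (subst (1 2) matrix_matrix_mult_def) (simp add: A Suc)
    then show ?case by (simp add: D_mult)
  qed
  have "(\<lambda>n. complex_of_real (((**) A ^^ n) (mat 1) $ i $ j / fact n)) sums of_real (matrix_exp A $ i $ j)"
    by (rule sums_of_real[OF matrix_exp_nth_sums])
  moreover have "(\<lambda>n. \<Sum>k\<in>UNIV. V $ i $ k * (f k ^ n /\<^sub>R fact n) * W $ k $ j) sums D (\<lambda>k. exp (f k)) $ i $ j"
    unfolding D_nth by (intro sums_sum sums_mult sums_mult2 exp_converges)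
  moreover have "(\<Sum>k\<in>UNIV. V $ i $ k * (f k ^ n /\<^sub>R fact n) * W $ k $ j) =
      complex_of_real (((**) A ^^ n) (mat 1) $ i $ j / fact n)" for n
    unfolding of_real_divide pow D_nth sum_divide_distrib
    by (intro sum.cong refl) (simp add: scaleR_conv_of_real field_simps)
  ultimately show ?thesis by (simp add: sums_unique2)
qed

end

text \<open>
  The numbers \<open>\<mu> k\<close> are the eigenvalues of \<open>- Q\<close>, so that \<open>exp (tQ)\<close> has the eigenvalues
  \<open>exp (- t \<mu> k)\<close>, which will turn out to decay.
\<close>

locale phase_type = eigenbasis V W
  for V W :: "complex ^ 'm ^ 'm" +
  fixes Q :: "real ^ 'm ^ 'm" and \<alpha> :: "real ^ 'm" and \<mu> :: "'m \<Rightarrow> complex"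
  assumes generator: "phasetype_matrix Q" and initial: "prob_vector \<alpha>"
    and inj_eig: "inj \<mu>" and Q_D: "cmat Q = D (\<lambda>k. - \<mu> k)"
begin

text \<open>
  Coordinates of the row vector \<open>\<alpha>\<close> and of the column vector \<open>q\<close> in the eigenbasis; every rational
  transform below is a sum of simple fractions with these coordinates in the numerators.
\<close>

definition init_coord :: "'m \<Rightarrow> complex" where "init_coord k = (\<Sum>i\<in>UNIV. of_real (\<alpha> $ i) * V $ i $ k)"

definition exit_coord :: "'m \<Rightarrow> complex" where "exit_coord k = (\<Sum>i\<in>UNIV. W $ k $ i * of_real (exit_rates Q $ i))"

text \<open>
  The row vector \<open>\<alpha> exp (tQ)\<close>: its entry \<open>i\<close> is the probability of being in the transient state \<open>i\<close>
  at time \<open>t\<close>. Paired with the exit rates it gives the phase-type density \<open>\<alpha> exp (tQ) q\<close>.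
\<close>

definition occ :: "real \<Rightarrow> 'm \<Rightarrow> real" where
  "occ t i = (\<Sum>k\<in>UNIV. \<alpha> $ k * matrix_exp (t *\<^sub>R Q) $ k $ i)"

definition dens :: "real \<Rightarrow> real" where "dens t = (\<Sum>i\<in>UNIV. occ t i * exit_rates Q $ i)"

lemma Q_offdiag: "i \<noteq> j \<Longrightarrow> 0 \<le> Q $ i $ j"
  and exit_nonneg: "0 \<le> exit_rates Q $ i"
proof -
  have g: "is_generator (hat_generator Q)" using generator by (simp add: phasetype_matrix_def)
  show "i \<noteq> j \<Longrightarrow> 0 \<le> Q $ i $ j"
    using g unfolding is_generator_def by (metis hat_generator_nth(3) option.inject)
  have "0 \<le> hat_generator Q $ Some i $ None" using g unfolding is_generator_def by blast
  then show "0 \<le> exit_rates Q $ i" by (simp add: hat_generator_def)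
qed

lemma cmat_scale: "cmat (t *\<^sub>R Q) = D (\<lambda>k. - of_real t * \<mu> k)"
proof -
  have "cmat (t *\<^sub>R Q) = t *\<^sub>R cmat Q" by (simp add: vec_eq_iff) (simp add: scaleR_conv_of_real)
  then show ?thesis by (simp add: Q_D D_scaleR)
qed

lemma transition_D: "complex_of_real (matrix_exp (t *\<^sub>R Q) $ i $ j) = (\<Sum>k\<in>UNIV. V $ i $ k * exp (- of_real t * \<mu> k) * W $ k $ j)"
  by (simp add: matrix_exp_D[OF cmat_scale] D_nth)

text \<open>
  \<open>exp (tQ) = exp (- tc) exp (t(Q + c))\<close>, and for large \<open>c\<close> the matrix \<open>Q + c\<close> has no negative
  entry.
\<close>

lemma transition_nonneg:
  assumes "0 \<le> t" shows "0 \<le> matrix_exp (t *\<^sub>R Q) $ i $ j"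
proof -
  \<comment> \<open>the diagonal entries are the only negative ones\<close>
  define c where "c = (\<Sum>i\<in>UNIV. \<bar>Q $ i $ i\<bar>)"
  have c: "- Q $ i $ i \<le> c" for i
    using member_le_sum[of i UNIV "\<lambda>i. \<bar>Q $ i $ i\<bar>"] by (simp add: c_def)
  have "0 \<le> (t *\<^sub>R (Q + mat c)) $ i $ j" for i j
    using c[of i] Q_offdiag[of i j] assms by (cases "i = j") (auto simp: mat_def)
  then have nn: "0 \<le> matrix_exp (t *\<^sub>R (Q + mat c)) $ i $ j"
    by (rule matrix_exp_nonneg)
  have "cmat (t *\<^sub>R (Q + mat c)) = t *\<^sub>R (cmat Q - mat (- of_real c))"
    by (simp add: vec_eq_iff mat_def) (simp add: scaleR_conv_of_real algebra_simps)
  also have "\<dots> = D (\<lambda>k. of_real (t * c) + - of_real t * \<mu> k)"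
    by (simp add: Q_D D_const[symmetric] D_diff D_scaleR algebra_simps)
  finally have "complex_of_real (matrix_exp (t *\<^sub>R (Q + mat c)) $ i $ j)
     = exp (of_real (t * c)) * complex_of_real (matrix_exp (t *\<^sub>R Q) $ i $ j)"
    unfolding transition_D D_nth sum_distrib_left
    by (subst matrix_exp_D, assumption)
       (simp only: D_nth, intro sum.cong refl, simp add: exp_add exp_diff exp_minus field_simps)
  also have "\<dots> = complex_of_real (exp (t * c) * matrix_exp (t *\<^sub>R Q) $ i $ j)"
    by (simp add: exp_of_real[symmetric])
  finally have "matrix_exp (t *\<^sub>R (Q + mat c)) $ i $ j = exp (t * c) * matrix_exp (t *\<^sub>R Q) $ i $ j"
    using of_real_eq_iff by blast
  then show ?thesis using nn by (simp add: zero_le_mult_iff not_less)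
qed

lemma trace_transition:
  "complex_of_real (\<Sum>i\<in>UNIV. matrix_exp (t *\<^sub>R Q) $ i $ i) = (\<Sum>k\<in>UNIV. exp (- of_real t * \<mu> k))"
  using trace_D[of "\<lambda>k. exp (- of_real t * \<mu> k)"]
  by (simp add: trace_def D_nth transition_D)

lemma continuous_transition: "continuous_on UNIV (\<lambda>t. matrix_exp (t *\<^sub>R Q) $ i $ j)"
proof -
  have "continuous_on UNIV (\<lambda>t. Re (complex_of_real (matrix_exp (t *\<^sub>R Q) $ i $ j)))"
    unfolding transition_D by (intro continuous_intros)
  then show ?thesis by simp
qed

text \<open>
  The trace \<open>f t = \<Sum>k. exp (- t \<mu> k)\<close> of \<open>exp (tQ)\<close> is nonnegative, and transience makes it
  integrable over the half line. Let \<open>\<mu> j\<close> have the smallest real part and suppose that this is not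
  positive. Then \<open>f t exp (t \<mu> j)\<close> is bounded by \<open>f t\<close>, so that its integrals over \<open>[0, N]\<close> stay
  bounded. But these integrals equal \<open>N\<close> plus a bounded term, because the other exponents
  \<open>\<mu> j - \<mu> k\<close> are nonzero and their real parts are not positive.
\<close>

lemma Re_eig_pos: "0 < Re (\<mu> k)"
proof -
  define f where "f t = (\<Sum>i\<in>UNIV. matrix_exp (t *\<^sub>R Q) $ i $ i)" for t
  have f_nn: "0 \<le> f t" if "0 \<le> t" for t
    unfolding f_def by (intro sum_nonneg transition_nonneg that)
  have f_cont: "continuous_on S f" for S
    unfolding f_def by (intro continuous_on_sum continuous_on_subset[OF continuous_transition]) auto
  have f_meas: "(\<lambda>t. matrix_exp (t *\<^sub>R Q) $ i $ i) \<in> borel_measurable borel" for i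
    using continuous_transition by (intro borel_measurable_continuous_onI)
  have "(\<integral>\<^sup>+ t. ennreal (f t) * indicator {0..} t \<partial>lborel) =
      (\<integral>\<^sup>+ t. (\<Sum>i\<in>UNIV. ennreal (matrix_exp (t *\<^sub>R Q) $ i $ i) * indicator {0..} t) \<partial>lborel)"
    by (intro nn_integral_cong) (auto simp: f_def sum_ennreal transition_nonneg split: split_indicator)
  also have "\<dots> = (\<Sum>i\<in>UNIV. \<integral>\<^sup>+ t. ennreal (matrix_exp (t *\<^sub>R Q) $ i $ i) * indicator {0..} t \<partial>lborel)"
    using f_meas by (intro nn_integral_sum borel_measurable_times_ennreal) auto
  also have "\<dots> < \<infinity>"
    using generator
    by (auto simp: phasetype_matrix_def transient_state_def matrix_exp_hat_generator)
  finally have "(\<integral>\<^sup>+ t. ennreal (f t) * indicator {0..} t \<partial>lborel) < \<infinity>" .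
  then obtain C where C0: "0 \<le> C" and C: "(\<integral>\<^sup>+ t. ennreal (f t) * indicator {0..} t \<partial>lborel) = ennreal C"
    by (auto simp: less_top_ennreal)
  have int_f: "integral {0..N} f \<le> C" if "0 \<le> N" for N
  proof -
    have "f integrable_on {0..N}" using f_cont by (rule integrable_continuous_real)
    then have "(\<integral>\<^sup>+ t. ennreal (f t) * indicator {0..N} t \<partial>lborel) = ennreal (integral {0..N} f)"
      by (intro nn_integral_has_integral_lebesgue' integrable_integral) (auto intro: f_nn)
    moreover have "(\<integral>\<^sup>+ t. ennreal (f t) * indicator {0..N} t \<partial>lborel) \<le> (\<integral>\<^sup>+ t. ennreal (f t) * indicator {0..} t \<partial>lborel)"
      by (intro nn_integral_mono) (auto split: split_indicator)
    ultimately show ?thesis using C0 C by simp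
  qed
  define j where "j = (ARG_MIN (\<lambda>k. Re (\<mu> k)) k. k \<in> UNIV)"
  have j: "Re (\<mu> j) \<le> Re (\<mu> k)" for k
    unfolding j_def using arg_min_if_finite(2)[of UNIV "\<lambda>k. Re (\<mu> k)"]
    by (metis UNIV_I UNIV_not_empty arg_min_on_def finite_code not_le_imp_less)
  have "0 < Re (\<mu> j)"
  proof (rule ccontr)
    assume neg: "\<not> 0 < Re (\<mu> j)"
    define g where "g t = complex_of_real (f t) * exp (of_real t * \<mu> j)" for t
    have g_eq: "g t = 1 + (\<Sum>k\<in>-{j}. exp (of_real t * (\<mu> j - \<mu> k)))" for t
    proof -
      have "g t = (\<Sum>k\<in>UNIV. exp (of_real t * (\<mu> j - \<mu> k)))"
        unfolding g_def f_def trace_transition sum_distrib_right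
        by (intro sum.cong refl) (simp add: exp_add[symmetric] algebra_simps)
      also have "\<dots> = 1 + (\<Sum>k\<in>-{j}. exp (of_real t * (\<mu> j - \<mu> k)))"
        by (subst sum.remove[of _ j]) (auto simp: Compl_eq_Diff_UNIV)
      finally show ?thesis .
    qed
    define B where "B = (\<Sum>k\<in>-{j}. 2 / norm (\<mu> j - \<mu> k))"
    have "N \<le> C + B" if N: "0 \<le> N" for N :: real
    proof -
      have k: "((\<lambda>t. exp (of_real t * (\<mu> j - \<mu> k))) has_integral
          (exp (of_real N * (\<mu> j - \<mu> k)) / (\<mu> j - \<mu> k) - exp (of_real 0 * (\<mu> j - \<mu> k)) / (\<mu> j - \<mu> k))) {0..N}"
        if "k \<in> -{j}" for k
      proof -
        have ne: "\<mu> j - \<mu> k \<noteq> 0" using that inj_eig by (auto simp: inj_def)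
        show ?thesis
          by (rule fundamental_theorem_of_calculus[OF N])
             (use ne in \<open>auto intro!: derivative_eq_intros has_vector_derivative_real_field\<close>)
      qed
      have hi: "(g has_integral (of_real N + (\<Sum>k\<in>-{j}. exp (of_real N * (\<mu> j - \<mu> k)) / (\<mu> j - \<mu> k) - exp (of_real 0 * (\<mu> j - \<mu> k)) / (\<mu> j - \<mu> k)))) {0..N}"
        unfolding g_eq
        using has_integral_const_real[of "1::complex" 0 N] N
        by (intro has_integral_add has_integral_sum k) (auto simp: scaleR_conv_of_real)
      have "norm (integral {0..N} g) \<le> integral {0..N} f"
      proof (rule integral_norm_bound_integral)
        show "g integrable_on {0..N}" using hi by blast
        show "f integrable_on {0..N}" using f_cont by (rule integrable_continuous_real)
        fix t assume t: "t \<in> {0..N}"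
        have "norm (exp (of_real t * \<mu> j)) \<le> 1"
          using neg t by (simp add: mult_nonneg_nonpos)
        then show "norm (g t) \<le> f t" using f_nn[of t] t
          by (simp add: g_def norm_mult mult_left_le)
      qed
      also have "\<dots> \<le> C" by (rule int_f[OF N])
      finally have 1: "norm (of_real N + (\<Sum>k\<in>-{j}. exp (of_real N * (\<mu> j - \<mu> k)) / (\<mu> j - \<mu> k) - exp (of_real 0 * (\<mu> j - \<mu> k)) / (\<mu> j - \<mu> k))) \<le> C"
        (is "norm (of_real N + ?S) \<le> C") using hi by (simp add: integral_unique)
      have 2: "norm ?S \<le> B"
        unfolding B_def
      proof (intro sum_norm_le)
        fix k assume "k \<in> -{j}"
        have "norm (exp (of_real N * (\<mu> j - \<mu> k))) \<le> 1"
          using j[of k] N by (simp add: mult_nonneg_nonpos)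
        then have "norm (exp (of_real N * (\<mu> j - \<mu> k)) - 1) \<le> 2"
          using norm_triangle_ineq4[of "exp (of_real N * (\<mu> j - \<mu> k))" 1] unfolding norm_one by linarith
        then show "norm (exp (of_real N * (\<mu> j - \<mu> k)) / (\<mu> j - \<mu> k) - exp (of_real 0 * (\<mu> j - \<mu> k)) / (\<mu> j - \<mu> k)) \<le> 2 / norm (\<mu> j - \<mu> k)"
          by (simp add: diff_divide_distrib[symmetric] norm_divide divide_right_mono)
      qed
      have "N = norm (complex_of_real N)" using N by simp
      also have "\<dots> \<le> norm (of_real N + ?S) + norm ?S"
        using norm_triangle_ineq4[of "of_real N + ?S" ?S] by simp
      finally show ?thesis using 1 2 by simp
    qed
    from this[of "max 0 (C + B + 1)"] show False by simp
  qed
  with j[of k] show ?thesis by simp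
qed

lemma occ_nonneg: "0 \<le> t \<Longrightarrow> 0 \<le> occ t i"
  unfolding occ_def using initial
  by (intro sum_nonneg mult_nonneg_nonneg transition_nonneg) (auto simp: prob_vector_def)

lemma dens_nonneg: "0 \<le> t \<Longrightarrow> 0 \<le> dens t"
  unfolding dens_def by (intro sum_nonneg mult_nonneg_nonneg occ_nonneg exit_nonneg)

lemma occ_D: "complex_of_real (occ t i) = (\<Sum>k\<in>UNIV. init_coord k * exp (- of_real t * \<mu> k) * W $ k $ i)"
proof -
  have "complex_of_real (occ t i) =
      (\<Sum>l\<in>UNIV. \<Sum>k\<in>UNIV. of_real (\<alpha> $ l) * V $ l $ k * exp (- of_real t * \<mu> k) * W $ k $ i)"
    by (simp add: occ_def transition_D sum_distrib_left mult_ac)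
  also have "\<dots> = (\<Sum>k\<in>UNIV. init_coord k * exp (- of_real t * \<mu> k) * W $ k $ i)"
    by (subst sum.swap) (simp add: init_coord_def sum_distrib_right)
  finally show ?thesis .
qed

lemma occ_V: "(\<Sum>i\<in>UNIV. complex_of_real (occ t i) * V $ i $ k) = init_coord k * exp (- of_real t * \<mu> k)"
proof -
  have "(\<Sum>i\<in>UNIV. complex_of_real (occ t i) * V $ i $ k) =
      (\<Sum>l\<in>UNIV. \<Sum>i\<in>UNIV. init_coord l * exp (- of_real t * \<mu> l) * (W $ l $ i * V $ i $ k))"
    by (subst sum.swap) (simp add: occ_D sum_distrib_left sum_distrib_right mult_ac)
  also have "\<dots> = (\<Sum>l\<in>UNIV. init_coord l * exp (- of_real t * \<mu> l) * (if l = k then 1 else 0))"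
    by (simp add: sum_distrib_left[symmetric] WV_nth)
  also have "\<dots> = init_coord k * exp (- of_real t * \<mu> k)"
    by (simp add: if_distrib cong: if_cong)
  finally show ?thesis .
qed

lemma dens_D: "complex_of_real (dens t) = (\<Sum>k\<in>UNIV. init_coord k * exit_coord k * exp (- of_real t * \<mu> k))"
proof -
  have "complex_of_real (dens t) =
      (\<Sum>k\<in>UNIV. \<Sum>i\<in>UNIV. init_coord k * exp (- of_real t * \<mu> k) * (W $ k $ i * of_real (exit_rates Q $ i)))"
    by (subst sum.swap) (simp add: dens_def occ_D sum_distrib_left sum_distrib_right mult_ac)
  then show ?thesis by (simp add: exit_coord_def sum_distrib_left mult_ac)
qed

lemma exit_coord_eq: "exit_coord k = \<mu> k * (\<Sum>i\<in>UNIV. W $ k $ i)"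
proof -
  have e: "complex_of_real (exit_rates Q $ i) = (\<Sum>j\<in>UNIV. \<Sum>l\<in>UNIV. V $ i $ l * \<mu> l * W $ l $ j)" for i
  proof -
    have "complex_of_real (Q $ i $ j) = - (\<Sum>l\<in>UNIV. V $ i $ l * \<mu> l * W $ l $ j)" for j
      using Q_D by (simp add: vec_eq_iff D_nth sum_negf)
    then show ?thesis by (simp add: exit_rates_def matrix_vector_mult_def sum_negf)
  qed
  have "exit_coord k = (\<Sum>i\<in>UNIV. \<Sum>j\<in>UNIV. \<Sum>l\<in>UNIV. (W $ k $ i * V $ i $ l) * (\<mu> l * W $ l $ j))"
    by (simp add: exit_coord_def e sum_distrib_left mult_ac)
  also have "\<dots> = (\<Sum>j\<in>UNIV. \<Sum>l\<in>UNIV. \<Sum>i\<in>UNIV. (W $ k $ i * V $ i $ l) * (\<mu> l * W $ l $ j))"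
    by (subst sum.swap) (intro sum.cong refl sum.swap)
  also have "\<dots> = (\<Sum>j\<in>UNIV. \<Sum>l\<in>UNIV. (if k = l then 1 else 0) * (\<mu> l * W $ l $ j))"
    by (simp add: sum_distrib_right[symmetric] WV_nth)
  also have "\<dots> = \<mu> k * (\<Sum>i\<in>UNIV. W $ k $ i)"
    by (simp add: mult_delta_left sum_distrib_left)
  finally show ?thesis .
qed

lemma sum_occ_D: "complex_of_real (\<Sum>i\<in>UNIV. occ t i) = (\<Sum>k\<in>UNIV. init_coord k * exit_coord k / \<mu> k * exp (- of_real t * \<mu> k))"
proof -
  have ne: "\<mu> k \<noteq> 0" for k using Re_eig_pos[of k] by auto
  have "complex_of_real (\<Sum>i\<in>UNIV. occ t i) = (\<Sum>k\<in>UNIV. \<Sum>i\<in>UNIV. init_coord k * exp (- of_real t * \<mu> k) * W $ k $ i)"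
    by (subst sum.swap) (simp add: occ_D)
  moreover have "(\<Sum>i\<in>UNIV. init_coord k * exp (- of_real t * \<mu> k) * W $ k $ i) =
      init_coord k * exit_coord k / \<mu> k * exp (- of_real t * \<mu> k)" for k
    unfolding sum_distrib_left[symmetric] exit_coord_eq using ne[of k] by simp
  ultimately show ?thesis by simp
qed

lemma coord_sum: "(\<Sum>k\<in>UNIV. init_coord k * exit_coord k / \<mu> k) = 1"
proof -
  have "matrix_exp (0 *\<^sub>R Q) $ i $ j = (if i = j then 1 else 0)" for i j
  proof -
    have "complex_of_real (matrix_exp (0 *\<^sub>R Q) $ i $ j) = of_real (if i = j then 1 else 0)"
      unfolding transition_D using VW_nth[of i j] by simp
    then show ?thesis using of_real_eq_iff by blast
  qed
  then have "occ 0 i = \<alpha> $ i" for i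
    unfolding occ_def by (simp only: mult_delta_right) simp
  then have "(\<Sum>i\<in>UNIV. occ 0 i) = 1" using initial by (simp add: prob_vector_def)
  then show ?thesis using sum_occ_D[of 0] by simp
qed

lemma resolvent_D:
  assumes "u \<notin> range \<mu>"
  shows "resolvent Q u = D (\<lambda>k. 1 / (\<mu> k - u))"
proof -
  have "mat (- u) - cmat Q = D (\<lambda>k. \<mu> k - u)"
    by (simp add: Q_D D_const[symmetric] D_diff)
  moreover have "\<mu> k - u \<noteq> 0" for k using assms by auto
  ultimately show ?thesis by (simp add: D_inv)
qed

lemma scalar_product_D:
  "scalar_product (a v* D f) (cvec (exit_rates Q)) = (\<Sum>k\<in>UNIV. (\<Sum>i\<in>UNIV. a $ i * V $ i $ k) * f k * exit_coord k)"
proof -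
  have "scalar_product (a v* D f) (cvec (exit_rates Q)) =
     (\<Sum>j\<in>UNIV. \<Sum>i\<in>UNIV. \<Sum>k\<in>UNIV. a $ i * V $ i $ k * f k * (W $ k $ j * of_real (exit_rates Q $ j)))"
    by (simp add: scalar_product_def vector_matrix_mult_def cvec_def D_nth sum_distrib_left sum_distrib_right mult_ac)
  also have "\<dots> = (\<Sum>j\<in>UNIV. \<Sum>k\<in>UNIV. \<Sum>i\<in>UNIV. a $ i * V $ i $ k * f k * (W $ k $ j * of_real (exit_rates Q $ j)))"
    by (intro sum.cong refl sum.swap)
  also have "\<dots> = (\<Sum>k\<in>UNIV. \<Sum>j\<in>UNIV. \<Sum>i\<in>UNIV. a $ i * V $ i $ k * f k * (W $ k $ j * of_real (exit_rates Q $ j)))"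
    by (rule sum.swap)
  also have "\<dots> = (\<Sum>k\<in>UNIV. (\<Sum>i\<in>UNIV. a $ i * V $ i $ k) * f k * exit_coord k)"
    by (intro sum.cong refl, subst sum.swap)
       (simp add: exit_coord_def sum_distrib_left sum_distrib_right mult_ac)
  finally show ?thesis .
qed

lemma phasetype_transform_D:
  assumes "u \<notin> range \<mu>"
  shows "phasetype_transform Q a u = (\<Sum>k\<in>UNIV. (\<Sum>i\<in>UNIV. a $ i * V $ i $ k) * exit_coord k / (\<mu> k - u))"
  by (simp add: phasetype_transform_def resolvent_D[OF assms] scalar_product_D)

lemma exp_psi1_D:
  assumes "u \<notin> range \<mu>"
  shows "exp_psi1 Q \<alpha> u = (\<Sum>k\<in>UNIV. init_coord k * exit_coord k / (\<mu> k - u))"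
  by (simp add: exp_psi1_def phasetype_transform_D[OF assms] init_coord_def cvec_def)

lemma exp_psi_unit_D:
  assumes "u \<notin> range \<mu>"
  shows "exp_psi_unit Q i u = (\<Sum>k\<in>UNIV. V $ i $ k * exit_coord k / (\<mu> k - u))"
  by (simp add: exp_psi_unit_def phasetype_transform_D[OF assms] axis_def mult_delta_left)

text \<open>
  Over a bounded interval the exponential moment of the phase-type density exists for every \<open>v\<close>,
  also where the moment over the half line diverges. It is the rational extension at \<open>v\<close> minus
  \<open>exp (v c)\<close> times the same extension for the residual life time after \<open>c\<close>, whose initial law is the
  state vector at time \<open>c\<close>. This identity takes the place of an analytic continuation in \<open>v\<close>.
\<close>

lemma exp_dens_has_integral:
  assumes "0 \<le> c" "v \<notin> range \<mu>"
  shows "((\<lambda>s. exp (v * of_real s) * of_real (dens s)) has_integral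
     (exp_psi1 Q \<alpha> v - exp (v * of_real c) * (\<Sum>i\<in>UNIV. of_real (occ c i) * exp_psi_unit Q i v))) {0..c}"
proof -
  have ne: "v - \<mu> k \<noteq> 0" for k using assms by auto
  let ?F = "\<lambda>k s. init_coord k * exit_coord k * (exp (of_real s * (v - \<mu> k)) / (v - \<mu> k))"
  have "((\<lambda>s. \<Sum>k\<in>UNIV. init_coord k * exit_coord k * exp (of_real s * (v - \<mu> k))) has_integral (\<Sum>k\<in>UNIV. ?F k c - ?F k 0)) {0..c}"
    by (intro has_integral_sum fundamental_theorem_of_calculus assms)
       (use ne in \<open>auto intro!: derivative_eq_intros has_vector_derivative_real_field\<close>)
  moreover have "(\<Sum>k\<in>UNIV. init_coord k * exit_coord k * exp (of_real s * (v - \<mu> k))) = exp (v * of_real s) * of_real (dens s)" for s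
    by (simp add: dens_D sum_distrib_left algebra_simps exp_diff exp_minus divide_inverse)
  moreover have "(\<Sum>k\<in>UNIV. ?F k c - ?F k 0) =
     exp_psi1 Q \<alpha> v - exp (v * of_real c) * (\<Sum>i\<in>UNIV. of_real (occ c i) * exp_psi_unit Q i v)"
  proof -
    have "(\<Sum>i\<in>UNIV. of_real (occ c i) * exp_psi_unit Q i v) =
        (\<Sum>k\<in>UNIV. \<Sum>i\<in>UNIV. (of_real (occ c i) * V $ i $ k) * (exit_coord k / (\<mu> k - v)))"
      by (subst sum.swap) (simp add: exp_psi_unit_D[OF assms(2)] sum_distrib_left mult_ac)
    also have "\<dots> = (\<Sum>k\<in>UNIV. init_coord k * exp (- of_real c * \<mu> k) * (exit_coord k / (\<mu> k - v)))"
      by (simp only: sum_distrib_right[symmetric] occ_V)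
    finally have 1: "exp (v * of_real c) * (\<Sum>i\<in>UNIV. of_real (occ c i) * exp_psi_unit Q i v) =
        (\<Sum>k\<in>UNIV. - ?F k c)"
      by (simp add: sum_distrib_left exp_add[symmetric] minus_divide_right[symmetric] algebra_simps)
         (intro sum.cong refl, simp add: exp_diff exp_minus field_simps minus_divide_right)
    have 2: "exp_psi1 Q \<alpha> v = (\<Sum>k\<in>UNIV. - ?F k 0)"
      unfolding exp_psi1_D[OF assms(2)] by (intro sum.cong refl) (simp add: minus_divide_right)
    show ?thesis unfolding 1 2 by (simp add: sum_subtractf sum_negf)
  qed
  ultimately show ?thesis by simp
qed

end


section \<open>Laplace transforms and the product defining exp_phi\<close>

lemma norm_exp_minus_le:
  assumes "0 \<le> Re w"
  shows "norm (exp (- w) - 1) \<le> 2 * min 1 (norm w)"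
proof -
  have "norm (exp (- w) - exp (- 0)) \<le> 1 * norm (w - 0)"
  proof (rule field_differentiable_bound)
    show "convex {z. 0 \<le> Re z}" by (rule convex_halfspace_Re_ge)
    show "((\<lambda>z. exp (- z)) has_field_derivative - exp (- z)) (at z within {z. 0 \<le> Re z})" for z
      by (auto intro!: derivative_eq_intros)
  qed (use assms in auto)
  then have "norm (exp (- w) - 1) \<le> norm w" by simp
  moreover have "norm (exp (- w) - 1) \<le> 2"
    using norm_triangle_ineq4[of "exp (- w)" 1] assms by (simp add: order_trans)
  ultimately show ?thesis using norm_ge_zero[of w] unfolding min_def by (split if_split) linarith
qed

text \<open>
  The right-hand side telescopes along \<open>a, lam a, lam\<^sup>2 a, \<dots>\<close>. This turns a logarithmic moment into
  the summability of truncated first moments.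
\<close>

lemma min_one_le_ln_diff:
  fixes a lam :: real
  assumes "0 < lam" "lam < 1" "0 \<le> a"
  shows "(1 - lam) / 2 * min 1 a \<le> ln (1 + a) - ln (1 + lam * a)"
proof -
  have pos: "0 < 1 + a" "0 < 1 + lam * a" using assms by (simp_all add: add_pos_nonneg)
  have "ln ((1 + lam * a) / (1 + a)) \<le> (1 + lam * a) / (1 + a) - 1"
    using pos by (intro ln_le_minus_one divide_pos_pos)
  also have "\<dots> = - ((1 - lam) * (a / (1 + a)))" using pos by (simp add: field_simps)
  finally have 1: "(1 - lam) * (a / (1 + a)) \<le> ln (1 + a) - ln (1 + lam * a)"
    using pos by (simp add: ln_div)
  have "min 1 a / 2 \<le> a / (1 + a)"
    using assms mult_left_le[of a a] by (cases "a \<le> 1") (auto simp: field_simps)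
  then have "(1 - lam) * (min 1 a / 2) \<le> (1 - lam) * (a / (1 + a))"
    using assms by (intro mult_left_mono) auto
  then have "(1 - lam) / 2 * min 1 a \<le> (1 - lam) * (a / (1 + a))" by simp
  with 1 show ?thesis by linarith
qed

lemma sum_min_one_le:
  fixes a lam :: real
  assumes "0 < lam" "lam < 1" "0 \<le> a"
  shows "(\<Sum>k<N. min 1 (lam ^ k * a)) \<le> 2 / (1 - lam) * ln (1 + a)"
proof -
  have "(1 - lam) / 2 * (\<Sum>k<N. min 1 (lam ^ k * a)) \<le> (\<Sum>k<N. ln (1 + lam ^ k * a) - ln (1 + lam ^ Suc k * a))"
    unfolding sum_distrib_left
    using min_one_le_ln_diff[OF assms(1,2)] assms
    by (intro sum_mono) (simp add: mult.assoc)
  also have "\<dots> = ln (1 + a) - ln (1 + lam ^ N * a)"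
    by (induction N) auto
  also have "\<dots> \<le> ln (1 + a)" using assms by simp
  finally show ?thesis using assms by (simp add: field_simps)
qed

lemma laplace_norm_le:
  assumes "prob_space M" and X: "X \<in> borel_measurable M" and nn: "AE \<omega> in M. 0 \<le> X \<omega>" and u: "0 \<le> Re u"
  shows "integrable M (\<lambda>\<omega>. exp (- u * complex_of_real (X \<omega>)))"
    and "norm (\<integral>\<omega>. exp (- u * complex_of_real (X \<omega>)) \<partial>M) \<le> 1"
proof -
  interpret prob_space M by fact
  have b: "AE \<omega> in M. norm (exp (- u * complex_of_real (X \<omega>))) \<le> 1"
    using nn by eventually_elim (use u in simp)
  show i: "integrable M (\<lambda>\<omega>. exp (- u * complex_of_real (X \<omega>)))"
    using b X by (intro integrable_const_bound[where B = 1]) auto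
  have "norm (\<integral>\<omega>. exp (- u * complex_of_real (X \<omega>)) \<partial>M) \<le> (\<integral>\<omega>. norm (exp (- u * complex_of_real (X \<omega>))) \<partial>M)"
    by (rule integral_norm_bound)
  also have "\<dots> \<le> (\<integral>\<omega>. 1 \<partial>M)"
    using integrable_norm[OF i] b by (intro integral_mono_AE) auto
  finally show "norm (\<integral>\<omega>. exp (- u * complex_of_real (X \<omega>)) \<partial>M) \<le> 1" by (simp add: prob_space)
qed

text \<open>
  The expansion of \<open>exp (- u X)\<close> around \<open>z\<close> may be integrated term by term for \<open>|u - z| < Re z\<close>: with
  absolute values its sum is \<open>exp ((|u - z| - Re z) X)\<close>, which is at most \<open>1\<close>.
\<close>

lemma laplace_analytic:
  assumes "prob_space M" and X: "X \<in> borel_measurable M" and nn: "AE \<omega> in M. 0 \<le> X \<omega>" and z: "0 < Re z"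
  shows "(\<lambda>u. \<integral>\<omega>. exp (- u * complex_of_real (X \<omega>)) \<partial>M) analytic_on {z}"
proof -
  interpret prob_space M by fact
  note X[measurable]
  let ?L = "\<lambda>u. \<integral>\<omega>. exp (- u * complex_of_real (X \<omega>)) \<partial>M"
  let ?c = "\<lambda>n \<omega>. exp (- z * complex_of_real (X \<omega>)) * (- complex_of_real (X \<omega>)) ^ n /\<^sub>R fact n"
  have "(\<lambda>n. (\<integral>\<omega>. ?c n \<omega> \<partial>M) * (w - z) ^ n) sums ?L w" if w: "w \<in> ball z (Re z)" for w
  proof -
    define d where "d = norm (w - z)"
    have d: "0 \<le> d" "d < Re z" using w by (auto simp: d_def dist_norm norm_minus_commute)
    let ?f = "\<lambda>n \<omega>. ?c n \<omega> * (w - z) ^ n"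
    let ?g = "\<lambda>n \<omega>. exp (- Re z * X \<omega>) * ((d * X \<omega>) ^ n /\<^sub>R fact n)"
    \<comment> \<open>\<open>?g\<close> dominates the terms of the expansion, and its sum is at most \<open>1\<close>\<close>
    have gs: "(\<lambda>n. ?g n \<omega>) sums exp ((d - Re z) * X \<omega>)" for \<omega>
      using sums_mult[OF exp_converges[of "d * X \<omega>"], of "exp (- Re z * X \<omega>)"]
      by (simp add: exp_add[symmetric] algebra_simps)
    have fs: "(\<lambda>n. ?f n \<omega>) sums exp (- w * complex_of_real (X \<omega>))" for \<omega>
    proof -
      have "?f n \<omega> = exp (- z * complex_of_real (X \<omega>)) * ((- (w - z) * complex_of_real (X \<omega>)) ^ n /\<^sub>R fact n)" for n
      proof -
        have "(- complex_of_real (X \<omega>)) ^ n * (w - z) ^ n = (- (w - z) * complex_of_real (X \<omega>)) ^ n"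
          unfolding power_mult_distrib[symmetric] by (simp add: algebra_simps)
        then show ?thesis by (simp add: mult.assoc)
      qed
      moreover have "exp (- z * complex_of_real (X \<omega>)) * exp (- (w - z) * complex_of_real (X \<omega>)) = exp (- w * complex_of_real (X \<omega>))"
        by (simp add: exp_add[symmetric] algebra_simps)
      ultimately show ?thesis
        using sums_mult[OF exp_converges[of "- (w - z) * complex_of_real (X \<omega>)"], of "exp (- z * complex_of_real (X \<omega>))"]
        by (simp only:)
    qed
    have nf: "norm (?f n \<omega>) = ?g n \<omega>" if "0 \<le> X \<omega>" for n \<omega>
      using that by (simp add: norm_mult norm_power d_def power_mult_distrib divide_inverse mult_ac)
    have part: "(\<Sum>n<N. ?g n \<omega>) \<le> 1" if "0 \<le> X \<omega>" for N \<omega>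
    proof -
      have "(\<Sum>n<N. ?g n \<omega>) \<le> exp ((d - Re z) * X \<omega>)"
        unfolding sums_unique[OF gs]
        using that d by (intro sum_le_suminf sums_summable[OF gs]) auto
      also have "\<dots> \<le> 1" using that d by (simp add: mult_nonpos_nonneg)
      finally show ?thesis .
    qed
    have g1: "?g n \<omega> \<le> 1" if "0 \<le> X \<omega>" for n \<omega>
    proof -
      have "?g n \<omega> \<le> (\<Sum>n<Suc n. ?g n \<omega>)"
        using that d by (intro member_le_sum) auto
      also have "\<dots> \<le> 1" by (rule part[OF that])
      finally show ?thesis .
    qed
    have int_g: "integrable M (?g n)" for n
      using nn d g1 by (intro integrable_const_bound[where B = 1]) (auto elim!: eventually_mono)
    have int_f: "integrable M (?f n)" for n
    proof (rule integrable_const_bound[where B = 1])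
      show "AE \<omega> in M. norm (?f n \<omega>) \<le> 1"
        using nn by eventually_elim (use g1 in \<open>simp only: nf\<close>)
    qed measurable
    have summ: "summable (\<lambda>n. \<integral>\<omega>. norm (?f n \<omega>) \<partial>M)"
    proof (rule bounded_imp_summable)
      fix N
      have "(\<Sum>n\<le>N. \<integral>\<omega>. norm (?f n \<omega>) \<partial>M) = (\<integral>\<omega>. (\<Sum>n\<le>N. norm (?f n \<omega>)) \<partial>M)"
        using int_f by (intro Bochner_Integration.integral_sum[symmetric] integrable_norm)
      also have "\<dots> \<le> (\<integral>\<omega>. 1 \<partial>M)"
      proof (rule integral_mono_AE)
        show "integrable M (\<lambda>\<omega>. \<Sum>n\<le>N. norm (?f n \<omega>))"
          using int_f by (intro Bochner_Integration.integrable_sum integrable_norm)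
        show "AE \<omega> in M. (\<Sum>n\<le>N. norm (?f n \<omega>)) \<le> 1"
          using nn by eventually_elim (use part[of _ "Suc N"] in \<open>simp only: nf lessThan_Suc_atMost\<close>)
      qed simp
      finally show "(\<Sum>n\<le>N. \<integral>\<omega>. norm (?f n \<omega>) \<partial>M) \<le> 1" by (simp add: prob_space)
    qed simp
    have "AE \<omega> in M. summable (\<lambda>n. norm (?f n \<omega>))"
      using nn by eventually_elim (use gs in \<open>simp only: nf, blast intro: sums_summable\<close>)
    then have "(\<lambda>n. integral\<^sup>L M (?f n)) sums (\<integral>\<omega>. (\<Sum>n. ?f n \<omega>) \<partial>M)"
      using int_f summ by (intro sums_integral)
    moreover have "(\<Sum>n. ?f n \<omega>) = exp (- w * complex_of_real (X \<omega>))" for \<omega>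
      using fs by (simp add: sums_iff)
    ultimately show ?thesis by simp
  qed
  then have "?L analytic_on ball z (Re z)" by (rule power_series_analytic)
  then show ?thesis by (rule analytic_on_subset) (use z in auto)
qed

locale ar_data = phase_type V W Q \<alpha> \<mu> + prob_space M
  for V W :: "complex ^ 'm ^ 'm" and Q \<alpha> \<mu> and M :: "'w measure" +
  fixes T :: "nat \<Rightarrow> 'w \<Rightarrow> real" and lam :: real
  assumes lam: "0 < lam" "lam < 1"
    and T1_meas: "T 1 \<in> borel_measurable M"
    and T1_nonneg: "AE \<omega> in M. 0 \<le> T 1 \<omega>"
    and ln_T1: "integrable M (\<lambda>\<omega>. ln (1 + \<bar>T 1 \<omega>\<bar>))"
begin

abbreviation psi1 where "psi1 \<equiv> exp_psi1 Q \<alpha>"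
abbreviation psi2 where "psi2 \<equiv> exp_psi2 M T"
abbreviation phi where "phi \<equiv> exp_phi M lam Q \<alpha> T"

text \<open>
  The points of the right half plane at which no factor of the product has a pole.
\<close>

definition regular :: "complex \<Rightarrow> bool" where
  "regular z \<longleftrightarrow> 0 < Re z \<and> (\<forall>k. of_real (lam ^ k) * z \<notin> range \<mu>)"

definition factor :: "nat \<Rightarrow> complex \<Rightarrow> complex" where
  "factor k z = psi1 (of_real (lam ^ k) * z) * psi2 (of_real (lam ^ k) * z)"

lemma phi_eq: "phi z = (\<Prod>k. factor k z)"
  by (simp add: exp_phi_def factor_def)

lemma regular_notin: "regular z \<Longrightarrow> z \<notin> range \<mu>"
  unfolding regular_def by (metis mult_1 of_real_1 power_0)

lemma regular_scale: "regular z \<Longrightarrow> regular (of_real (lam ^ n) * z)"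
  using lam by (auto simp: regular_def mult.assoc[symmetric] power_add[symmetric] of_real_mult[symmetric]
      simp del: of_real_mult of_real_power)

lemma psi2_norm_le: "0 \<le> Re u \<Longrightarrow> norm (psi2 u) \<le> 1"
  unfolding exp_psi2_def using laplace_norm_le(2)[OF prob_space_axioms T1_meas T1_nonneg] by simp

lemma psi2_analytic: "0 < Re z \<Longrightarrow> psi2 analytic_on {z}"
  unfolding exp_psi2_def using laplace_analytic[OF prob_space_axioms T1_meas T1_nonneg] by simp

lemma psi_rational_analytic: "z \<notin> range \<mu> \<Longrightarrow> (\<lambda>u. \<Sum>k\<in>UNIV. c k / (\<mu> k - u)) analytic_on {z}"
  by (intro analytic_intros) auto

lemma eventually_notin_eig: "z \<notin> range \<mu> \<Longrightarrow> \<forall>\<^sub>F u in nhds z. u \<notin> range \<mu>"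
  by (intro eventually_nhds_in_open[of "- range \<mu>", simplified]) (auto simp: finite_imp_closed open_Compl)

lemma psi1_analytic:
  assumes "z \<notin> range \<mu>" shows "psi1 analytic_on {z}"
proof -
  have "\<forall>\<^sub>F u in nhds z. psi1 u = (\<Sum>k\<in>UNIV. init_coord k * exit_coord k / (\<mu> k - u))"
    using eventually_notin_eig[OF assms] by eventually_elim (rule exp_psi1_D)
  then show ?thesis using psi_rational_analytic[OF assms] by (subst analytic_at_cong) auto
qed

lemma psi_unit_analytic:
  assumes "z \<notin> range \<mu>" shows "exp_psi_unit Q i analytic_on {z}"
proof -
  have "\<forall>\<^sub>F u in nhds z. exp_psi_unit Q i u = (\<Sum>k\<in>UNIV. V $ i $ k * exit_coord k / (\<mu> k - u))"
    using eventually_notin_eig[OF assms] by eventually_elim (rule exp_psi_unit_D)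
  then show ?thesis using psi_rational_analytic[OF assms] by (subst analytic_at_cong) auto
qed

text \<open>
  The transform has the value \<open>1\<close> at \<open>0\<close>, so its distance from \<open>1\<close> is of the order of \<open>u\<close>.
\<close>

lemma psi1_diff:
  assumes "u \<notin> range \<mu>"
  shows "psi1 u - 1 = u * (\<Sum>k\<in>UNIV. init_coord k * exit_coord k / (\<mu> k * (\<mu> k - u)))"
proof -
  have ne: "\<mu> k \<noteq> 0" "\<mu> k - u \<noteq> 0" for k using Re_eig_pos[of k] assms by auto
  have "psi1 u - 1 = (\<Sum>k\<in>UNIV. init_coord k * exit_coord k / (\<mu> k - u) - init_coord k * exit_coord k / \<mu> k)"
    using coord_sum by (simp add: exp_psi1_D[OF assms] sum_subtractf)
  also have "\<dots> = (\<Sum>k\<in>UNIV. u * (init_coord k * exit_coord k / (\<mu> k * (\<mu> k - u))))"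
    by (intro sum.cong refl) (use ne in \<open>simp add: field_simps\<close>)
  finally show ?thesis by (simp add: sum_distrib_left)
qed

text \<open>
  The points \<open>lam\<^sup>k z\<close> accumulate only at \<open>0\<close>, which is no pole. Hence they keep a positive distance
  from the finitely many poles, and half of this distance remains for all points near \<open>z\<close>.
\<close>

lemma regular_nbhd:
  assumes "regular z"
  obtains r d where "0 < r" "0 < d" "\<And>w. w \<in> cball z r \<Longrightarrow> 0 < Re w"
    "\<And>w k l. w \<in> cball z r \<Longrightarrow> d \<le> norm (\<mu> l - of_real (lam ^ k) * w)"
proof -
  have "\<exists>d>0. \<forall>k. d \<le> norm (\<mu> l - of_real (lam ^ k) * z)" for l
  proof -
    have ne: "0 < norm (\<mu> l - of_real (lam ^ k) * z)" for k
      using assms by (auto simp: regular_def) (metis rangeI)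
    have "(\<lambda>k. norm (\<mu> l - of_real (lam ^ k) * z)) \<longlonglongrightarrow> norm (\<mu> l - of_real 0 * z)"
      using lam by (intro tendsto_intros LIMSEQ_power_zero) auto
    moreover have m: "0 < norm (\<mu> l)" using Re_eig_pos[of l] by auto
    ultimately have "\<forall>\<^sub>F k in sequentially. norm (\<mu> l) / 2 < norm (\<mu> l - of_real (lam ^ k) * z)"
      by (intro order_tendstoD(1)) auto
    then obtain K where K: "\<And>k. k \<ge> K \<Longrightarrow> norm (\<mu> l) / 2 < norm (\<mu> l - of_real (lam ^ k) * z)"
      by (auto simp: eventually_sequentially)
    define d where "d = Min (insert (norm (\<mu> l) / 2) ((\<lambda>k. norm (\<mu> l - of_real (lam ^ k) * z)) ` {..<K}))"
    have "0 < d" using ne m by (auto simp: d_def)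
    moreover have "d \<le> norm (\<mu> l - of_real (lam ^ k) * z)" for k
    proof (cases "k < K")
      case True then show ?thesis unfolding d_def by (intro Min_le) auto
    next
      case False
      have "d \<le> norm (\<mu> l) / 2" unfolding d_def by (intro Min_le) auto
      with K[of k] False show ?thesis by simp
    qed
    ultimately show ?thesis by blast
  qed
  then obtain d where d: "\<And>l. 0 < d l" "\<And>l k. d l \<le> norm (\<mu> l - of_real (lam ^ k) * z)" by metis
  define e where "e = Min (range d)"
  have e: "0 < e" "e \<le> d l" for l using d(1) by (auto simp: e_def)
  define r where "r = min (Re z / 2) (e / 2)"
  have z: "0 < Re z" using assms by (simp add: regular_def)
  show thesis
  proof (rule that[of r "e / 2"])
    show "0 < r" "0 < e / 2" using e z by (auto simp: r_def)
    fix w assume w: "w \<in> cball z r"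
    have "norm (z - w) \<le> r" using w by (simp add: dist_norm)
    then have "Re z - Re w \<le> Re z / 2"
      using complex_Re_le_cmod[of "z - w"] by (simp add: r_def)
    with z show "0 < Re w" by simp
    show "e / 2 \<le> norm (\<mu> l - of_real (lam ^ k) * w)" for k l
    proof -
      have "norm (of_real (lam ^ k) * (z - w)) = lam ^ k * norm (z - w)"
        using lam by (simp add: norm_mult norm_power)
      also have "\<dots> \<le> 1 * norm (z - w)" using lam by (intro mult_right_mono power_le_one) auto
      also have "\<dots> \<le> e / 2" using \<open>norm (z - w) \<le> r\<close> by (simp add: r_def)
      finally have 1: "norm (of_real (lam ^ k) * (z - w)) \<le> e / 2" .
      have "norm (\<mu> l - of_real (lam ^ k) * z) \<le> norm (\<mu> l - of_real (lam ^ k) * w) + norm (of_real (lam ^ k) * (z - w))"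
        using norm_triangle_ineq4[of "\<mu> l - of_real (lam ^ k) * w" "of_real (lam ^ k) * (z - w)"]
        by (simp add: algebra_simps)
      with 1 e(2)[of l] d(2)[of l k] show ?thesis by simp
    qed
  qed
qed

abbreviation trunc_mean :: "real \<Rightarrow> nat \<Rightarrow> real" where
  "trunc_mean R k \<equiv> (\<integral>\<omega>. min 1 (lam ^ k * (R * \<bar>T 1 \<omega>\<bar>)) \<partial>M)"

lemma summable_expectation_min:
  assumes "0 \<le> R"
  shows "summable (trunc_mean R)"
proof (rule bounded_imp_summable)
  have i: "integrable M (\<lambda>\<omega>. min 1 (lam ^ k * (R * \<bar>T 1 \<omega>\<bar>)))" for k
    using T1_meas assms lam by (intro integrable_const_bound[where B = 1]) auto
  show "0 \<le> trunc_mean R k" for k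
    using assms lam by (intro integral_nonneg_AE) auto
  fix N
  have "(\<Sum>k\<le>N. trunc_mean R k) = (\<integral>\<omega>. (\<Sum>k\<le>N. min 1 (lam ^ k * (R * \<bar>T 1 \<omega>\<bar>))) \<partial>M)"
    using i by (intro Bochner_Integration.integral_sum[symmetric])
  also have "\<dots> \<le> (\<integral>\<omega>. 2 / (1 - lam) * (ln (1 + R) + ln (1 + \<bar>T 1 \<omega>\<bar>)) \<partial>M)"
  proof (rule integral_mono)
    show "integrable M (\<lambda>\<omega>. \<Sum>k\<le>N. min 1 (lam ^ k * (R * \<bar>T 1 \<omega>\<bar>)))"
      using i by (intro Bochner_Integration.integrable_sum)
    show "integrable M (\<lambda>\<omega>. 2 / (1 - lam) * (ln (1 + R) + ln (1 + \<bar>T 1 \<omega>\<bar>)))"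
      using ln_T1 by simp
    fix \<omega>
    have "(\<Sum>k\<le>N. min 1 (lam ^ k * (R * \<bar>T 1 \<omega>\<bar>))) \<le> 2 / (1 - lam) * ln (1 + R * \<bar>T 1 \<omega>\<bar>)"
      using sum_min_one_le[OF lam, of "R * \<bar>T 1 \<omega>\<bar>" "Suc N"] assms by (simp only: lessThan_Suc_atMost) simp
    also have "ln (1 + R * \<bar>T 1 \<omega>\<bar>) \<le> ln ((1 + R) * (1 + \<bar>T 1 \<omega>\<bar>))"
      using assms by (subst ln_le_cancel_iff) (auto simp: algebra_simps add_pos_nonneg)
    also have "\<dots> = ln (1 + R) + ln (1 + \<bar>T 1 \<omega>\<bar>)"
      using assms by (intro ln_mult_pos) auto
    finally show "(\<Sum>k\<le>N. min 1 (lam ^ k * (R * \<bar>T 1 \<omega>\<bar>))) \<le> 2 / (1 - lam) * (ln (1 + R) + ln (1 + \<bar>T 1 \<omega>\<bar>))"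
      using lam by (simp add: mult_left_mono divide_right_mono)
  qed
  finally show "(\<Sum>k\<le>N. trunc_mean R k) \<le> (\<integral>\<omega>. 2 / (1 - lam) * (ln (1 + R) + ln (1 + \<bar>T 1 \<omega>\<bar>)) \<partial>M)" .
qed

lemma psi2_diff_le:
  assumes "0 \<le> Re u" "norm u \<le> R"
  shows "norm (psi2 (of_real (lam ^ k) * u) - 1) \<le> 2 * trunc_mean R k"
proof -
  let ?u = "of_real (lam ^ k) * u"
  have R: "0 \<le> R" using norm_ge_zero order_trans assms(2) by blast
  have Re: "0 \<le> Re ?u" using assms lam by simp
  have i: "integrable M (\<lambda>\<omega>. exp (- ?u * complex_of_real (T 1 \<omega>)))"
    by (rule laplace_norm_le(1)[OF prob_space_axioms T1_meas T1_nonneg Re])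
  have "psi2 ?u - 1 = (\<integral>\<omega>. exp (- ?u * complex_of_real (T 1 \<omega>)) - 1 \<partial>M)"
    unfolding exp_psi2_def using i by (simp add: prob_space)
  also have "norm \<dots> \<le> (\<integral>\<omega>. norm (exp (- ?u * complex_of_real (T 1 \<omega>)) - 1) \<partial>M)"
    by (rule integral_norm_bound)
  also have "\<dots> \<le> (\<integral>\<omega>. 2 * min 1 (lam ^ k * (R * \<bar>T 1 \<omega>\<bar>)) \<partial>M)"
  proof (rule integral_mono_AE)
    show "integrable M (\<lambda>\<omega>. norm (exp (- ?u * complex_of_real (T 1 \<omega>)) - 1))"
      using i by (intro integrable_norm Bochner_Integration.integrable_diff) auto
    show "integrable M (\<lambda>\<omega>. 2 * min 1 (lam ^ k * (R * \<bar>T 1 \<omega>\<bar>)))"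
      using T1_meas R lam by (intro integrable_const_bound[where B = 2]) auto
    show "AE \<omega> in M. norm (exp (- ?u * complex_of_real (T 1 \<omega>)) - 1) \<le> 2 * min 1 (lam ^ k * (R * \<bar>T 1 \<omega>\<bar>))"
      using T1_nonneg
    proof eventually_elim
      case (elim \<omega>)
      have "norm (exp (- (?u * complex_of_real (T 1 \<omega>))) - 1) \<le> 2 * min 1 (norm (?u * complex_of_real (T 1 \<omega>)))"
        using elim Re by (intro norm_exp_minus_le) simp
      also have "norm (?u * complex_of_real (T 1 \<omega>)) = lam ^ k * (norm u * \<bar>T 1 \<omega>\<bar>)"
        using lam by (simp add: norm_mult norm_power)
      also have "2 * min 1 \<dots> \<le> 2 * min 1 (lam ^ k * (R * \<bar>T 1 \<omega>\<bar>))"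
        using assms lam by (intro mult_left_mono min.mono mult_right_mono) auto
      finally show ?case by simp
    qed
  qed
  finally show ?thesis by simp
qed

text \<open>
  A factor differs from \<open>1\<close> by a term of order \<open>lam\<^sup>k\<close>, stemming from the jump upwards, and by the
  truncated mean of a multiple of \<open>lam\<^sup>k T\<close>. Both are summable, uniformly near a regular point.
\<close>

lemma factor_bound:
  assumes "regular z"
  obtains r B where "0 < r" "summable B" "\<And>w. w \<in> cball z r \<Longrightarrow> regular w"
    "\<And>w k. w \<in> cball z r \<Longrightarrow> norm (factor k w - 1) \<le> B k"
proof -
  obtain r d where r: "0 < r" "0 < d" "\<And>w. w \<in> cball z r \<Longrightarrow> 0 < Re w"
    "\<And>w k l. w \<in> cball z r \<Longrightarrow> d \<le> norm (\<mu> l - of_real (lam ^ k) * w)"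
    using regular_nbhd[OF assms] by metis
  define R where "R = norm z + r"
  define C where "C = (\<Sum>k\<in>UNIV. norm (init_coord k * exit_coord k) / (norm (\<mu> k) * d))"
  define B where "B k = lam ^ k * (R * C) + 2 * trunc_mean R k" for k
  have R: "0 \<le> R" using r by (simp add: R_def)
  have reg: "regular w" if "w \<in> cball z r" for w
    using r(2,3) r(4)[OF that] that by (auto simp: regular_def) (metis diff_self norm_zero not_le of_real_power)
  show thesis
  proof (rule that[of r B])
    show "summable B" unfolding B_def
      using lam by (intro summable_add summable_mult summable_mult2 summable_expectation_min[OF R] summable_geometric) auto
    show "norm (factor k w - 1) \<le> B k" if w: "w \<in> cball z r" for w k
    proof -
      let ?w = "of_real (lam ^ k) * w"
      have nw: "norm w \<le> R"
        using w norm_triangle_ineq4[of z "z - w"] by (simp add: R_def dist_norm)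
      have Re: "0 \<le> Re w" "0 \<le> Re ?w" using r(3)[OF w] lam by auto
      have "?w \<notin> range \<mu>" using reg[OF w] by (simp add: regular_def)
      then have "norm (psi1 ?w - 1) \<le> norm ?w * C"
        unfolding psi1_diff[OF \<open>?w \<notin> range \<mu>\<close>] norm_mult[of ?w] C_def
      proof (intro mult_left_mono sum_norm_le)
        fix l
        have "0 < norm (\<mu> l)" using Re_eig_pos[of l] by auto
        then show "norm (init_coord l * exit_coord l / (\<mu> l * (\<mu> l - ?w))) \<le> norm (init_coord l * exit_coord l) / (norm (\<mu> l) * d)"
          unfolding norm_divide norm_mult[of "\<mu> l"] using r(2) r(4)[OF w, of l k]
          by (intro frac_le mult_left_mono mult_pos_pos) auto
      qed auto
      also have "norm ?w * C \<le> lam ^ k * (R * C)"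
      proof -
        have "0 \<le> C" unfolding C_def using r by (intro sum_nonneg) auto
        then show ?thesis using nw lam by (simp add: norm_mult norm_power mult_left_mono mult_right_mono)
      qed
      finally have 1: "norm (psi1 ?w - 1) \<le> lam ^ k * (R * C)" .
      have 2: "norm (psi2 ?w - 1) \<le> 2 * trunc_mean R k"
        by (rule psi2_diff_le[OF Re(1) nw])
      have "factor k w - 1 = (psi1 ?w - 1) * psi2 ?w + (psi2 ?w - 1)"
        by (simp add: factor_def algebra_simps)
      also have "norm \<dots> \<le> norm (psi1 ?w - 1) * norm (psi2 ?w) + norm (psi2 ?w - 1)"
        by (rule norm_triangle_le) (simp add: norm_mult)
      also have "norm (psi1 ?w - 1) * norm (psi2 ?w) \<le> norm (psi1 ?w - 1)"
        by (intro mult_left_le psi2_norm_le Re) auto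
      finally show ?thesis using 1 2 by (simp add: B_def)
    qed
  qed (use r reg in auto)
qed

lemma factor_analytic:
  assumes "regular z" shows "factor k analytic_on {z}"
proof -
  have "of_real (lam ^ k) * z \<notin> range \<mu>" "0 < Re (of_real (lam ^ k) * z)"
    using assms lam by (auto simp: regular_def)
  then have "(psi1 \<circ> (\<lambda>z. of_real (lam ^ k) * z)) analytic_on {z}" "(psi2 \<circ> (\<lambda>z. of_real (lam ^ k) * z)) analytic_on {z}"
    using psi1_analytic psi2_analytic
    by (auto intro!: analytic_on_compose analytic_intros simp del: of_real_power)
  then show ?thesis
    unfolding factor_def[abs_def] o_def by (intro analytic_intros)
qed

lemma factor_product_tendsto:
  assumes "regular z" shows "(\<lambda>n. \<Prod>k<n. factor k z) \<longlonglongrightarrow> phi z"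
proof -
  obtain r B where r: "0 < r" "summable B" "\<And>w k. w \<in> cball z r \<Longrightarrow> norm (factor k w - 1) \<le> B k"
    using factor_bound[OF assms] by metis
  have "summable (\<lambda>k. norm (factor k z - 1))"
    by (rule summable_comparison_test'[OF r(2)]) (use r in auto)
  then have "convergent_prod (\<lambda>k. factor k z)"
    by (intro abs_convergent_prod_imp_convergent_prod summable_imp_abs_convergent_prod)
  then have "(\<lambda>k. factor k z) has_prod phi z"
    unfolding phi_eq by (rule convergent_prod_has_prod)
  then show ?thesis by (rule has_prod_imp_tendsto')
qed

lemma factor_Suc: "factor (Suc k) z = factor k (of_real lam * z)"
  by (simp add: factor_def mult_ac)

lemma phi_functional_equation:
  assumes "regular z" shows "phi z = psi1 z * psi2 z * phi (of_real lam * z)"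
proof -
  have "regular (of_real lam * z)" using regular_scale[OF assms, of 1] by simp
  then have "(\<lambda>n. factor 0 z * (\<Prod>k<n. factor k (of_real lam * z))) \<longlonglongrightarrow> factor 0 z * phi (of_real lam * z)"
    by (intro tendsto_intros factor_product_tendsto)
  moreover have "factor 0 z * (\<Prod>k<n. factor k (of_real lam * z)) = (\<Prod>k<Suc n. factor k z)" for n
    unfolding prod.lessThan_Suc_shift factor_Suc by simp
  ultimately have "(\<lambda>n. \<Prod>k<Suc n. factor k z) \<longlonglongrightarrow> factor 0 z * phi (of_real lam * z)" by simp
  moreover have "(\<lambda>n. \<Prod>k<Suc n. factor k z) \<longlonglongrightarrow> phi z"
    using factor_product_tendsto[OF assms] by (rule LIMSEQ_Suc)
  ultimately show ?thesis by (simp add: LIMSEQ_unique factor_def)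
qed

lemma phi_analytic:
  assumes "regular z" shows "phi analytic_on {z}"
proof -
  obtain r B where r: "0 < r" "summable B" "\<And>w. w \<in> cball z r \<Longrightarrow> regular w"
    "\<And>w k. w \<in> cball z r \<Longrightarrow> norm (factor k w - 1) \<le> B k"
    using factor_bound[OF assms] by metis
  have an: "factor k analytic_on cball z r" for k
    using factor_analytic r(3) by (subst analytic_on_analytic_at) auto
  have "uniformly_convergent_on (cball z r) (\<lambda>N w. \<Prod>k<N. factor k w)"
  proof (rule uniformly_convergent_on_prod')
    show "continuous_on (cball z r) (factor k)" for k
      using an by (intro holomorphic_on_imp_continuous_on analytic_imp_holomorphic)
    show "uniformly_convergent_on (cball z r) (\<lambda>N w. \<Sum>k<N. norm (factor k w - 1))"
      by (rule Weierstrass_m_test'[OF _ r(2)]) (use r in auto)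
  qed simp
  then obtain g where g: "uniform_limit (cball z r) (\<lambda>N w. \<Prod>k<N. factor k w) g sequentially"
    by (auto simp: uniformly_convergent_on_def)
  have g_phi: "\<forall>w\<in>cball z r. g w = phi w"
    using tendsto_uniform_limitI[OF g] factor_product_tendsto[OF r(3)] LIMSEQ_unique by blast
  then have ul: "uniform_limit (cball z r) (\<lambda>N w. \<Prod>k<N. factor k w) phi sequentially"
    unfolding uniform_limit_iff
  proof (intro allI impI)
    fix e :: real assume "0 < e"
    with g have "\<forall>\<^sub>F N in sequentially. \<forall>w\<in>cball z r. dist (\<Prod>k<N. factor k w) (g w) < e"
      unfolding uniform_limit_iff by blast
    then show "\<forall>\<^sub>F N in sequentially. \<forall>w\<in>cball z r. dist (\<Prod>k<N. factor k w) (phi w) < e"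
      by eventually_elim (use g_phi in auto)
  qed
  have "\<forall>\<^sub>F N in sequentially. continuous_on (cball z r) (\<lambda>w. \<Prod>k<N. factor k w) \<and> (\<lambda>w. \<Prod>k<N. factor k w) holomorphic_on ball z r"
    by (intro always_eventually allI conjI holomorphic_on_imp_continuous_on[OF analytic_imp_holomorphic]
        analytic_imp_holomorphic analytic_on_prod) (auto intro: analytic_on_subset[OF an])
  then have "phi holomorphic_on ball z r"
    using ul by (rule holomorphic_uniform_limit) auto
  then show ?thesis using r by (auto simp: analytic_on_def)
qed

lemma psi_unit_bounded:
  assumes "regular z"
  obtains C where "\<And>n. norm (exp_psi_unit Q i (of_real (lam ^ n) * z)) \<le> C"
proof -
  obtain r d where r: "0 < r" "0 < d" "\<And>w k l. w \<in> cball z r \<Longrightarrow> d \<le> norm (\<mu> l - of_real (lam ^ k) * w)"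
    using regular_nbhd[OF assms] by metis
  have "norm (exp_psi_unit Q i (of_real (lam ^ n) * z)) \<le> (\<Sum>k\<in>UNIV. norm (V $ i $ k * exit_coord k) / d)" for n
  proof -
    have "of_real (lam ^ n) * z \<notin> range \<mu>" using assms by (simp add: regular_def)
    then show ?thesis
      using r(1,2) r(3)[of z _ n]
      unfolding exp_psi_unit_D[OF \<open>of_real (lam ^ n) * z \<notin> range \<mu>\<close>]
      by (intro sum_norm_le, unfold norm_divide, intro frac_le) auto
  qed
  then show thesis by (rule that)
qed

end


section \<open>Paths and the moment of crossing\<close>

text \<open>
  Right-continuity for the discrete topology on the values.
\<close>

definition right_constant :: "(real \<Rightarrow> 's) \<Rightarrow> bool" where
  "right_constant f \<longleftrightarrow> (\<forall>t\<ge>0. \<exists>e>0. \<forall>s\<in>{t..<t + e}. f s = f t)"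

text \<open>
  A dyadic number of level \<open>k\<close> strictly to the right of \<open>t\<close>. A random time is approximated through
  these by times with countably many values.
\<close>

definition dyadic_above :: "nat \<Rightarrow> real \<Rightarrow> real" where
  "dyadic_above k t = of_int (\<lfloor>t * 2 ^ k\<rfloor> + 1) / 2 ^ k"

lemma dyadic_above_bounds: "t < dyadic_above k t" "dyadic_above k t \<le> t + 1 / 2 ^ k"
proof -
  have "t * 2 ^ k < of_int (\<lfloor>t * 2 ^ k\<rfloor> + 1)" "of_int (\<lfloor>t * 2 ^ k\<rfloor> + 1) \<le> t * 2 ^ k + 1"
    by linarith+
  then show "t < dyadic_above k t" "dyadic_above k t \<le> t + 1 / 2 ^ k"
    by (simp_all add: dyadic_above_def field_simps)
qed

lemma right_constant_dyadic:
  assumes "right_constant f" "0 \<le> t"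
  shows "\<forall>\<^sub>F k in sequentially. f (dyadic_above k t) = f t"
proof -
  obtain e where e: "0 < e" "\<forall>s\<in>{t..<t + e}. f s = f t" using assms by (auto simp: right_constant_def)
  have "(\<lambda>k. (1 / 2) ^ k :: real) \<longlonglongrightarrow> 0" by (intro LIMSEQ_power_zero) simp
  then have "\<forall>\<^sub>F k in sequentially. (1 / 2) ^ k < e" using e by (intro order_tendstoD)
  then show ?thesis
  proof eventually_elim
    case (elim k)
    have "dyadic_above k t \<in> {t..<t + e}"
      using dyadic_above_bounds[where t = t and k = k] elim by (simp add: power_one_over)
    then show ?case using e by blast
  qed
qed

lemma right_constant_rational:
  assumes "right_constant f" "0 \<le> t" "f t = s" "t < u"
  shows "\<exists>q\<in>\<rat>. 0 \<le> q \<and> t < q \<and> q < u \<and> f q = s"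
proof -
  obtain e where e: "0 < e" "\<forall>s\<in>{t..<t + e}. f s = f t" using assms by (auto simp: right_constant_def)
  obtain q where "q \<in> \<rat>" "t < q" "q < min u (t + e)"
    using Rats_dense_in_real[of t "min u (t + e)"] e assms by auto
  then show ?thesis using e assms by (intro bexI[of _ q]) auto
qed

text \<open>
  By right-continuity the value at the time \<open>U\<close> is the eventual value at its dyadic approximations.
\<close>

lemma measurable_random_time:
  assumes meas: "\<And>t. 0 \<le> t \<Longrightarrow> Z t \<in> measurable N (count_space UNIV)"
    and rc: "\<And>\<omega>. \<omega> \<in> space N \<Longrightarrow> right_constant (\<lambda>t. Z t \<omega>)"
    and U: "U \<in> borel_measurable N" and U0: "\<And>\<omega>. \<omega> \<in> space N \<Longrightarrow> 0 \<le> U \<omega>"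
  shows "{\<omega>\<in>space N. Z (U \<omega>) \<omega> = s} \<in> sets N"
proof -
  have 1: "{\<omega>\<in>space N. Z (dyadic_above k (U \<omega>)) \<omega> = s} \<in> sets N" for k
  proof -
    have "{\<omega>\<in>space N. Z (dyadic_above k (U \<omega>)) \<omega> = s} =
        (\<Union>m::nat. {\<omega>\<in>space N. \<lfloor>U \<omega> * 2 ^ k\<rfloor> = int m} \<inter> (Z (real_of_int (int m + 1) / 2 ^ k) -` {s} \<inter> space N))"
    proof (intro equalityI subsetI)
      fix \<omega> assume w: "\<omega> \<in> {\<omega>\<in>space N. Z (dyadic_above k (U \<omega>)) \<omega> = s}"
      then obtain m :: nat where "\<lfloor>U \<omega> * 2 ^ k\<rfloor> = int m"
        using U0[of \<omega>] by (metis (no_types, lifting) mem_Collect_eq nonneg_int_cases zero_le_floor zero_le_mult_iff zero_le_numeral zero_le_power)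
      with w show "\<omega> \<in> (\<Union>m::nat. {\<omega>\<in>space N. \<lfloor>U \<omega> * 2 ^ k\<rfloor> = int m} \<inter> (Z (real_of_int (int m + 1) / 2 ^ k) -` {s} \<inter> space N))"
        by (auto simp: dyadic_above_def intro!: exI[of _ m])
    qed (auto simp: dyadic_above_def)
    also have "\<dots> \<in> sets N"
    proof -
      have "{\<omega>\<in>space N. \<lfloor>U \<omega> * 2 ^ k\<rfloor> = int m} \<in> sets N" for m using U by measurable
      moreover have "Z (real_of_int (int m + 1) / 2 ^ k) -` {s} \<inter> space N \<in> sets N" for m
        by (rule measurable_sets[OF meas]) auto
      ultimately show ?thesis by (intro sets.countable_UN image_subsetI) auto
    qed
    finally show ?thesis .
  qed
  have ev: "\<exists>K. \<forall>k\<ge>K. Z (dyadic_above k (U \<omega>)) \<omega> = Z (U \<omega>) \<omega>" if "\<omega> \<in> space N" for \<omega>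
    using right_constant_dyadic[OF rc[OF that] U0[OF that]] by (simp add: eventually_sequentially)
  have "{\<omega>\<in>space N. Z (U \<omega>) \<omega> = s} = (\<Union>K. \<Inter>k\<in>{K..}. {\<omega>\<in>space N. Z (dyadic_above k (U \<omega>)) \<omega> = s})"
  proof (intro equalityI subsetI)
    fix \<omega> assume "\<omega> \<in> {\<omega>\<in>space N. Z (U \<omega>) \<omega> = s}"
    then show "\<omega> \<in> (\<Union>K. \<Inter>k\<in>{K..}. {\<omega>\<in>space N. Z (dyadic_above k (U \<omega>)) \<omega> = s})"
      using ev[of \<omega>] by fastforce
  next
    fix \<omega> assume "\<omega> \<in> (\<Union>K. \<Inter>k\<in>{K..}. {\<omega>\<in>space N. Z (dyadic_above k (U \<omega>)) \<omega> = s})"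
    then obtain K where K: "\<forall>k\<ge>K. \<omega> \<in> space N \<and> Z (dyadic_above k (U \<omega>)) \<omega> = s" by auto
    then have "\<omega> \<in> space N" by auto
    then obtain K' where "\<forall>k\<ge>K'. Z (dyadic_above k (U \<omega>)) \<omega> = Z (U \<omega>) \<omega>"
      using ev by blast
    with K have "Z (U \<omega>) \<omega> = s" by (metis max.cobounded1 max.cobounded2)
    with \<open>\<omega> \<in> space N\<close> show "\<omega> \<in> {\<omega>\<in>space N. Z (U \<omega>) \<omega> = s}" by simp
  qed
  also have "\<dots> \<in> sets N" using 1 by (intro sets.countable_UN sets.countable_INT') auto
  finally show ?thesis .
qed

text \<open>
  By right-continuity the infimum may be restricted to rational times.
\<close>

lemma measurable_absorption_time:
  assumes meas: "\<And>t. 0 \<le> t \<Longrightarrow> Z t \<in> measurable N (count_space UNIV)"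
    and rc: "\<And>\<omega>. \<omega> \<in> space N \<Longrightarrow> right_constant (\<lambda>t. Z t \<omega>)"
  shows "absorption_time Z \<in> borel_measurable N"
proof -
  define I where "I \<omega> = (INF q\<in>\<rat> \<inter> {0..}. if Z q \<omega> = None then ereal q else \<infinity>)" for \<omega>
  have [measurable]: "{\<omega>\<in>space N. Z q \<omega> = None} \<in> sets N" if "0 \<le> q" for q
    using measurable_sets[OF meas[OF that], of "{None}"] by (simp add: vimage_def Int_def conj_commute)
  have "I \<in> borel_measurable N"
    unfolding I_def[abs_def]
    by (intro borel_measurable_INF countable_Int1 countable_rat) (auto intro!: measurable_If)
  moreover have "absorption_time Z \<omega> = real_of_ereal (I \<omega>)" if "\<omega> \<in> space N" for \<omega>
  proof -
    have "(INF t\<in>{t. 0 \<le> t \<and> Z t \<omega> = None}. ereal t) = I \<omega>"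
    proof (rule antisym)
      show "(INF t\<in>{t. 0 \<le> t \<and> Z t \<omega> = None}. ereal t) \<le> I \<omega>"
        unfolding I_def by (intro INF_greatest) (auto intro!: INF_lower)
      show "I \<omega> \<le> (INF t\<in>{t. 0 \<le> t \<and> Z t \<omega> = None}. ereal t)"
      proof (rule INF_greatest, rule ereal_le_epsilon2)
        fix t e :: real assume t: "t \<in> {t. 0 \<le> t \<and> Z t \<omega> = None}" and "0 < e"
        then have "0 \<le> t" "Z t \<omega> = None" "t < t + e" by auto
        from right_constant_rational[OF rc[OF that] this]
        obtain q where q: "q \<in> \<rat>" "0 \<le> q" "q < t + e" "Z q \<omega> = None" by blast
        then have "I \<omega> \<le> ereal q"
          unfolding I_def by (intro INF_lower2[of q]) auto
        also have "\<dots> \<le> ereal t + ereal e" using q by simp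
        finally show "I \<omega> \<le> ereal t + ereal e" .
      qed
    qed
    then show ?thesis by (simp add: absorption_time_def)
  qed
  ultimately show ?thesis
    by (subst measurable_cong[where g = "\<lambda>\<omega>. real_of_ereal (I \<omega>)"]) auto
qed

lemma absorption_time_nonneg: "0 \<le> absorption_time Z \<omega>"
  unfolding absorption_time_def by (rule real_of_ereal_pos, rule INF_greatest) simp

text \<open>
  On a path that never leaves \<open>None\<close> again, the set of times spent there is an interval unbounded to
  the right, and right-continuity puts its infimum into it.
\<close>

lemma absorption_time_iff:
  assumes rc: "right_constant (\<lambda>t. Z t \<omega>)" and abs: "\<And>r s. 0 \<le> r \<Longrightarrow> r \<le> s \<Longrightarrow> Z r \<omega> = None \<Longrightarrow> Z s \<omega> = None"
    and ex: "0 \<le> t0" "Z t0 \<omega> = None" and Z0: "Z 0 \<omega> \<noteq> None"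
  shows "0 < absorption_time Z \<omega>" "0 \<le> t \<Longrightarrow> Z t \<omega> = None \<longleftrightarrow> absorption_time Z \<omega> \<le> t"
proof -
  define A where "A = {t. 0 \<le> t \<and> Z t \<omega> = None}"
  have A: "A \<noteq> {}" "bdd_below A" using ex by (auto simp: A_def)
  define S where "S = Inf A"
  have S0: "0 \<le> S" unfolding S_def by (rule cInf_greatest[OF A(1)]) (simp add: A_def)
  have "S \<in> A"
  proof (rule ccontr)
    assume n: "S \<notin> A"
    obtain e where e: "0 < e" "\<forall>s\<in>{S..<S + e}. Z s \<omega> = Z S \<omega>" using rc S0 by (auto simp: right_constant_def)
    obtain a where a: "a \<in> A" "a < S + e" using e cInf_lessD[OF A(1), of "S + e"] by (auto simp: S_def)
    have "S \<le> a" unfolding S_def by (rule cInf_lower[OF a(1) A(2)])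
    then have "Z a \<omega> = Z S \<omega>" using a(2) by (intro bspec[OF e(2)]) simp
    then show False using a(1) n S0 by (simp add: A_def)
  qed
  have A_eq: "A = {S..}"
  proof (intro equalityI subsetI)
    fix t assume "t \<in> A" then show "t \<in> {S..}" using cInf_lower[OF _ A(2)] by (simp add: S_def)
  next
    fix t assume "t \<in> {S..}"
    with \<open>S \<in> A\<close> abs[of S t] show "t \<in> A" by (simp add: A_def)
  qed
  have "(INF t\<in>A. ereal t) = ereal S"
    unfolding A_eq by (intro antisym INF_greatest INF_lower2[of S]) auto
  then have eq: "absorption_time Z \<omega> = S" by (simp add: absorption_time_def A_def)
  show "0 \<le> t \<Longrightarrow> Z t \<omega> = None \<longleftrightarrow> absorption_time Z \<omega> \<le> t"
    using A_eq by (auto simp: eq A_def)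
  have "S \<noteq> 0" using \<open>S \<in> A\<close> Z0 by (auto simp: A_def)
  with S0 show "0 < absorption_time Z \<omega>" by (simp add: eq)
qed

lemma renewal_sum_Suc: "renewal_sum J (Suc n) \<omega> = renewal_sum J n \<omega> + absorption_time (J (Suc n)) \<omega>"
  by (simp add: renewal_sum_def)

lemma renewal_sum_0: "renewal_sum J 0 \<omega> = 0"
  by (simp add: renewal_sum_def)

lemma renewal_sum_mono: "m \<le> n \<Longrightarrow> renewal_sum J m \<omega> \<le> renewal_sum J n \<omega>"
  by (rule lift_Suc_mono_le[of "\<lambda>n. renewal_sum J n \<omega>"]) (auto simp: renewal_sum_Suc absorption_time_nonneg)

lemma renewal_count_eq:
  assumes "renewal_sum J k \<omega> \<le> t" "t < renewal_sum J (Suc k) \<omega>"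
  shows "renewal_count J t \<omega> = k"
proof -
  have "{n. renewal_sum J n \<omega> \<le> t} = {..k}"
  proof (intro equalityI subsetI)
    fix n assume "n \<in> {n. renewal_sum J n \<omega> \<le> t}"
    with assms(2) renewal_sum_mono[of "Suc k" n J \<omega>] show "n \<in> {..k}"
      by (auto simp: not_less_eq_eq[symmetric])
  next
    fix n assume "n \<in> {..k}"
    with assms(1) renewal_sum_mono[of n k J \<omega>] show "n \<in> {n. renewal_sum J n \<omega> \<le> t}" by auto
  qed
  then show ?thesis by (simp add: renewal_count_def Max_eq_iff)
qed

text \<open>
  Between two renewal times the embedded process grows with slope \<open>1\<close>, and its left limit at the end
  of the interval \<open>n\<close> is \<open>X n\<close>. So it stays below \<open>b\<close> on the intervals that end below \<open>b\<close>. On the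
  interval that ends above \<open>b\<close> it starts below \<open>b\<close> and needs the time \<open>c\<close> to reach \<open>b\<close>, which happens
  before the current chain is absorbed.
\<close>

lemma crossing_deterministic:
  fixes lam b x :: real and J :: "nat \<Rightarrow> real \<Rightarrow> 'w \<Rightarrow> 'm option" and T \<omega> and m :: nat
  defines "X \<equiv> \<lambda>n. ar_process lam J T x n \<omega>"
  defines "c \<equiv> b - lam * X m + T (Suc m) \<omega>"
  defines "Hs \<equiv> {t. 0 \<le> t \<and> b \<le> embedded_process lam J T x t \<omega>}"
  assumes lam: "0 < lam" "lam < 1" and b: "0 \<le> b"
    and T: "0 \<le> T (Suc m) \<omega>" and below: "\<forall>k\<le>m. X k < b" and above: "b < X (Suc m)"
  shows "0 < c" "c < absorption_time (J (Suc m)) \<omega>" "Hs \<noteq> {}" "embedded_state J (Inf Hs) \<omega> = J (Suc m) c \<omega>"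
proof -
  let ?R = "\<lambda>n. renewal_sum J n \<omega>"
  let ?S = "\<lambda>n. absorption_time (J n) \<omega>"
  have XS: "X (Suc n) = lam * X n + (?S (Suc n) - T (Suc n) \<omega>)" for n
    by (simp add: X_def innovation_def)
  have "lam * X m < b"
  proof (cases "0 < X m")
    case True
    then have "lam * X m < 1 * X m" using lam by (intro mult_strict_right_mono) auto
    then show ?thesis using below by force
  next
    case False
    show ?thesis
    proof (cases "X m = 0")
      case True then show ?thesis using below by auto
    next
      case f: False
      then have "lam * X m < 0" using False lam by (simp add: mult_pos_neg)
      then show ?thesis using b by simp
    qed
  qed
  then show c0: "0 < c" using T by (simp add: c_def)
  show cS: "c < ?S (Suc m)" using above by (simp add: c_def XS)
  define ts where "ts = ?R m + c"
  have R0: "0 \<le> ?R n" for n using renewal_sum_mono[of 0 n J \<omega>] by (simp add: renewal_sum_0)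
  have cnt: "renewal_count J ts \<omega> = m"
    by (rule renewal_count_eq) (use c0 cS in \<open>auto simp: ts_def renewal_sum_Suc\<close>)
  have "embedded_process lam J T x ts \<omega> = b"
    unfolding embedded_process_def cnt Let_def by (simp add: ts_def c_def X_def)
  then have tsH: "ts \<in> Hs" using R0[of m] c0 by (simp add: Hs_def ts_def)
  have before: "embedded_process lam J T x t \<omega> < b" if t: "0 \<le> t" "t < ts" for t
  proof -
    define k where "k = (LEAST k. t < ?R (Suc k))"
    have tm: "t < ?R (Suc m)" using t cS by (simp add: ts_def renewal_sum_Suc)
    then have k1: "t < ?R (Suc k)" and km: "k \<le> m"
      unfolding k_def by (auto intro: LeastI Least_le)
    have k0: "?R k \<le> t"
    proof (cases k)
      case (Suc k')
      then have "\<not> t < ?R (Suc k')" unfolding k_def by (metis lessI not_less_Least)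
      with Suc show ?thesis by simp
    qed (simp add: renewal_sum_0 t)
    have "renewal_count J t \<omega> = k" by (rule renewal_count_eq[OF k0 k1])
    then have Y: "embedded_process lam J T x t \<omega> = lam * X k - T (Suc k) \<omega> + t - ?R k"
      by (simp add: embedded_process_def Let_def X_def)
    show ?thesis
    proof (cases "k = m")
      case True
      then show ?thesis using t by (simp add: Y ts_def c_def)
    next
      case False
      then have "X (Suc k) < b" using km below by simp
      then show ?thesis using k1 by (simp add: Y XS renewal_sum_Suc)
    qed
  qed
  show "Hs \<noteq> {}" using tsH by auto
  have "Inf Hs = ts"
    by (rule cInf_eq_minimum[OF tsH]) (use before in \<open>force simp: Hs_def not_less[symmetric]\<close>)
  then show "embedded_state J (Inf Hs) \<omega> = J (Suc m) c \<omega>"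
    by (simp add: embedded_state_def cnt Let_def) (simp add: ts_def)
qed

text \<open>
  On paths with bounded renewal sums, \<open>renewal_count\<close> is eventually the maximum of an infinite set,
  a fixed unspecified number; this still does not vary with time.
\<close>

lemma renewal_count_right_constant: "right_constant (\<lambda>t. renewal_count J t \<omega>)"
  unfolding right_constant_def
proof (intro allI impI)
  fix t :: real assume "0 \<le> t"
  let ?R = "\<lambda>n. renewal_sum J n \<omega>"
  show "\<exists>e>0. \<forall>s\<in>{t..<t + e}. renewal_count J s \<omega> = renewal_count J t \<omega>"
  proof (cases "\<exists>n. t < ?R n")
    case False
    then have "{n. ?R n \<le> s} = UNIV" if "t \<le> s" for s
      using that by (auto simp: not_less intro: order_trans)
    then show ?thesis by (intro exI[of _ 1]) (auto simp: renewal_count_def)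
  next
    case True
    define n where "n = (LEAST n. t < ?R n)"
    have n: "t < ?R n" unfolding n_def using True by (auto intro: LeastI_ex)
    have lt: "?R k \<le> t" if "k < n" for k
      using not_less_Least[of k "\<lambda>n. t < ?R n"] that by (auto simp: n_def)
    have "{k. ?R k \<le> s} = {..<n}" if "t \<le> s" "s < ?R n" for s
    proof (intro equalityI subsetI)
      fix k assume "k \<in> {k. ?R k \<le> s}"
      with that renewal_sum_mono[of n k J \<omega>] show "k \<in> {..<n}" by (cases "k < n") auto
    next
      fix k assume "k \<in> {..<n}"
      with lt[of k] that show "k \<in> {k. ?R k \<le> s}" by auto
    qed
    then have "\<forall>s\<in>{t..<t + (?R n - t)}. renewal_count J s \<omega> = renewal_count J t \<omega>"
      using n by (simp add: renewal_count_def)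
    moreover have "0 < ?R n - t" using n by simp
    ultimately show ?thesis by (intro exI conjI)
  qed
qed

lemma renewal_sum_count_le:
  assumes "0 \<le> t" shows "renewal_sum J (renewal_count J t \<omega>) \<omega> \<le> t"
proof (cases "finite {n. renewal_sum J n \<omega> \<le> t}")
  case True
  then have "Max {n. renewal_sum J n \<omega> \<le> t} \<in> {n. renewal_sum J n \<omega> \<le> t}"
    using assms renewal_sum_0[of J \<omega>] by (intro Max_in) (auto intro!: exI[of _ 0])
  then show ?thesis by (simp add: renewal_count_def)
next
  case False
  then obtain n where "renewal_count J t \<omega> \<le> n" "renewal_sum J n \<omega> \<le> t"
    unfolding infinite_nat_iff_unbounded_le by auto
  from order_trans[OF renewal_sum_mono[OF this(1)] this(2)] show ?thesis .
qed

text \<open>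
  These assumptions hold at every sample point, not only almost surely, which is what measurability
  with respect to an incomplete measure requires.
\<close>

locale ar_paths =
  fixes N :: "'w measure" and J :: "nat \<Rightarrow> real \<Rightarrow> 'w \<Rightarrow> 'm option" and T :: "nat \<Rightarrow> 'w \<Rightarrow> real"
    and lam b :: real
  assumes J_meas: "\<And>n t. 1 \<le> n \<Longrightarrow> 0 \<le> t \<Longrightarrow> J n t \<in> measurable N (count_space UNIV)"
    and J_rc: "\<And>n \<omega>. 1 \<le> n \<Longrightarrow> \<omega> \<in> space N \<Longrightarrow> right_constant (\<lambda>t. J n t \<omega>)"
    and T_measurable: "\<And>n. 1 \<le> n \<Longrightarrow> T n \<in> borel_measurable N"
begin

lemma absorption_measurable[measurable]: "absorption_time (J (Suc n)) \<in> borel_measurable N"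
  by (rule measurable_absorption_time[OF J_meas J_rc]) auto

lemma T_Suc_measurable[measurable]: "T (Suc n) \<in> borel_measurable N"
  by (rule T_measurable) simp

lemma ar_process_measurable[measurable]: "ar_process lam J T x n \<in> borel_measurable N"
proof (induction n)
  case (Suc n)
  note Suc[measurable]
  show ?case unfolding ar_process.simps(2)[abs_def] innovation_def by measurable
qed simp

lemma renewal_sum_measurable[measurable]: "renewal_sum J n \<in> borel_measurable N"
proof (induction n)
  case (Suc n)
  note Suc[measurable]
  show ?case unfolding renewal_sum_Suc[abs_def] by measurable
qed (simp add: renewal_sum_0[abs_def])

lemma renewal_count_measurable:
  assumes [measurable]: "U \<in> borel_measurable N"
  shows "(\<lambda>\<omega>. renewal_count J (U \<omega>) \<omega>) \<in> measurable N (count_space UNIV)"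
  unfolding renewal_count_def by measurable

lemma embedded_process_measurable[measurable]: "embedded_process lam J T x t \<in> borel_measurable N"
  unfolding embedded_process_def[abs_def] Let_def
  by (rule measurable_compose_countable[OF _ renewal_count_measurable[of "\<lambda>_. t", simplified]]) measurable

lemma embedded_process_right:
  assumes "0 \<le> t" "b \<le> embedded_process lam J T x t \<omega>" "t < u"
  shows "\<exists>q\<in>\<rat>. 0 \<le> q \<and> q < u \<and> b \<le> embedded_process lam J T x q \<omega>"
proof -
  obtain q where "q \<in> \<rat>" "0 \<le> q" "t < q" "q < u" "renewal_count J q \<omega> = renewal_count J t \<omega>"
    using right_constant_rational[OF renewal_count_right_constant[of J \<omega>] assms(1) refl assms(3)] by blast
  then show ?thesis using assms(2) by (intro bexI[of _ q]) (auto simp: embedded_process_def Let_def)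
qed

text \<open>
  The crossing transform is the integral of a function that must be measurable as it stands, since
  null sets cannot be discarded when the measure is not complete. The crossing time is an infimum
  over rational times, and the state at that time is the value of a right-continuous path at a
  measurable time.
\<close>

lemma crossing_event_sets: "crossing_event N lam J T b x i \<in> sets N"
proof -
  define Hs where "Hs \<omega> = {t. 0 \<le> t \<and> b \<le> embedded_process lam J T x t \<omega>}" for \<omega>
  define U where "U \<omega> = (if Hs \<omega> = {} then 0 else Inf (Hs \<omega>))" for \<omega>
  have bdd: "bdd_below (Hs \<omega>)" for \<omega> by (auto simp: Hs_def)
  have ne_iff: "Hs \<omega> \<noteq> {} \<longleftrightarrow> (\<exists>q\<in>\<rat> \<inter> {0..}. b \<le> embedded_process lam J T x q \<omega>)" for \<omega>
    using embedded_process_right[of t x \<omega> "t + 1" for t] by (fastforce simp: Hs_def)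
  have less_iff: "Inf (Hs \<omega>) < s \<longleftrightarrow> (\<exists>q\<in>\<rat> \<inter> {0..}. q < s \<and> b \<le> embedded_process lam J T x q \<omega>)"
    if "Hs \<omega> \<noteq> {}" for \<omega> s
    unfolding cInf_less_iff[OF that bdd] using embedded_process_right[of _ x \<omega> s] by (auto simp: Hs_def)
  have cr: "countable (\<rat> \<inter> {0::real..})" by (intro countable_Int1 countable_rat)
  have ne_sets[measurable]: "{\<omega>\<in>space N. Hs \<omega> \<noteq> {}} \<in> sets N"
    unfolding ne_iff using cr by measurable
  have U_meas[measurable]: "U \<in> borel_measurable N"
  proof (rule borel_measurableI_less)
    fix s
    have "{\<omega>\<in>space N. U \<omega> < s} = {\<omega>\<in>space N. (Hs \<omega> \<noteq> {} \<and> (\<exists>q\<in>\<rat> \<inter> {0..}. q < s \<and> b \<le> embedded_process lam J T x q \<omega>)) \<or> (\<not> Hs \<omega> \<noteq> {} \<and> 0 < s)}"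
      using less_iff by (auto simp: U_def)
    also have "\<dots> \<in> sets N" using cr by measurable
    finally show "{\<omega>\<in>space N. U \<omega> < s} \<in> sets N" .
  qed
  have U0: "0 \<le> U \<omega>" for \<omega> by (auto simp: U_def Hs_def intro!: cInf_greatest)
  have "crossing_event N lam J T b x i =
     {\<omega>\<in>space N. Hs \<omega> \<noteq> {}} \<inter> (\<Union>k. {\<omega>\<in>space N. renewal_count J (U \<omega>) \<omega> = k} \<inter>
        {\<omega>\<in>space N. J (Suc k) (max 0 (U \<omega> - renewal_sum J k \<omega>)) \<omega> = Some i})"
  proof -
    have mx: "max 0 (U \<omega> - renewal_sum J k \<omega>) = U \<omega> - renewal_sum J k \<omega>"
      if "renewal_count J (U \<omega>) \<omega> = k" for \<omega> k
      using renewal_sum_count_le[OF U0[of \<omega>], of J \<omega>] that by simp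
    have "\<omega> \<in> crossing_event N lam J T b x i \<longleftrightarrow> \<omega> \<in> space N \<and> Hs \<omega> \<noteq> {} \<and>
        (\<exists>k. renewal_count J (U \<omega>) \<omega> = k \<and> J (Suc k) (U \<omega> - renewal_sum J k \<omega>) \<omega> = Some i)" for \<omega>
      unfolding crossing_event_def Let_def Hs_def[symmetric] embedded_state_def
      by (cases "Hs \<omega> = {}") (simp_all add: U_def)
    then show ?thesis using mx by (intro set_eqI) (simp, metis)
  qed
  also have "\<dots> \<in> sets N"
  proof (intro sets.Int sets.countable_UN ne_sets)
    show "range (\<lambda>k. {\<omega>\<in>space N. renewal_count J (U \<omega>) \<omega> = k} \<inter>
        {\<omega>\<in>space N. J (Suc k) (max 0 (U \<omega> - renewal_sum J k \<omega>)) \<omega> = Some i}) \<subseteq> sets N"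
    proof (intro image_subsetI sets.Int)
      fix k
      show "{\<omega>\<in>space N. renewal_count J (U \<omega>) \<omega> = k} \<in> sets N"
        using measurable_sets[OF renewal_count_measurable[OF U_meas], of "{k}"] by (simp add: vimage_def Int_def conj_commute)
      show "{\<omega>\<in>space N. J (Suc k) (max 0 (U \<omega> - renewal_sum J k \<omega>)) \<omega> = Some i} \<in> sets N"
        by (rule measurable_random_time[OF J_meas J_rc]) auto
    qed
  qed
  finally show ?thesis .
qed

end


section \<open>The law of the absorption time\<close>

context phase_type
begin

lemma DERIV_sum_occ: "((\<lambda>t. - (\<Sum>i\<in>UNIV. occ t i)) has_real_derivative dens t) (at t)"
proof -
  have "((\<lambda>t. - (\<Sum>k\<in>UNIV. init_coord k * exit_coord k / \<mu> k * exp (- of_real t * \<mu> k))) has_vector_derivative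
      (\<Sum>k\<in>UNIV. init_coord k * exit_coord k * exp (- of_real t * \<mu> k))) (at t)"
  proof -
    have "((\<lambda>z. - (\<Sum>k\<in>UNIV. init_coord k * exit_coord k / \<mu> k * exp (- z * \<mu> k))) has_field_derivative
      (\<Sum>k\<in>UNIV. init_coord k * exit_coord k * exp (- of_real t * \<mu> k))) (at (of_real t))"
    proof -
      have "\<mu> k \<noteq> 0" for k using Re_eig_pos[of k] by auto
      then show ?thesis
        by (auto intro!: derivative_eq_intros sum.cong simp: sum_negf[symmetric])
    qed
    then show ?thesis by (rule has_vector_derivative_real_field)
  qed
  then have "((\<lambda>t. Re (- complex_of_real (\<Sum>i\<in>UNIV. occ t i))) has_vector_derivative Re (complex_of_real (dens t))) (at t)"
    unfolding sum_occ_D dens_D by (rule bounded_linear.has_vector_derivative[OF bounded_linear_Re])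
  then show ?thesis by (simp add: has_real_derivative_iff_has_vector_derivative)
qed

lemma sum_occ_0: "(\<Sum>i\<in>UNIV. occ 0 i) = 1"
proof -
  have "complex_of_real (\<Sum>i\<in>UNIV. occ 0 i) = of_real 1"
    unfolding sum_occ_D using coord_sum by simp
  then show ?thesis using of_real_eq_iff by blast
qed

lemma exp_eig_tendsto_0: "Re z < Re (\<mu> k) \<Longrightarrow> ((\<lambda>t. exp (of_real t * (z - \<mu> k))) \<longlongrightarrow> 0) at_top"
proof -
  assume a: "Re z < Re (\<mu> k)"
  have "((\<lambda>t. exp ((Re z - Re (\<mu> k)) * t)) \<longlongrightarrow> 0) at_top"
    by (rule filterlim_compose[OF exp_at_bot filterlim_tendsto_neg_mult_at_bot[OF tendsto_const _ filterlim_ident]])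
       (use a in simp)
  then show ?thesis by (subst tendsto_norm_zero_iff[symmetric]) (simp add: mult.commute)
qed

lemma sum_occ_tendsto: "((\<lambda>t. \<Sum>i\<in>UNIV. occ t i) \<longlongrightarrow> 0) at_top"
proof -
  have "((\<lambda>t. \<Sum>k\<in>UNIV. init_coord k * exit_coord k / \<mu> k * exp (of_real t * (0 - \<mu> k))) \<longlongrightarrow> (\<Sum>k\<in>UNIV. init_coord k * exit_coord k / \<mu> k * 0)) at_top"
    by (intro tendsto_intros exp_eig_tendsto_0) (simp add: Re_eig_pos)
  then have "((\<lambda>t. complex_of_real (\<Sum>i\<in>UNIV. occ t i)) \<longlongrightarrow> of_real 0) at_top"
    unfolding sum_occ_D by (simp add: mult.commute)
  then show ?thesis by (subst (asm) tendsto_of_real_iff)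
qed

lemma continuous_dens: "continuous_on A dens"
proof -
  have "continuous_on A (\<lambda>t. Re (complex_of_real (dens t)))"
    unfolding dens_D by (intro continuous_intros)
  then show ?thesis by simp
qed

lemma dens_measurable[measurable]: "dens \<in> borel_measurable borel"
  using continuous_dens by (rule borel_measurable_continuous_onI)

lemma continuous_occ: "continuous_on A (\<lambda>t. occ t i)"
  unfolding occ_def by (intro continuous_on_sum continuous_on_mult continuous_on_const continuous_on_subset[OF continuous_transition]) auto

lemma occ_measurable[measurable]: "(\<lambda>t. occ t i) \<in> borel_measurable borel"
  using continuous_occ by (rule borel_measurable_continuous_onI)

lemma sum_occ_le_1:
  assumes "0 \<le> t" shows "(\<Sum>i\<in>UNIV. occ t i) \<le> 1"
  using DERIV_nonneg_imp_nondecreasing[OF assms, of "\<lambda>t. - (\<Sum>i\<in>UNIV. occ t i)"] DERIV_sum_occ dens_nonneg sum_occ_0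
  by force

lemma occ_le_1: "0 \<le> t \<Longrightarrow> occ t i \<le> 1"
  using sum_occ_le_1[of t] member_le_sum[of i UNIV "occ t"] occ_nonneg by force

definition phase_law :: "real measure" where
  "phase_law = density lborel (\<lambda>s. ennreal (dens s) * indicator {0..} s)"

lemma sets_phase_law[simp, measurable_cong]: "sets phase_law = sets borel"
  by (simp add: phase_law_def)

lemma space_phase_law[simp]: "space phase_law = UNIV"
  by (simp add: phase_law_def)

lemma cdf_phase_law:
  assumes "0 \<le> t" shows "emeasure phase_law {..t} = ennreal (1 - (\<Sum>i\<in>UNIV. occ t i))"
proof -
  have "emeasure phase_law {..t} = (\<integral>\<^sup>+ s. ennreal (dens s) * indicator {0..t} s \<partial>lborel)"
    unfolding phase_law_def by (subst emeasure_density) (auto intro!: nn_integral_cong split: split_indicator)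
  also have "\<dots> = ennreal (- (\<Sum>i\<in>UNIV. occ t i) - (- (\<Sum>i\<in>UNIV. occ 0 i)))"
    using DERIV_sum_occ dens_nonneg assms by (intro nn_integral_FTC_Icc) (auto intro: DERIV_subset has_real_derivative_iff_has_vector_derivative[THEN iffD1])
  finally show ?thesis by (simp add: sum_occ_0)
qed

lemma emeasure_phase_law: "emeasure phase_law UNIV = 1"
proof -
  have "emeasure phase_law UNIV = (\<integral>\<^sup>+ s. ennreal (dens s) * indicator {0..} s \<partial>lborel)"
    unfolding phase_law_def by (subst emeasure_density) auto
  also have "\<dots> = ennreal (- 0 - (- (\<Sum>i\<in>UNIV. occ 0 i)))"
    using DERIV_sum_occ dens_nonneg by (intro nn_integral_FTC_atLeast tendsto_minus sum_occ_tendsto) auto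
  finally show ?thesis by (simp add: sum_occ_0)
qed

lemma prob_space_phase_law: "prob_space phase_law"
  by (rule prob_spaceI) (simp add: emeasure_phase_law)

lemma distr_eq_phase_law:
  assumes "prob_space M" and [measurable]: "S \<in> borel_measurable M" and nn: "\<And>\<omega>. 0 \<le> S \<omega>"
    and law: "\<And>t. 0 \<le> t \<Longrightarrow> measure M {\<omega>\<in>space M. S \<omega> \<le> t} = 1 - (\<Sum>i\<in>UNIV. occ t i)"
  shows "distr M borel S = phase_law"
proof -
  interpret prob_space M by fact
  interpret D: prob_space "distr M borel S" by (rule prob_space_distr) simp
  interpret P: prob_space phase_law by (rule prob_space_phase_law)
  have P: "measure phase_law {..t} = measure M {\<omega>\<in>space M. S \<omega> \<le> t}" for t
  proof (cases "0 \<le> t")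
    case True
    have "0 \<le> 1 - (\<Sum>i\<in>UNIV. occ t i)" using sum_occ_le_1[OF True] by simp
    then show ?thesis using cdf_phase_law[OF True] law[OF True] by (simp add: measure_def)
  next
    case False
    then have "{\<omega>\<in>space M. S \<omega> \<le> t} = {}" using nn by (auto simp: not_le) (meson le_less_trans not_le)
    moreover have "emeasure phase_law {..t} = 0"
      unfolding phase_law_def using False by (subst emeasure_density) (auto intro!: nn_integral_zero' AE_I2 split: split_indicator)
    ultimately show ?thesis unfolding measure_def by (simp only: emeasure_empty)
  qed
  show ?thesis
  proof (rule cdf_unique)
    show "real_distribution (distr M borel S)" "real_distribution phase_law"
      by (simp_all add: real_distribution_def real_distribution_axioms_def D.prob_space_axioms P.prob_space_axioms)
    show "cdf (distr M borel S) = cdf phase_law"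
      by (rule ext) (simp add: cdf_def P measure_distr vimage_def Int_def conj_commute)
  qed
qed

lemma AE_phase_law_neq: "AE s in phase_law. s \<noteq> c"
  unfolding phase_law_def using AE_lborel_singleton[of c] by (subst AE_density) auto

lemma nn_integral_phase_law: "g \<in> borel_measurable borel \<Longrightarrow> (\<integral>\<^sup>+ s. g s \<partial>phase_law) = (\<integral>\<^sup>+ s. ennreal (dens s) * indicator {0..} s * g s \<partial>lborel)"
  unfolding phase_law_def by (rule nn_integral_density) auto

lemma phase_law_exponential_moment:
  obtains e where "0 < e" "(\<integral>\<^sup>+ s. ennreal (exp (e * s)) \<partial>phase_law) < \<infinity>"
proof -
  \<comment> \<open>any exponent below all real parts of the eigenvalues serves\<close>
  define e where "e = Min (range (\<lambda>k. Re (\<mu> k))) / 2"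
  have m: "0 < Min (range (\<lambda>k. Re (\<mu> k)))" "Min (range (\<lambda>k. Re (\<mu> k))) \<le> Re (\<mu> k)" for k
    using Re_eig_pos by auto
  have e: "0 < e" "e < Re (\<mu> k)" for k using m(1) m(2)[of k] unfolding e_def by linarith+
  define F where "F s = Re (\<Sum>k\<in>UNIV. init_coord k * exit_coord k * (exp (of_real s * (of_real e - \<mu> k)) / (of_real e - \<mu> k)))" for s
  have ne: "of_real e - \<mu> k \<noteq> 0" for k using e(2)[of k] by (metis Re_complex_of_real eq_iff_diff_eq_0 less_irrefl)
  have der: "(F has_real_derivative exp (e * s) * dens s) (at s)" for s
  proof -
    have "((\<lambda>z. \<Sum>k\<in>UNIV. init_coord k * exit_coord k * (exp (z * (of_real e - \<mu> k)) / (of_real e - \<mu> k))) has_field_derivative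
       (\<Sum>k\<in>UNIV. init_coord k * exit_coord k * exp (of_real s * (of_real e - \<mu> k)))) (at (of_real s))"
      using ne by (auto intro!: derivative_eq_intros sum.cong)
    then have "((\<lambda>s. \<Sum>k\<in>UNIV. init_coord k * exit_coord k * (exp (of_real s * (of_real e - \<mu> k)) / (of_real e - \<mu> k))) has_vector_derivative
       (\<Sum>k\<in>UNIV. init_coord k * exit_coord k * exp (of_real s * (of_real e - \<mu> k)))) (at s)"
      by (rule has_vector_derivative_real_field)
    from bounded_linear.has_vector_derivative[OF bounded_linear_Re this]
    have "(F has_vector_derivative Re (\<Sum>k\<in>UNIV. init_coord k * exit_coord k * exp (of_real s * (of_real e - \<mu> k)))) (at s)"
      unfolding F_def .
    moreover have "(\<Sum>k\<in>UNIV. init_coord k * exit_coord k * exp (of_real s * (of_real e - \<mu> k))) = complex_of_real (exp (e * s) * dens s)"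
      by (simp add: dens_D sum_distrib_left exp_of_real[symmetric] exp_diff exp_minus algebra_simps divide_inverse)
    ultimately have "(F has_vector_derivative Re (complex_of_real (exp (e * s) * dens s))) (at s)"
      by (simp only:)
    then show ?thesis by (simp add: has_real_derivative_iff_has_vector_derivative)
  qed
  have lim: "(F \<longlongrightarrow> 0) at_top"
  proof -
    have "(F \<longlongrightarrow> Re (\<Sum>k\<in>UNIV. init_coord k * exit_coord k * (0 / (of_real e - \<mu> k)))) at_top"
      unfolding F_def by (intro tendsto_intros exp_eig_tendsto_0 ne) (simp add: e)
    then show ?thesis by simp
  qed
  have "(\<integral>\<^sup>+ s. ennreal (exp (e * s)) \<partial>phase_law) = (\<integral>\<^sup>+ s. ennreal (exp (e * s) * dens s) * indicator {0..} s \<partial>lborel)"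
    by (subst nn_integral_phase_law) (auto intro!: nn_integral_cong simp: ennreal_mult dens_nonneg mult.commute split: split_indicator)
  also have "\<dots> = ennreal (0 - F 0)"
    using der lim by (intro nn_integral_FTC_atLeast) (auto simp: dens_nonneg)
  also have "\<dots> < \<infinity>" by simp
  finally show thesis using that[of e] e by simp
qed

lemma integral_phase_law_exp:
  assumes c: "0 < c" and v: "v \<notin> range \<mu>"
  shows "(\<integral>s. indicator {..<c} s * exp (v * of_real s) \<partial>phase_law) =
     exp_psi1 Q \<alpha> v - exp (v * of_real c) * (\<Sum>i\<in>UNIV. of_real (occ c i) * exp_psi_unit Q i v)"
proof -
  let ?g = "\<lambda>s. exp (v * of_real s) * of_real (dens s) :: complex"
  have "phase_law = density lborel (\<lambda>s. ennreal (indicator {0..} s * dens s))"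
    unfolding phase_law_def by (intro arg_cong2[where f = density] ext) (auto split: split_indicator)
  then have "(\<integral>s. indicator {..<c} s * exp (v * of_real s) \<partial>phase_law) =
      (\<integral>s. (indicator {0..} s * dens s) *\<^sub>R (indicator {..<c} s * exp (v * of_real s)) \<partial>lborel)"
    by (simp only:) (rule integral_density, auto intro: dens_nonneg split: split_indicator)
  also have "\<dots> = (\<integral>s. indicator {0..c} s *\<^sub>R ?g s \<partial>lborel)"
  proof (rule integral_cong_AE)
    show "AE s in lborel. (indicator {0..} s * dens s) *\<^sub>R (indicator {..<c} s * exp (v * of_real s)) = indicator {0..c} s *\<^sub>R ?g s"
      using AE_lborel_singleton[of c]
      by eventually_elim (auto simp: scaleR_conv_of_real split: split_indicator)
  qed auto
  also have "\<dots> = integral {0..c} ?g"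
  proof -
    have "set_integrable lborel {0..c} ?g"
      by (intro borel_integrable_atLeastAtMost' continuous_intros continuous_dens)
    from set_borel_integral_eq_integral(2)[OF this] show ?thesis by (simp add: set_lebesgue_integral_def)
  qed
  also have "\<dots> = exp_psi1 Q \<alpha> v - exp (v * of_real c) * (\<Sum>i\<in>UNIV. of_real (occ c i) * exp_psi_unit Q i v)"
    using exp_dens_has_integral[of c v] c v by (intro integral_unique) auto
  finally show ?thesis .
qed

end

lemma (in prob_space) prob_split_state:
  fixes X :: "'a \<Rightarrow> 's :: finite"
  assumes "X \<in> measurable M (count_space UNIV)" "{\<omega>\<in>space M. P \<omega>} \<in> events"
  shows "prob {\<omega>\<in>space M. P \<omega>} = (\<Sum>s\<in>UNIV. prob {\<omega>\<in>space M. X \<omega> = s \<and> P \<omega>})"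
proof -
  have m: "{\<omega>\<in>space M. X \<omega> = s \<and> P \<omega>} \<in> events" for s
    using sets.Int[OF measurable_sets[OF assms(1), of "{s}"] assms(2)] by (simp add: vimage_def Int_def conj_ac cong: conj_cong)
  have "prob (\<Union>s\<in>UNIV. {\<omega>\<in>space M. X \<omega> = s \<and> P \<omega>}) = (\<Sum>s\<in>UNIV. prob {\<omega>\<in>space M. X \<omega> = s \<and> P \<omega>})"
    using m by (intro finite_measure_finite_Union) (auto simp: disjoint_family_on_def)
  moreover have "(\<Union>s\<in>UNIV. {\<omega>\<in>space M. X \<omega> = s \<and> P \<omega>}) = {\<omega>\<in>space M. P \<omega>}" by auto
  ultimately show ?thesis by simp
qed

locale phase_chain = phase_type V W Q \<alpha> \<mu> + prob_space M
  for V W :: "complex ^ 'm ^ 'm" and Q \<alpha> \<mu> and M :: "'w measure" +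
  fixes Z :: "real \<Rightarrow> 'w \<Rightarrow> 'm option"
  assumes chain: "markov_chain M (hat_generator Q) (hat_initial \<alpha>) Z"
begin

lemma Z_meas: "0 \<le> t \<Longrightarrow> Z t \<in> measurable M (count_space UNIV)"
  using chain by (simp add: markov_chain_def)

lemma Z_rc: "\<omega> \<in> space M \<Longrightarrow> right_constant (\<lambda>t. Z t \<omega>)"
  using chain by (auto simp: markov_chain_def right_constant_def)

lemma Z_event: "0 \<le> t \<Longrightarrow> {\<omega>\<in>space M. Z t \<omega> = s} \<in> events"
  using measurable_sets[OF Z_meas, of t "{s}"] by (simp add: vimage_def Int_def conj_commute)

lemma Z_event2: "0 \<le> t \<Longrightarrow> 0 \<le> t' \<Longrightarrow> {\<omega>\<in>space M. Z t \<omega> = s \<and> Z t' \<omega> = s'} \<in> events"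
  using sets.Int[OF Z_event[of t s] Z_event[of t' s']] by (simp add: Int_def conj_ac cong: conj_cong)

lemma fdd: "t 0 = 0 \<Longrightarrow> (\<And>k. k < n \<Longrightarrow> t k \<le> t (Suc k)) \<Longrightarrow>
    prob {\<omega>\<in>space M. \<forall>k\<le>n. Z (t k) \<omega> = s k} =
    hat_initial \<alpha> $ s 0 * (\<Prod>k<n. matrix_exp ((t (Suc k) - t k) *\<^sub>R hat_generator Q) $ s k $ s (Suc k))"
  for t :: "nat \<Rightarrow> real"
  using chain unfolding markov_chain_def by blast

lemma prob_Z0: "prob {\<omega>\<in>space M. Z 0 \<omega> = None} = 0"
  using fdd[of "\<lambda>_. 0" 0 "\<lambda>_. None"] by (simp add: hat_initial_def)

lemma prob_Z:
  assumes "0 \<le> t" shows "prob {\<omega>\<in>space M. Z t \<omega> = Some i} = occ t i"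
proof -
  have "prob {\<omega>\<in>space M. Z 0 \<omega> = s \<and> Z t \<omega> = Some i} = hat_initial \<alpha> $ s * matrix_exp (t *\<^sub>R hat_generator Q) $ s $ Some i" for s
    using fdd[of "\<lambda>k. if k = 0 then 0 else t" 1 "\<lambda>k. if k = 0 then s else Some i"] assms
    by (simp add: le_Suc_eq all_conj_distrib conj_commute)
  then have "prob {\<omega>\<in>space M. Z t \<omega> = Some i} = (\<Sum>s\<in>UNIV. hat_initial \<alpha> $ s * matrix_exp (t *\<^sub>R hat_generator Q) $ s $ Some i)"
    using prob_split_state[OF Z_meas[of 0] Z_event[OF assms]] by simp
  then show ?thesis
    by (simp add: UNIV_option_conv sum.reindex hat_initial_def matrix_exp_hat_generator occ_def)
qed

lemma prob_Z_None:
  assumes "0 \<le> t" shows "prob {\<omega>\<in>space M. Z t \<omega> = None} = 1 - (\<Sum>i\<in>UNIV. occ t i)"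
proof -
  have "1 = (\<Sum>s\<in>UNIV. prob {\<omega>\<in>space M. Z t \<omega> = s \<and> True})"
    using prob_split_state[OF Z_meas[OF assms], of "\<lambda>_. True"] by (simp add: prob_space)
  then show ?thesis using assms by (simp add: UNIV_option_conv sum.reindex prob_Z)
qed

lemma prob_revive:
  assumes "0 \<le> r" "r \<le> s" shows "prob {\<omega>\<in>space M. Z r \<omega> = None \<and> Z s \<omega> = Some j} = 0"
proof -
  have "prob {\<omega>\<in>space M. Z 0 \<omega> = s0 \<and> Z r \<omega> = None \<and> Z s \<omega> = Some j} = 0" for s0
    using fdd[of "\<lambda>k. if k = 0 then 0 else if k = 1 then r else s" 2 "\<lambda>k. if k = 0 then s0 else if k = 1 then None else Some j"] assms
    by (simp add: le_Suc_eq numeral_2_eq_2 less_Suc_eq all_conj_distrib lessThan_Suc matrix_exp_hat_generator conj_ac)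
  then show ?thesis
    using prob_split_state[OF Z_meas[of 0] Z_event2[of r s None "Some j"]] assms by simp
qed

text \<open>
  For two rational times this is a statement about finite-dimensional laws. A revival at real times
  would by right-continuity be seen at rational times.
\<close>

lemma AE_absorbing: "AE \<omega> in M. \<forall>r\<ge>0. \<forall>s\<ge>r. Z r \<omega> = None \<longrightarrow> Z s \<omega> = None"
proof -
  have "AE \<omega> in M. \<not> (Z r \<omega> = None \<and> Z s \<omega> = Some j)" if "0 \<le> r" "r \<le> s" for r s j
    using that prob_revive[OF that, of j] Z_event2[of r s None "Some j"]
    by (subst AE_iff_measurable[OF _ refl]) (auto simp: emeasure_eq_measure)
  then have "AE \<omega> in M. \<forall>r\<in>\<rat> \<inter> {0..}. \<forall>s\<in>\<rat> \<inter> {r..}. \<forall>j\<in>UNIV. \<not> (Z r \<omega> = None \<and> Z s \<omega> = Some j)"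
    by (intro AE_ball_countable[THEN iffD2] ballI countable_Int1 countable_rat) auto
  then show ?thesis
    using AE_space
  proof eventually_elim
    case (elim \<omega>)
    show ?case
    proof (intro allI impI, rule ccontr)
      fix r s assume *: "0 \<le> r" "r \<le> s" "Z r \<omega> = None" "Z s \<omega> \<noteq> None"
      then obtain j where j: "Z s \<omega> = Some j" by auto
      have "0 \<le> s" "s < s + 1" using * by auto
      from right_constant_rational[OF Z_rc[OF elim(2)] this(1) j this(2)]
      obtain q where q: "q \<in> \<rat>" "s < q" "Z q \<omega> = Some j" by blast
      have "r < q" using * q by simp
      from right_constant_rational[OF Z_rc[OF elim(2)] *(1) *(3) this]
      obtain p where p: "p \<in> \<rat>" "0 \<le> p" "p < q" "Z p \<omega> = None" by blast
      show False using elim(1) p q by (metis Int_iff UNIV_I atLeast_iff less_imp_le)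
    qed
  qed
qed

lemma AE_absorbed: "AE \<omega> in M. \<exists>t\<ge>0. Z t \<omega> = None"
proof -
  have ev: "{\<omega>\<in>space M. Z (real n) \<omega> \<noteq> None} \<in> events" for n
  proof -
    have "{\<omega>\<in>space M. Z (real n) \<omega> \<noteq> None} = space M - {\<omega>\<in>space M. Z (real n) \<omega> = None}" by auto
    then show ?thesis using Z_event[of "real n" None] by auto
  qed
  let ?N = "{\<omega>\<in>space M. \<forall>n. Z (real n) \<omega> \<noteq> None}"
  have N: "?N = (\<Inter>n. {\<omega>\<in>space M. Z (real n) \<omega> \<noteq> None})" by auto
  have Nev: "?N \<in> events" unfolding N using ev by (intro sets.countable_INT') auto
  have le: "prob ?N \<le> (\<Sum>i\<in>UNIV. occ (real n) i)" for n
  proof -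
    have "prob ?N \<le> prob (space M - {\<omega>\<in>space M. Z (real n) \<omega> = None})"
    proof (rule finite_measure_mono)
      show "?N \<subseteq> space M - {\<omega>\<in>space M. Z (real n) \<omega> = None}" by blast
    qed (use Z_event[of "real n" None] in simp)
    also have "\<dots> = (\<Sum>i\<in>UNIV. occ (real n) i)"
      using prob_compl[OF Z_event[of "real n" None]] prob_Z_None[of "real n"] by simp
    finally show ?thesis .
  qed
  have "prob ?N \<le> 0"
  proof (rule LIMSEQ_le_const)
    show "(\<lambda>n. \<Sum>i\<in>UNIV. occ (real n) i) \<longlonglongrightarrow> 0"
      by (rule filterlim_compose[OF sum_occ_tendsto filterlim_real_sequentially])
  qed (use le in auto)
  then have "prob ?N = 0" using measure_nonneg by (simp add: antisym)
  then have "AE \<omega> in M. \<not> (\<forall>n. Z (real n) \<omega> \<noteq> None)"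
    using Nev by (subst AE_iff_measurable[OF _ refl]) (auto simp: emeasure_eq_measure)
  then show ?thesis by eventually_elim (metis of_nat_0_le_iff)
qed

lemma AE_start: "AE \<omega> in M. Z 0 \<omega> \<noteq> None"
  using prob_Z0 Z_event[of 0 None] by (subst AE_iff_measurable[OF _ refl]) (auto simp: emeasure_eq_measure)

lemma AE_absorption_time:
  "AE \<omega> in M. 0 < absorption_time Z \<omega> \<and> (\<forall>t\<ge>0. Z t \<omega> = None \<longleftrightarrow> absorption_time Z \<omega> \<le> t)"
  using AE_absorbing AE_absorbed AE_start AE_space
proof eventually_elim
  case (elim \<omega>)
  then obtain t0 where t0: "0 \<le> t0" "Z t0 \<omega> = None" by blast
  show ?case
    using absorption_time_iff[of Z \<omega> t0, OF Z_rc[OF elim(4)] _ t0 elim(3)] elim(1) by blast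
qed

lemma distr_absorption_time: "distr M borel (absorption_time Z) = phase_law"
proof (rule distr_eq_phase_law)
  show meas: "absorption_time Z \<in> borel_measurable M"
    by (rule measurable_absorption_time[OF Z_meas Z_rc])
  fix t :: real assume t: "0 \<le> t"
  have "prob {\<omega>\<in>space M. absorption_time Z \<omega> \<le> t} = prob {\<omega>\<in>space M. Z t \<omega> = None}"
  proof (rule finite_measure_eq_AE)
    show "AE \<omega> in M. \<omega> \<in> {\<omega>\<in>space M. absorption_time Z \<omega> \<le> t} \<longleftrightarrow> \<omega> \<in> {\<omega>\<in>space M. Z t \<omega> = None}"
      using AE_absorption_time by eventually_elim (use t in auto)
    show "{\<omega>\<in>space M. absorption_time Z \<omega> \<le> t} \<in> events" using meas by measurable
  qed (use Z_event[OF t] in auto)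
  then show "prob {\<omega>\<in>space M. absorption_time Z \<omega> \<le> t} = 1 - (\<Sum>i\<in>UNIV. occ t i)"
    by (simp add: prob_Z_None[OF t])
qed (auto simp: absorption_time_nonneg prob_space_axioms)

end


section \<open>One step of the process below the barrier\<close>

context prob_space
begin

lemma subalgebra_measurable:
  assumes "sets N \<subseteq> events" "space N = space M" "X \<in> measurable N S"
  shows "X \<in> measurable M S"
  using measurable_from_subalg[of M N X S] assms by (simp add: subalgebra_def)

lemma indep_var_subalgebras:
  assumes ind: "indep_set (sets N1) (sets N2)" and sp: "space N1 = space M" "space N2 = space M"
    and X: "X \<in> measurable N1 S1" and Y: "Y \<in> measurable N2 S2"
  shows "indep_var S1 X S2 Y"
proof -
  note ev = indep_setD_ev1[OF ind] indep_setD_ev2[OF ind]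
  have 1: "sigma_sets (space M) {X -` A \<inter> space M |A. A \<in> sets S1} \<subseteq> sets N1"
    using sets.sigma_sets_subset[of "{X -` A \<inter> space M |A. A \<in> sets S1}" N1] measurable_sets[OF X] sp by auto
  have 2: "sigma_sets (space M) {Y -` A \<inter> space M |A. A \<in> sets S2} \<subseteq> sets N2"
    using sets.sigma_sets_subset[of "{Y -` A \<inter> space M |A. A \<in> sets S2}" N2] measurable_sets[OF Y] sp by auto
  have "indep_set (sigma_sets (space M) {X -` A \<inter> space M |A. A \<in> sets S1}) (sigma_sets (space M) {Y -` A \<inter> space M |A. A \<in> sets S2})"
    unfolding indep_set_def
    by (rule indep_sets_mono_sets[OF ind[unfolded indep_set_def]]) (use 1 2 in \<open>auto split: bool.split\<close>)
  then show ?thesis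
    using subalgebra_measurable[OF ev(1) sp(1) X] subalgebra_measurable[OF ev(2) sp(2) Y]
    by (simp add: indep_var_eq)
qed

text \<open>
  Fubini's theorem for an integrand that depends on \<open>X\<close> and, through a sub-\<open>\<sigma>\<close>-algebra independent of
  \<open>X\<close>, on the sample point itself: the joint law of \<open>X\<close> and the sample point is a product. The whole
  path of a chain enters in this way, without a measure on the path space.
\<close>

lemma integral_indep:
  fixes F :: "'b \<times> 'a \<Rightarrow> 'c :: {banach, second_countable_topology}"
  assumes ind: "indep_set (sets N1) (sets N2)" and sp: "space N1 = space M" "space N2 = space M"
    and X: "X \<in> measurable N1 S" and F: "F \<in> borel_measurable (S \<Otimes>\<^sub>M N2)"
    and B: "\<And>z \<omega>. norm (F (z, \<omega>)) \<le> B"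
  shows "(\<integral>\<omega>. F (X \<omega>, \<omega>) \<partial>M) = (\<integral>\<omega>. (\<integral>\<omega>'. F (X \<omega>, \<omega>') \<partial>M) \<partial>M)"
proof -
  note ev = indep_setD_ev1[OF ind] indep_setD_ev2[OF ind]
  have idN: "(\<lambda>\<omega>. \<omega>) \<in> measurable N2 N2" by simp
  have XM[measurable]: "X \<in> measurable M S" by (rule subalgebra_measurable[OF ev(1) sp(1) X])
  have idM[measurable]: "(\<lambda>\<omega>. \<omega>) \<in> measurable M N2" by (rule subalgebra_measurable[OF ev(2) sp(2) idN])
  note F[measurable]
  let ?D1 = "distr M S X" and ?D2 = "distr M N2 (\<lambda>\<omega>. \<omega>)"
  interpret D1: prob_space ?D1 by (rule prob_space_distr) measurable
  interpret D2: prob_space ?D2 by (rule prob_space_distr) measurable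
  interpret P: pair_prob_space ?D1 ?D2 ..
  have eq: "?D1 \<Otimes>\<^sub>M ?D2 = distr M (S \<Otimes>\<^sub>M N2) (\<lambda>\<omega>. (X \<omega>, \<omega>))"
  proof (rule pair_measure_eqI)
    fix A B assume A: "A \<in> sets ?D1" and B: "B \<in> sets ?D2"
    then have [measurable]: "A \<in> sets S" "B \<in> sets N2" by simp_all
    have XA: "X -` A \<inter> space M \<in> sets N1" using measurable_sets[OF X] sp by simp
    have BM: "B \<subseteq> space M" using sets.sets_into_space[of B N2] sp by simp
    have "emeasure ?D1 A * emeasure ?D2 B = ennreal (prob (X -` A \<inter> space M) * prob B)"
      using BM by (simp add: emeasure_distr emeasure_eq_measure ennreal_mult Int_absorb2)
    also have "prob (X -` A \<inter> space M) * prob B = prob ((X -` A \<inter> space M) \<inter> B)"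
      using indep_setD[OF ind XA, of B] by simp
    also have "(X -` A \<inter> space M) \<inter> B = (\<lambda>\<omega>. (X \<omega>, \<omega>)) -` (A \<times> B) \<inter> space M"
      using BM by auto
    also have "ennreal (prob \<dots>) = emeasure (distr M (S \<Otimes>\<^sub>M N2) (\<lambda>\<omega>. (X \<omega>, \<omega>))) (A \<times> B)"
      by (subst emeasure_distr) (auto simp: emeasure_eq_measure)
    finally show "emeasure ?D1 A * emeasure ?D2 B = emeasure (distr M (S \<Otimes>\<^sub>M N2) (\<lambda>\<omega>. (X \<omega>, \<omega>))) (A \<times> B)" .
  qed (auto simp: D1.sigma_finite_measure_axioms D2.sigma_finite_measure_axioms)
  have F': "F \<in> borel_measurable (?D1 \<Otimes>\<^sub>M ?D2)" by simp
  have int: "integrable (?D1 \<Otimes>\<^sub>M ?D2) F"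
    by (rule P.integrable_const_bound[where B = B, OF _ F']) (use B in auto)
  have "(\<integral>\<omega>. F (X \<omega>, \<omega>) \<partial>M) = integral\<^sup>L (?D1 \<Otimes>\<^sub>M ?D2) F"
    unfolding eq by (subst integral_distr) auto
  also have "\<dots> = (\<integral>z. (\<integral>\<omega>'. F (z, \<omega>') \<partial>?D2) \<partial>?D1)"
    by (rule P.integral_fst'[OF int, symmetric])
  also have "\<dots> = (\<integral>\<omega>. (\<integral>\<omega>'. F (X \<omega>, \<omega>') \<partial>?D2) \<partial>M)"
    by (rule integral_distr) measurable
  also have "\<dots> = (\<integral>\<omega>. (\<integral>\<omega>'. F (X \<omega>, \<omega>') \<partial>M) \<partial>M)"
  proof (rule Bochner_Integration.integral_cong[OF refl])
    fix \<omega> assume "\<omega> \<in> space M"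
    then have "X \<omega> \<in> space S" using XM by (rule measurable_space[rotated])
    then have "(\<lambda>\<omega>'. F (X \<omega>, \<omega>')) \<in> borel_measurable N2"
      using F by (rule measurable_Pair2[rotated])
    then show "(\<integral>\<omega>'. F (X \<omega>, \<omega>') \<partial>?D2) = (\<integral>\<omega>'. F (X \<omega>, \<omega>') \<partial>M)"
      by (rule integral_distr[OF idM])
  qed
  finally show ?thesis .
qed

end

locale ar_model = phase_type V W Q \<alpha> \<mu> + prob_space M
  for V W :: "complex ^ 'm ^ 'm" and Q \<alpha> \<mu> and M :: "'w measure" +
  fixes J :: "nat \<Rightarrow> real \<Rightarrow> 'w \<Rightarrow> 'm option" and T :: "nat \<Rightarrow> 'w \<Rightarrow> real" and lam b x :: real
  assumes lam01: "0 < lam" "lam < 1"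
    and chains: "\<And>n. 1 \<le> n \<Longrightarrow> markov_chain M (hat_generator Q) (hat_initial \<alpha>) (J n)"
    and T_meas: "\<And>n. 1 \<le> n \<Longrightarrow> T n \<in> borel_measurable M"
    and T_nonneg: "\<And>n. 1 \<le> n \<Longrightarrow> AE \<omega> in M. 0 \<le> T n \<omega>"
    and T_ident: "\<And>n. 1 \<le> n \<Longrightarrow> distr M borel (T n) = distr M borel (T 1)"
    and indep: "chains_indep M J T"
    and log_moment: "integrable M (\<lambda>\<omega>. ln (1 + \<bar>innovation J T 1 \<omega>\<bar>))"
    and b_nonneg: "0 \<le> b" and x_less: "x < b"
begin

lemma phase_chain: "1 \<le> n \<Longrightarrow> phase_chain V W Q \<alpha> \<mu> M (J n)"
  by unfold_locales (rule chains)

sublocale ar_paths M J T lam b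
  by unfold_locales
     (auto intro: phase_chain.Z_meas[OF phase_chain] phase_chain.Z_rc[OF phase_chain] T_meas)

abbreviation jump :: "nat \<Rightarrow> 'w \<Rightarrow> real" where
  "jump n \<equiv> absorption_time (J (Suc n))"

lemma AE_paths:
  "AE \<omega> in M. \<forall>n. 0 \<le> T (Suc n) \<omega> \<and> 0 < jump n \<omega> \<and>
     (\<forall>t\<ge>0. J (Suc n) t \<omega> = None \<longleftrightarrow> jump n \<omega> \<le> t)"
  unfolding AE_all_countable
  using T_nonneg phase_chain.AE_absorption_time[OF phase_chain]
  by (auto simp: AE_conj_iff)

lemma distr_absorption: "distr M borel (jump n) = phase_law"
  by (rule phase_chain.distr_absorption_time[OF phase_chain]) simp

text \<open>
  \<open>|T|\<close> is at most \<open>|S - T| + S\<close>, and \<open>S\<close> has an exponential moment.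
\<close>

lemma ln_T_integrable: "integrable M (\<lambda>\<omega>. ln (1 + \<bar>T 1 \<omega>\<bar>))"
proof -
  let ?S = "absorption_time (J (Suc 0))"
  obtain e where e: "0 < e" "(\<integral>\<^sup>+ s. ennreal (exp (e * s)) \<partial>phase_law) < \<infinity>"
    using phase_law_exponential_moment by blast
  have "(\<integral>\<^sup>+ \<omega>. ennreal (exp (e * ?S \<omega>)) \<partial>M) = (\<integral>\<^sup>+ s. ennreal (exp (e * s)) \<partial>phase_law)"
    unfolding distr_absorption[of 0, symmetric] by (subst nn_integral_distr) auto
  then have expS: "integrable M (\<lambda>\<omega>. exp (e * ?S \<omega>))"
    using e(2) by (intro integrableI_bounded) auto
  show ?thesis
  proof (rule Bochner_Integration.integrable_bound)
    show "integrable M (\<lambda>\<omega>. ln (1 + \<bar>innovation J T 1 \<omega>\<bar>) + exp (e * ?S \<omega>) / e)"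
      using log_moment expS by (intro Bochner_Integration.integrable_add) auto
    show "(\<lambda>\<omega>. ln (1 + \<bar>T 1 \<omega>\<bar>)) \<in> borel_measurable M" using T_meas[of 1] by simp
    show "AE \<omega> in M. norm (ln (1 + \<bar>T 1 \<omega>\<bar>)) \<le> norm (ln (1 + \<bar>innovation J T 1 \<omega>\<bar>) + exp (e * ?S \<omega>) / e)"
    proof (rule AE_I2)
      fix \<omega>
      let ?z = "\<bar>innovation J T 1 \<omega>\<bar>" and ?s = "?S \<omega>"
      have s: "0 \<le> ?s" by (rule absorption_time_nonneg)
      have "\<bar>T 1 \<omega>\<bar> \<le> ?z + ?s" using s by (simp add: innovation_def)
      also have "1 + (?z + ?s) \<le> (1 + ?z) * (1 + ?s)" using s by (simp add: algebra_simps)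
      finally have "ln (1 + \<bar>T 1 \<omega>\<bar>) \<le> ln ((1 + ?z) * (1 + ?s))" by (subst ln_le_cancel_iff) (use s in \<open>auto intro!: mult_pos_pos\<close>)
      also have "\<dots> = ln (1 + ?z) + ln (1 + ?s)" using s by (intro ln_mult_pos) auto
      also have "ln (1 + ?s) \<le> ?s" using s by (rule ln_add_one_self_le_self)
      also have "?s \<le> exp (e * ?s) / e"
      proof -
        have "e * ?s \<le> exp (e * ?s)" using exp_ge_add_one_self[of "e * ?s"] by linarith
        then show ?thesis using e by (simp add: field_simps)
      qed
      finally have "ln (1 + \<bar>T 1 \<omega>\<bar>) \<le> ln (1 + ?z) + exp (e * ?s) / e" by simp
      moreover have "0 \<le> ln (1 + \<bar>T 1 \<omega>\<bar>)" by simp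
      ultimately show "norm (ln (1 + \<bar>T 1 \<omega>\<bar>)) \<le> norm (ln (1 + ?z) + exp (e * ?s) / e)" by simp
    qed
  qed
qed

sublocale ar_data V W Q \<alpha> \<mu> M T lam
  by unfold_locales (use lam01 T_meas[of 1] T_nonneg[of 1] ln_T_integrable in auto)

text \<open>
  The generating events of the \<open>\<sigma>\<close>-algebras that are assumed independent.
\<close>

definition generators :: "nat + nat \<Rightarrow> 'w set set" where
  "generators k = (case k of
     Inl n \<Rightarrow> {(\<lambda>\<omega>. restrict (\<lambda>t. J n t \<omega>) {0..}) -` B \<inter> space M |B. B \<in> sets (Pi\<^sub>M {0..} (\<lambda>_. count_space UNIV))}
   | Inr n \<Rightarrow> {T n -` B \<inter> space M |B. B \<in> sets borel})"

definition sig :: "(nat + nat) set \<Rightarrow> 'w measure" where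
  "sig K = sigma (space M) (\<Union>k\<in>K. generators k)"

lemma generators_subset: "(\<Union>k\<in>K. generators k) \<subseteq> Pow (space M)"
  by (auto simp: generators_def split: sum.splits)

lemma space_sig[simp]: "space (sig K) = space M"
  unfolding sig_def by (rule space_measure_of[OF generators_subset])

lemma sets_sig: "sets (sig K) = sigma_sets (space M) (\<Union>k\<in>K. generators k)"
  unfolding sig_def by (rule sets_measure_of[OF generators_subset])

lemma Int_stable_generators: "Int_stable (generators k)"
proof (cases k)
  case (Inl n)
  show ?thesis unfolding Int_stable_def Inl generators_def sum.case
    by (clarsimp, metis (no_types, lifting) Int_assoc Int_commute Int_left_absorb sets.Int vimage_Int)
next
  case (Inr n)
  show ?thesis unfolding Int_stable_def Inr generators_def sum.case
    by (clarsimp, metis (no_types, lifting) Int_assoc Int_commute Int_left_absorb sets.Int vimage_Int)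
qed

lemma indep_sig:
  assumes "K \<subseteq> Inl ` {1..} \<union> Inr ` {1..}" "L \<subseteq> Inl ` {1..} \<union> Inr ` {1..}" "K \<inter> L = {}"
  shows "indep_set (sets (sig K)) (sets (sig L))"
proof -
  have "indep_sets generators (Inl ` {1..} \<union> Inr ` {1..})"
    using indep unfolding chains_indep_def generators_def[abs_def] .
  then have "indep_sets generators (\<Union>j\<in>UNIV. case_bool K L j)"
    by (rule indep_sets_mono_index[rotated]) (use assms in \<open>auto split: bool.splits\<close>)
  then have "indep_sets (\<lambda>j. sigma_sets (space M) (\<Union>i\<in>case_bool K L j. generators i)) UNIV"
    by (rule indep_sets_collect_sigma)
       (use assms(3) in \<open>auto simp: Int_stable_generators disjoint_family_on_def split: bool.splits\<close>)
  moreover have "(\<lambda>j. sigma_sets (space M) (\<Union>i\<in>case_bool K L j. generators i)) = case_bool (sets (sig K)) (sets (sig L))"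
    by (auto simp: fun_eq_iff sets_sig split: bool.split)
  ultimately show ?thesis by (simp add: indep_set_def)
qed

lemma J_sig: "Inl n \<in> K \<Longrightarrow> 0 \<le> t \<Longrightarrow> J n t \<in> measurable (sig K) (count_space UNIV)"
proof -
  assume n: "Inl n \<in> K" and t: "0 \<le> t"
  let ?g = "\<lambda>\<omega>. restrict (\<lambda>t. J n t \<omega>) {0..}"
  have "?g \<in> measurable (sig K) (Pi\<^sub>M {0..} (\<lambda>_. count_space UNIV))"
  proof (rule measurableI)
    fix A :: "(real \<Rightarrow> 'm option) set" assume "A \<in> sets (Pi\<^sub>M {0..} (\<lambda>_. count_space UNIV))"
    then have "?g -` A \<inter> space M \<in> generators (Inl n)" by (auto simp: generators_def)
    with n show "?g -` A \<inter> space (sig K) \<in> sets (sig K)" unfolding sets_sig space_sig by (intro sigma_sets.Basic) auto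
  qed (auto simp: space_PiM)
  then have "(\<lambda>\<omega>. ?g \<omega> t) \<in> measurable (sig K) (count_space UNIV)"
    by (rule measurable_compose[OF _ measurable_component_singleton]) (use t in auto)
  then show ?thesis using t by simp
qed

lemma T_sig: "Inr n \<in> K \<Longrightarrow> T n \<in> borel_measurable (sig K)"
proof (rule measurableI)
  fix A :: "real set" assume n: "Inr n \<in> K" and "A \<in> sets borel"
  then have "T n -` A \<inter> space M \<in> generators (Inr n)" by (auto simp: generators_def)
  with n show "T n -` A \<inter> space (sig K) \<in> sets (sig K)" unfolding sets_sig space_sig by (intro sigma_sets.Basic) auto
qed auto

lemma S_sig: "Inl (Suc n) \<in> K \<Longrightarrow> jump n \<in> borel_measurable (sig K)"
  by (rule measurable_absorption_time) (auto intro: J_sig J_rc)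

definition past :: "nat \<Rightarrow> (nat + nat) set" where "past n = Inl ` {1..n} \<union> Inr ` {1..n}"

abbreviation X where "X n \<omega> \<equiv> ar_process lam J T x n \<omega>"

lemma X_sig: "past n \<subseteq> K \<Longrightarrow> X n \<in> borel_measurable (sig K)"
proof (induction n)
  case (Suc n)
  have "past n \<subseteq> past (Suc n)" by (auto simp: past_def)
  then have [measurable]: "X n \<in> borel_measurable (sig K)" using Suc by auto
  have "Inl (Suc n) \<in> K" "Inr (Suc n) \<in> K" using Suc.prems by (auto simp: past_def)
  note [measurable] = S_sig[OF this(1)] T_sig[OF this(2)]
  show ?case unfolding ar_process.simps(2)[abs_def] innovation_def by measurable
qed (simp add: ar_process.simps(1)[abs_def])

definition below :: "nat \<Rightarrow> 'w \<Rightarrow> bool" where "below n \<omega> \<longleftrightarrow> (\<forall>k\<le>n. X k \<omega> < b)"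

text \<open>
  The time that the jump number \<open>Suc n\<close> must outlast to carry the process over \<open>b\<close>. The value \<open>- 1\<close>
  marks the paths that have crossed before; on the others the clock is almost surely positive.
\<close>

definition clock :: "nat \<Rightarrow> 'w \<Rightarrow> real" where
  "clock n \<omega> = (if below n \<omega> then b - lam * X n \<omega> + T (Suc n) \<omega> else - 1)"

lemma below_sig: "past n \<subseteq> K \<Longrightarrow> Measurable.pred (sig K) (below n)"
proof -
  assume "past n \<subseteq> K"
  then have "X k \<in> borel_measurable (sig K)" if "k \<le> n" for k
    using that by (intro X_sig) (auto simp: past_def)
  then show ?thesis unfolding below_def[abs_def] by measurable
qed

lemma below_measurable[measurable]: "Measurable.pred M (below n)"
  unfolding below_def[abs_def] by measurable

lemma clock_measurable[measurable]: "clock n \<in> borel_measurable M"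
  unfolding clock_def[abs_def] by measurable

abbreviation past' where "past' n \<equiv> insert (Inr (Suc n)) (past n)"

lemma clock_sig: "clock n \<in> borel_measurable (sig (past' n))"
proof -
  have [measurable]: "Measurable.pred (sig (past' n)) (below n)" by (rule below_sig) auto
  have [measurable]: "X n \<in> borel_measurable (sig (past' n))" by (rule X_sig) auto
  have [measurable]: "T (Suc n) \<in> borel_measurable (sig (past' n))" by (rule T_sig) auto
  show ?thesis unfolding clock_def[abs_def] by measurable
qed

lemma indep_past': "indep_set (sets (sig (past' n))) (sets (sig {Inl (Suc n)}))"
  by (rule indep_sig) (auto simp: past_def)

lemma indep_past: "indep_set (sets (sig (past n))) (sets (sig {Inr (Suc n)}))"
  by (rule indep_sig) (auto simp: past_def)

lemma AE_clock_pos: "AE \<omega> in M. below n \<omega> \<longrightarrow> 0 < clock n \<omega>"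
  using AE_paths
proof eventually_elim
  case (elim \<omega>)
  show ?case
  proof
    assume bl: "below n \<omega>"
    then have "X n \<omega> < b" by (simp add: below_def)
    then have "lam * X n \<omega> < b"
      using lam01 b_nonneg mult_strict_left_mono[of "X n \<omega>" b lam] mult_left_le_one_le[of b lam] by linarith
    then show "0 < clock n \<omega>" using elim bl by (simp add: clock_def add_pos_nonneg)
  qed
qed

lemma clock_pos_below: "0 < clock n \<omega> \<Longrightarrow> below n \<omega>"
  by (auto simp: clock_def split: if_splits)

abbreviation clock_occ :: "nat \<Rightarrow> 'm \<Rightarrow> 'w \<Rightarrow> real" where
  "clock_occ n i \<omega> \<equiv> if 0 < clock n \<omega> then occ (clock n \<omega>) i else 0"

abbreviation alive_exp :: "complex \<Rightarrow> nat \<Rightarrow> 'w \<Rightarrow> complex" where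
  "alive_exp v n \<omega> \<equiv> if below n \<omega> then exp (v * of_real (X n \<omega>)) else 0"

text \<open>
  The probability of crossing during the jump number \<open>Suc n\<close>, in the state \<open>i\<close>; the maximum with \<open>0\<close>
  only serves to have a time at which the chain is defined on all paths.
\<close>

definition exit_prob :: "nat \<Rightarrow> 'm \<Rightarrow> real" where
  "exit_prob n i = prob {\<omega>\<in>space M. 0 < clock n \<omega> \<and> J (Suc n) (max 0 (clock n \<omega>)) \<omega> = Some i}"

text \<open>
  The exponential moment of \<open>X n\<close> on the event that the barrier has not been reached. As \<open>X n\<close> is then
  below \<open>b\<close>, it exists for all \<open>v\<close> in the right half plane.
\<close>

definition killed_transform :: "nat \<Rightarrow> complex \<Rightarrow> complex" where
  "killed_transform n v = (\<integral>\<omega>. (alive_exp v n \<omega>) \<partial>M)"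

lemma exit_event: "{\<omega>\<in>space M. 0 < clock n \<omega> \<and> J (Suc n) (max 0 (clock n \<omega>)) \<omega> = Some i} \<in> events"
proof -
  have "{\<omega>\<in>space M. J (Suc n) (max 0 (clock n \<omega>)) \<omega> = Some i} \<in> events"
    by (rule measurable_random_time[OF J_meas J_rc]) auto
  then show ?thesis by measurable
qed

text \<open>
  Given the past, the clock is a constant \<open>c\<close>, and the chain is in state \<open>i\<close> at time \<open>c\<close> with probability
  \<open>occ c i\<close>.
\<close>

lemma exit_prob_eq: "exit_prob n i = (\<integral>\<omega>. (clock_occ n i \<omega>) \<partial>M)"
proof -
  define F :: "real \<times> 'w \<Rightarrow> real" where
    "F p = (if 0 < fst p \<and> J (Suc n) (max 0 (fst p)) (snd p) = Some i then 1 else 0)" for p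
  let ?L = "sig {Inl (Suc n)}"
  have "{p\<in>space (borel \<Otimes>\<^sub>M ?L). J (Suc n) (max 0 (fst p)) (snd p) = Some i} \<in> sets (borel \<Otimes>\<^sub>M ?L)"
  proof (rule measurable_random_time[where Z = "\<lambda>t p. J (Suc n) t (snd p)" and U = "\<lambda>p. max 0 (fst p)"])
    show "(\<lambda>p. J (Suc n) t (snd p)) \<in> measurable (borel \<Otimes>\<^sub>M ?L) (count_space UNIV)" if "0 \<le> t" for t
      by (rule measurable_compose[OF measurable_snd J_sig]) (use that in auto)
    show "right_constant (\<lambda>t. J (Suc n) t (snd p))" if "p \<in> space (borel \<Otimes>\<^sub>M ?L)" for p :: "real \<times> 'w"
      using that by (intro J_rc) (auto simp: space_pair_measure)
  qed auto
  then have F: "F \<in> borel_measurable (borel \<Otimes>\<^sub>M ?L)"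
    unfolding F_def[abs_def] by measurable
  have "exit_prob n i = (\<integral>\<omega>. F (clock n \<omega>, \<omega>) \<partial>M)"
  proof -
    have "exit_prob n i = (\<integral>\<omega>. indicator {\<omega>\<in>space M. 0 < clock n \<omega> \<and> J (Suc n) (max 0 (clock n \<omega>)) \<omega> = Some i} \<omega> \<partial>M)"
      using exit_event by (simp add: exit_prob_def)
    also have "\<dots> = (\<integral>\<omega>. F (clock n \<omega>, \<omega>) \<partial>M)"
      by (intro Bochner_Integration.integral_cong) (auto simp: F_def)
    finally show ?thesis .
  qed
  also have "\<dots> = (\<integral>\<omega>. (\<integral>\<omega>'. F (clock n \<omega>, \<omega>') \<partial>M) \<partial>M)"
    by (rule integral_indep[OF indep_past' _ _ clock_sig F, where B = 1]) (auto simp: F_def)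
  also have "\<dots> = (\<integral>\<omega>. (clock_occ n i \<omega>) \<partial>M)"
  proof (intro Bochner_Integration.integral_cong refl)
    fix \<omega>
    show "(\<integral>\<omega>'. F (clock n \<omega>, \<omega>') \<partial>M) = (clock_occ n i \<omega>)"
    proof (cases "0 < clock n \<omega>")
      case True
      then have "(\<integral>\<omega>'. F (clock n \<omega>, \<omega>') \<partial>M) = (\<integral>\<omega>'. indicator {\<omega>'\<in>space M. J (Suc n) (clock n \<omega>) \<omega>' = Some i} \<omega>' \<partial>M)"
        by (intro Bochner_Integration.integral_cong) (auto simp: F_def)
      also have "\<dots> = occ (clock n \<omega>) i"
        using True phase_chain.prob_Z[OF phase_chain, of "Suc n" "clock n \<omega>" i]
          phase_chain.Z_event[OF phase_chain, of "Suc n" "clock n \<omega>" "Some i"] by simp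
      finally show ?thesis using True by simp
    qed (simp add: F_def)
  qed
  finally show ?thesis .
qed

text \<open>
  The absorption time is independent of the clock and its law has no atoms.
\<close>

lemma AE_no_tie: "AE \<omega> in M. jump n \<omega> \<noteq> clock n \<omega>"
proof -
  let ?S = "jump n" and ?L = "sig {Inl (Suc n)}"
  define F :: "real \<times> 'w \<Rightarrow> real" where "F p = (if ?S (snd p) = fst p then 1 else 0)" for p
  have [measurable]: "?S \<in> borel_measurable ?L" by (rule S_sig) simp
  have F: "F \<in> borel_measurable (borel \<Otimes>\<^sub>M ?L)" unfolding F_def[abs_def] by measurable
  have 0: "(\<integral>\<omega>'. F (c, \<omega>') \<partial>M) = 0" for c
  proof -
    have "AE s in distr M borel ?S. s \<noteq> c" unfolding distr_absorption by (rule AE_phase_law_neq)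
    then have "AE \<omega>' in M. ?S \<omega>' \<noteq> c" by (simp add: AE_distr_iff)
    then show ?thesis by (intro integral_eq_zero_AE) (auto simp: F_def elim!: eventually_mono)
  qed
  have "(\<integral>\<omega>. F (clock n \<omega>, \<omega>) \<partial>M) = 0"
    by (subst integral_indep[OF indep_past' _ _ clock_sig F, where B = 1]) (auto simp: F_def[of "(_, _)"] 0[unfolded F_def fst_conv snd_conv])
  moreover have "(\<lambda>\<omega>. F (clock n \<omega>, \<omega>)) \<in> borel_measurable M" unfolding F_def by measurable
  then have "integrable M (\<lambda>\<omega>. F (clock n \<omega>, \<omega>))"
    by (intro integrable_const_bound[where B = 1]) (auto simp: F_def)
  ultimately have "AE \<omega> in M. F (clock n \<omega>, \<omega>) = 0"
    by (subst (asm) integral_nonneg_eq_0_iff_AE) (auto simp: F_def)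
  then show ?thesis by eventually_elim (auto simp: F_def split: if_splits)
qed

lemma X_Suc_clock: "below n \<omega> \<Longrightarrow> X (Suc n) \<omega> = b - clock n \<omega> + jump n \<omega>"
  by (simp add: clock_def innovation_def)

lemma below_Suc: "below (Suc n) \<omega> \<longleftrightarrow> below n \<omega> \<and> X (Suc n) \<omega> < b"
  by (auto simp: below_def le_Suc_eq)

lemma exp_bound_b:
  assumes "0 \<le> Re v" "y < b" shows "norm (exp (v * of_real y)) \<le> exp (Re v * b)"
  using assms by (simp add: mult_left_mono)

abbreviation clock_exp :: "complex \<Rightarrow> nat \<Rightarrow> 'w \<Rightarrow> complex" where
  "clock_exp v n \<omega> \<equiv> if 0 < clock n \<omega> then exp (v * of_real (b - clock n \<omega>)) else 0"

lemma integrable_clock_exp: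
  assumes "0 \<le> Re v"
  shows "integrable M (\<lambda>\<omega>. clock_exp v n \<omega>)"
proof (rule integrable_const_bound[where B = "exp (Re v * b)"])
  show "AE \<omega> in M. norm (clock_exp v n \<omega>) \<le> exp (Re v * b)"
    using exp_bound_b[OF assms, of "b - clock n \<omega>" for \<omega>] by (intro AE_I2) (simp del: norm_exp_eq_Re)
qed measurable

lemma integrable_clock_occ: "integrable M (\<lambda>\<omega>. clock_occ n i \<omega>)"
  by (rule integrable_const_bound[where B = 1]) (auto intro!: AE_I2 simp: occ_le_1 occ_nonneg abs_of_nonneg)

text \<open>
  Given the past, the process survives the next jump if and only if the jump ends before the clock
  \<open>c\<close>, so the exponential moment of the jump is taken over \<open>[0, c]\<close>. Its boundary term carries the
  state vector at time \<open>c\<close>, and this is the law of the state at the crossing.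
\<close>

lemma killed_transform_Suc:
  assumes v: "0 \<le> Re v" "v \<notin> range \<mu>"
  shows "killed_transform (Suc n) v = psi1 v * (\<integral>\<omega>. (clock_exp v n \<omega>) \<partial>M)
     - exp (v * of_real b) * (\<Sum>i\<in>UNIV. exp_psi_unit Q i v * of_real (exit_prob n i))"
proof -
  let ?S = "jump n" and ?L = "sig {Inl (Suc n)}"
  define F :: "real \<times> 'w \<Rightarrow> complex" where
    "F p = (if 0 < fst p \<and> ?S (snd p) < fst p then exp (v * of_real (b - fst p + ?S (snd p))) else 0)" for p
  have [measurable]: "?S \<in> borel_measurable ?L" by (rule S_sig) simp
  have F: "F \<in> borel_measurable (borel \<Otimes>\<^sub>M ?L)" unfolding F_def[abs_def] by measurable
  have "killed_transform (Suc n) v = (\<integral>\<omega>. F (clock n \<omega>, \<omega>) \<partial>M)"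
    unfolding killed_transform_def
  proof (rule integral_cong_AE)
    show "AE \<omega> in M. (if below (Suc n) \<omega> then exp (v * of_real (X (Suc n) \<omega>)) else 0) = F (clock n \<omega>, \<omega>)"
      using AE_clock_pos[of n]
    proof eventually_elim
      case (elim \<omega>)
      show ?case
      proof (cases "below n \<omega>")
        case True
        then show ?thesis using elim by (simp add: F_def below_Suc X_Suc_clock del: ar_process.simps)
      next
        case False
        then show ?thesis using clock_pos_below[of n \<omega>] by (auto simp: F_def below_Suc)
      qed
    qed
    show "(\<lambda>\<omega>. F (clock n \<omega>, \<omega>)) \<in> borel_measurable M" unfolding F_def fst_conv snd_conv by measurable
  qed measurable
  also have "\<dots> = (\<integral>\<omega>. (\<integral>\<omega>'. F (clock n \<omega>, \<omega>') \<partial>M) \<partial>M)"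
    by (rule integral_indep[OF indep_past' _ _ clock_sig F, where B = "exp (Re v * b)"])
       (use v exp_bound_b[OF v(1)] in \<open>auto simp: F_def simp del: norm_exp_eq_Re of_real_add of_real_diff\<close>)
  also have "\<dots> = (\<integral>\<omega>. psi1 v * (clock_exp v n \<omega>)
      - exp (v * of_real b) * (\<Sum>i\<in>UNIV. exp_psi_unit Q i v * of_real (clock_occ n i \<omega>)) \<partial>M)"
  proof (intro Bochner_Integration.integral_cong refl)
    fix \<omega>
    let ?c = "clock n \<omega>"
    show "(\<integral>\<omega>'. F (?c, \<omega>') \<partial>M) = psi1 v * (if 0 < ?c then exp (v * of_real (b - ?c)) else 0)
      - exp (v * of_real b) * (\<Sum>i\<in>UNIV. exp_psi_unit Q i v * of_real (if 0 < ?c then occ ?c i else 0))"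
    proof (cases "0 < ?c")
      case True
      have "(\<integral>\<omega>'. F (?c, \<omega>') \<partial>M) = (\<integral>\<omega>'. exp (v * of_real (b - ?c)) * (indicator {..<?c} (?S \<omega>') * exp (v * of_real (?S \<omega>'))) \<partial>M)"
        using True by (intro Bochner_Integration.integral_cong) (auto simp: F_def exp_add[symmetric] algebra_simps)
      also have "\<dots> = exp (v * of_real (b - ?c)) * (\<integral>s. indicator {..<?c} s * exp (v * of_real s) \<partial>distr M borel ?S)"
        by (subst integral_distr) auto
      also have "\<dots> = exp (v * of_real (b - ?c)) * (psi1 v - exp (v * of_real ?c) * (\<Sum>i\<in>UNIV. of_real (occ ?c i) * exp_psi_unit Q i v))"
        unfolding distr_absorption integral_phase_law_exp[OF True v(2)] ..
      also have "\<dots> = psi1 v * exp (v * of_real (b - ?c)) - (exp (v * of_real (b - ?c)) * exp (v * of_real ?c)) * (\<Sum>i\<in>UNIV. exp_psi_unit Q i v * of_real (occ ?c i))"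
        by (simp add: algebra_simps)
      also have "exp (v * of_real (b - ?c)) * exp (v * of_real ?c) = exp (v * of_real b)"
        by (simp add: exp_add[symmetric] algebra_simps)
      finally show ?thesis using True by simp
    qed (simp add: F_def)
  qed
  also have "\<dots> = psi1 v * (\<integral>\<omega>. (clock_exp v n \<omega>) \<partial>M)
     - exp (v * of_real b) * (\<Sum>i\<in>UNIV. exp_psi_unit Q i v * of_real (exit_prob n i))"
    unfolding exit_prob_eq
    using integrable_clock_exp[OF v(1), of n] integrable_clock_occ[of n]
    by (subst Bochner_Integration.integral_diff)
       (auto intro!: Bochner_Integration.integrable_sum simp: Bochner_Integration.integral_sum simp del: of_real_diff)
  finally show ?thesis .
qed

lemma clock_transform:
  assumes v: "0 \<le> Re v"
  shows "(\<integral>\<omega>. (clock_exp v n \<omega>) \<partial>M) = killed_transform n (of_real lam * v) * psi2 v"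
proof -
  let ?f = "\<lambda>\<omega>. if below n \<omega> then exp (of_real lam * v * of_real (X n \<omega>)) else 0"
  let ?g = "\<lambda>\<omega>. exp (- v * complex_of_real (T (Suc n) \<omega>))"
  have "(\<integral>\<omega>. (clock_exp v n \<omega>) \<partial>M) = (\<integral>\<omega>. ?f \<omega> * ?g \<omega> \<partial>M)"
  proof (rule integral_cong_AE)
    show "AE \<omega> in M. (clock_exp v n \<omega>) = ?f \<omega> * ?g \<omega>"
      using AE_clock_pos[of n]
    proof eventually_elim
      case (elim \<omega>)
      show ?case
      proof (cases "below n \<omega>")
        case True
        then have "complex_of_real (b - clock n \<omega>) = of_real lam * of_real (X n \<omega>) - of_real (T (Suc n) \<omega>)"
          by (simp add: clock_def)
        then have "exp (v * of_real (b - clock n \<omega>)) = exp (of_real lam * v * of_real (X n \<omega>)) * ?g \<omega>"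
          unfolding exp_add[symmetric] by (simp only:) (simp add: algebra_simps)
        with True elim show ?thesis by simp
      qed (auto dest: clock_pos_below)
    qed
  qed measurable
  also have "\<dots> = (\<integral>\<omega>. ?f \<omega> \<partial>M) * (\<integral>\<omega>. ?g \<omega> \<partial>M)"
  proof (rule indep_var_lebesgue_integral)
    show "indep_var borel ?f borel ?g"
    proof (rule indep_var_subalgebras[OF indep_past])
      have [measurable]: "Measurable.pred (sig (past n)) (below n)" "X n \<in> borel_measurable (sig (past n))"
        by (auto intro: below_sig X_sig)
      show "?f \<in> borel_measurable (sig (past n))" by measurable
      have [measurable]: "T (Suc n) \<in> borel_measurable (sig {Inr (Suc n)})" by (rule T_sig) simp
      show "?g \<in> borel_measurable (sig {Inr (Suc n)})" by measurable
    qed auto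
    show "integrable M ?f"
    proof (rule integrable_const_bound[where B = "exp (Re (of_real lam * v) * b)"])
      have "norm (?f \<omega>) \<le> exp (Re (of_real lam * v) * b)" for \<omega>
      proof (cases "below n \<omega>")
        case True
        then have "X n \<omega> < b" by (simp add: below_def)
        then show ?thesis using exp_bound_b[of "of_real lam * v" "X n \<omega>"] v lam01 True by (simp del: norm_exp_eq_Re)
      qed simp
      then show "AE \<omega> in M. norm (?f \<omega>) \<le> exp (Re (of_real lam * v) * b)" by (rule AE_I2)
    qed measurable
    show "integrable M ?g" by (rule laplace_norm_le(1)[OF prob_space_axioms T_meas T_nonneg v]) auto
  qed
  also have "(\<integral>\<omega>. ?g \<omega> \<partial>M) = psi2 v"
  proof -
    have "(\<integral>\<omega>. ?g \<omega> \<partial>M) = (\<integral>t. exp (- v * complex_of_real t) \<partial>distr M borel (T (Suc n)))"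
      by (subst integral_distr) auto
    also have "\<dots> = (\<integral>t. exp (- v * complex_of_real t) \<partial>distr M borel (T 1))"
      using T_ident[of "Suc n"] by simp
    also have "\<dots> = psi2 v"
      unfolding exp_psi2_def by (subst integral_distr) (use T_meas[of 1] in auto)
    finally show ?thesis .
  qed
  finally show ?thesis unfolding killed_transform_def .
qed

text \<open>
  The columns of \<open>V\<close> are eigenvectors, so pairing the state vector at the clock time with column \<open>k\<close>
  leaves a single exponential of the clock, which is linear in \<open>X n\<close>.
\<close>

lemma exit_prob_V:
  "(\<Sum>i\<in>UNIV. V $ i $ k * of_real (exit_prob n i)) =
     init_coord k * exp (- of_real b * \<mu> k) * psi2 (\<mu> k) * killed_transform n (of_real lam * \<mu> k)"
proof -
  have "(\<Sum>i\<in>UNIV. V $ i $ k * of_real (exit_prob n i)) =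
      (\<integral>\<omega>. (\<Sum>i\<in>UNIV. V $ i $ k * of_real (clock_occ n i \<omega>)) \<partial>M)"
    unfolding exit_prob_eq using integrable_clock_occ[of n] by (subst Bochner_Integration.integral_sum) auto
  also have "\<dots> = (\<integral>\<omega>. init_coord k * exp (- of_real b * \<mu> k) * (if 0 < clock n \<omega> then exp (\<mu> k * of_real (b - clock n \<omega>)) else 0) \<partial>M)"
  proof (intro Bochner_Integration.integral_cong refl)
    fix \<omega>
    have "(\<Sum>i\<in>UNIV. V $ i $ k * of_real (occ (clock n \<omega>) i)) = init_coord k * exp (- of_real b * \<mu> k) * exp (\<mu> k * of_real (b - clock n \<omega>))"
      using occ_V[of "clock n \<omega>" k] by (simp add: mult.commute[of "V $ _ $ k"] mult.assoc exp_add[symmetric]) (simp add: algebra_simps)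
    then show "(\<Sum>i\<in>UNIV. V $ i $ k * of_real (clock_occ n i \<omega>)) =
        init_coord k * exp (- of_real b * \<mu> k) * (if 0 < clock n \<omega> then exp (\<mu> k * of_real (b - clock n \<omega>)) else 0)"
      by simp
  qed
  also have "\<dots> = init_coord k * exp (- of_real b * \<mu> k) * (killed_transform n (of_real lam * \<mu> k) * psi2 (\<mu> k))"
    using clock_transform[of "\<mu> k" n] Re_eig_pos[of k] by simp
  finally show ?thesis by simp
qed

lemma killed_transform_0: "killed_transform 0 v = exp (v * of_real x)"
  using x_less by (simp add: killed_transform_def below_def prob_space)

lemma killed_transform_bound:
  assumes "0 \<le> Re v" shows "norm (killed_transform n v) \<le> exp (Re v * b)"
proof -
  have b1: "norm (alive_exp v n \<omega>) \<le> exp (Re v * b)" for \<omega>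
  proof (cases "below n \<omega>")
    case True
    then have "X n \<omega> < b" by (simp add: below_def)
    then show ?thesis using exp_bound_b[OF assms] True by (simp del: norm_exp_eq_Re)
  qed simp
  have "norm (killed_transform n v) \<le> (\<integral>\<omega>. norm (alive_exp v n \<omega>) \<partial>M)"
    unfolding killed_transform_def by (rule integral_norm_bound)
  also have "\<dots> \<le> (\<integral>\<omega>. exp (Re v * b) \<partial>M)"
    using b1 by (intro integral_mono_AE integrable_norm integrable_const_bound[where B = "exp (Re v * b)"] AE_I2) auto
  finally show ?thesis by (simp add: prob_space)
qed

text \<open>
  Almost surely the crossing events for different \<open>n\<close> exclude each other, and the event for \<open>n\<close>
  means that the barrier is reached at the time \<open>Suc n\<close>.
\<close>

lemma crossing_transform_sums:
  assumes \<rho>: "0 < \<rho>" "\<rho> < 1"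
  shows "(\<lambda>n. \<rho> ^ Suc n * exit_prob n i) sums crossing_transform M lam J T b \<rho> x i"
proof -
  let ?C = "crossing_event M lam J T b x i"
  define E where "E n = {\<omega>\<in>space M. 0 < clock n \<omega> \<and> J (Suc n) (max 0 (clock n \<omega>)) \<omega> = Some i}" for n
  define K where "K \<omega> = {k. b \<le> X k \<omega>}" for \<omega>
  have E[measurable]: "E n \<in> events" for n unfolding E_def by (rule exit_event)
  have C[measurable]: "?C \<in> events" by (rule crossing_event_sets)
  let ?f = "\<lambda>n \<omega>. \<rho> ^ Suc n * indicator (E n) \<omega> :: real"
  have int: "integrable M (?f n)" for n
    by (intro integrable_mult_right integrable_real_indicator E) (simp add: emeasure_eq_measure)
  have norm_le: "norm (?f n \<omega>) \<le> \<rho> ^ Suc n" for n \<omega> using \<rho> by (auto split: split_indicator)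
  have sm: "summable (\<lambda>n. \<rho> ^ Suc n)" using \<rho> by (simp add: summable_Suc_iff summable_geometric)
  have "(\<lambda>n. integral\<^sup>L M (?f n)) sums (\<integral>\<omega>. (\<Sum>n. ?f n \<omega>) \<partial>M)"
  proof (rule sums_integral[OF int])
    show "AE \<omega> in M. summable (\<lambda>n. norm (?f n \<omega>))"
      by (intro AE_I2 summable_comparison_test'[OF sm, of 0]) (use norm_le in simp)
    show "summable (\<lambda>n. \<integral>\<omega>. norm (?f n \<omega>) \<partial>M)"
    proof (rule summable_comparison_test'[OF sm, of 0])
      fix n
      have "(\<integral>\<omega>. norm (?f n \<omega>) \<partial>M) \<le> (\<integral>\<omega>. \<rho> ^ Suc n \<partial>M)"
        using norm_le int by (intro integral_mono_AE integrable_norm AE_I2) auto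
      then show "norm (\<integral>\<omega>. norm (?f n \<omega>) \<partial>M) \<le> \<rho> ^ Suc n" by (simp add: prob_space)
    qed
  qed
  moreover have "(\<integral>\<omega>. (\<Sum>n. ?f n \<omega>) \<partial>M) = crossing_transform M lam J T b \<rho> x i"
    unfolding crossing_transform_def Let_def K_def[symmetric]
  proof (rule integral_cong_AE)
    show "(\<lambda>\<omega>. (if K \<omega> = {} then 0 else \<rho> ^ Inf (K \<omega>)) * indicator ?C \<omega>) \<in> borel_measurable M"
    proof -
      have [measurable]: "(\<lambda>\<omega>. Inf (K \<omega>)) \<in> measurable M (count_space UNIV)"
        unfolding K_def Inf_nat_def by measurable
      have [measurable]: "Measurable.pred M (\<lambda>\<omega>. K \<omega> = {})" unfolding K_def Collect_empty_eq by measurable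
      show ?thesis by measurable
    qed
    have tie: "AE \<omega> in M. \<forall>n. jump n \<omega> \<noteq> clock n \<omega>"
      unfolding AE_all_countable using AE_no_tie by blast
    show "AE \<omega> in M. (\<Sum>n. ?f n \<omega>) = (if K \<omega> = {} then 0 else \<rho> ^ Inf (K \<omega>)) * indicator ?C \<omega>"
      using tie AE_paths AE_space
    proof eventually_elim
      case (elim \<omega>)
      note S = elim(2)[rule_format]
      have E_imp: "below n \<omega> \<and> b < X (Suc n) \<omega>" if "\<omega> \<in> E n" for n
      proof -
        have c: "0 < clock n \<omega>" "J (Suc n) (clock n \<omega>) \<omega> \<noteq> None" using that by (auto simp: E_def max_def)
        have bl: "below n \<omega>" by (rule clock_pos_below[OF c(1)])
        have "clock n \<omega> < jump n \<omega>" using S[of n] c by (meson less_imp_le not_le)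
        then show ?thesis using bl X_Suc_clock[OF bl] by simp
      qed
      show ?case
      proof (cases "K \<omega> = {}")
        case True
        then have "\<omega> \<notin> E n" for n
          using E_imp[of n] by (auto simp: K_def not_le simp del: ar_process.simps dest: less_asym)
        then show ?thesis using True by simp
      next
        case False
        define N where "N = Inf (K \<omega>)"
        have N: "b \<le> X N \<omega>" using Inf_nat_def1[OF False] by (simp add: N_def K_def)
        have N_le: "N \<le> k" if "b \<le> X k \<omega>" for k
          using that unfolding N_def by (intro cInf_lower) (auto simp: K_def)
        have "N \<noteq> 0" using N x_less by (cases N) auto
        then obtain m where m: "N = Suc m" using not0_implies_Suc by blast
        have bl: "below m \<omega>" unfolding below_def using N_le m by (metis leD leI le_imp_less_Suc not_less_eq_eq)
        have "X (Suc m) \<omega> \<noteq> b"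
        proof
          assume "X (Suc m) \<omega> = b"
          then have "jump m \<omega> = clock m \<omega>" using X_Suc_clock[OF bl] by linarith
          then show False using elim(1) by blast
        qed
        then have above: "b < X (Suc m) \<omega>" using N m by simp
        have cl: "clock m \<omega> = b - lam * X m \<omega> + T (Suc m) \<omega>" using bl by (simp add: clock_def)
        have "0 \<le> T (Suc m) \<omega>" using S[of m] by simp
        note D = crossing_deterministic[OF lam01 b_nonneg this bl[unfolded below_def] above, folded cl]
        have other: "\<omega> \<notin> E n" if "n \<noteq> m" for n
        proof
          assume "\<omega> \<in> E n"
          from E_imp[OF this] have "below n \<omega>" "b < X (Suc n) \<omega>" by auto
          then have "m \<le> n" using N_le[of "Suc n"] m by simp
          moreover have "n \<le> m"
          proof (rule ccontr)
            assume "\<not> n \<le> m"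
            then have "X (Suc m) \<omega> < b" using \<open>below n \<omega>\<close> unfolding below_def by (auto simp del: ar_process.simps)
            then show False using above by simp
          qed
          ultimately show False using that by simp
        qed
        have "\<omega> \<in> E m \<longleftrightarrow> \<omega> \<in> ?C"
          using D elim(3) by (simp add: E_def crossing_event_def Let_def)
        moreover have "(\<Sum>n. ?f n \<omega>) = (\<Sum>n\<in>{m}. ?f n \<omega>)"
          by (rule suminf_finite) (use other in auto)
        moreover have "\<dots> = ?f m \<omega>" by (subst sum.insert) auto
        ultimately have "(\<Sum>n. ?f n \<omega>) = \<rho> ^ Suc m * indicator ?C \<omega>" by (simp only: indicator_def)
        then show ?thesis using False m by (simp add: N_def[symmetric])
      qed
    qed
  qed measurable
  moreover have "integral\<^sup>L M (?f n) = \<rho> ^ Suc n * exit_prob n i" for n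
  proof -
    have "E n \<inter> space M = E n" by (auto simp: E_def)
    then show ?thesis by (simp add: exit_prob_def E_def[symmetric])
  qed
  ultimately show ?thesis by (simp only:)
qed

end


section \<open>The linear system for the crossing transforms\<close>

lemma rational_partial_fractions:
  fixes \<mu> :: "'m::finite \<Rightarrow> complex"
  assumes "D \<inter> range \<mu> = {}" "\<And>z. z \<in> D \<Longrightarrow> f z = (\<Sum>j\<in>UNIV. c j / (\<mu> j - z))"
  shows "rational_with_poles (range \<mu>) D f"
proof -
  define r where "r = (\<Prod>l\<in>UNIV. [:\<mu> l, -1:])"
  define p where "p = (\<Sum>j\<in>UNIV. smult (c j) (\<Prod>l\<in>-{j}. [:\<mu> l, -1:]))"
  have r: "poly r z = (\<Prod>l\<in>UNIV. (\<mu> l - z))" for z by (simp add: r_def poly_prod)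
  have "f z = poly p z / poly r z" if "z \<in> D" for z
  proof -
    have ne: "\<mu> l - z \<noteq> 0" for l using assms(1) that by auto
    have "c j / (\<mu> j - z) = c j * (\<Prod>l\<in>-{j}. (\<mu> l - z)) / poly r z" for j
    proof -
      have "poly r z = (\<mu> j - z) * (\<Prod>l\<in>-{j}. (\<mu> l - z))"
        unfolding r by (subst prod.remove[of _ j]) (auto simp: Compl_eq_Diff_UNIV)
      moreover have "(\<Prod>l\<in>-{j}. (\<mu> l - z)) \<noteq> 0" using ne by simp
      ultimately show ?thesis by simp
    qed
    then show ?thesis by (simp add: assms(2)[OF that] p_def poly_sum poly_prod sum_divide_distrib)
  qed
  moreover have "r \<noteq> 0" by (simp add: r_def)
  moreover have "{z. poly r z = 0} \<subseteq> range \<mu>" by (auto simp: r)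
  ultimately show ?thesis unfolding rational_with_poles_def by blast
qed

text \<open>
  Multiplication by \<open>\<mu> j - z\<close> followed by the limit \<open>z \<rightarrow> \<mu> j\<close> isolates the coefficient \<open>j\<close>. Points near
  \<open>\<mu> j\<close> are admissible because \<open>\<mu> j\<close> lies in the open right half plane.
\<close>

lemma partial_fractions_unique:
  fixes \<mu> :: "'m::finite \<Rightarrow> complex"
  assumes inj: "inj \<mu>" and pos: "\<And>k. 0 < Re (\<mu> k)"
    and eq: "\<And>z. 0 \<le> Re z \<Longrightarrow> z \<notin> range \<mu> \<Longrightarrow> (\<Sum>j\<in>UNIV. c j / (\<mu> j - z)) = (\<Sum>j\<in>UNIV. d j / (\<mu> j - z))"
  shows "c j = d j"
proof -
  define e where "e l = c l - d l" for l
  define g where "g z = e j + (\<mu> j - z) * (\<Sum>l\<in>-{j}. e l / (\<mu> l - z))" for z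
  have ne: "\<mu> l \<noteq> \<mu> j" if "l \<in> -{j}" for l using inj that by (auto simp: inj_def)
  have "isCont g (\<mu> j)" unfolding g_def by (intro continuous_intros) (use ne in auto)
  then have "(g \<longlongrightarrow> g (\<mu> j)) (at (\<mu> j))" by (simp add: isCont_def)
  then have lim: "(g \<longlongrightarrow> e j) (at (\<mu> j))" by (simp add: g_def)
  have "open ({z. 0 < Re z} \<inter> - \<mu> ` (-{j}))"
    by (intro open_Int open_halfspace_Re_gt) (simp add: finite_imp_closed open_Compl)
  then have "\<forall>\<^sub>F z in at (\<mu> j). z \<in> ({z. 0 < Re z} \<inter> - \<mu> ` (-{j})) - {\<mu> j}"
    by (rule eventually_at_in_open) (use pos ne in force)
  then have "\<forall>\<^sub>F z in at (\<mu> j). g z = 0"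
  proof eventually_elim
    case (elim z)
    have "z \<noteq> \<mu> l" for l using elim by (cases "l = j") auto
    then have z: "0 \<le> Re z" "z \<notin> range \<mu>" using elim by auto
    have zj: "\<mu> j - z \<noteq> 0" using elim by auto
    have "(\<Sum>l\<in>UNIV. e l / (\<mu> l - z)) = 0"
      using eq[OF z] by (simp add: e_def diff_divide_distrib sum_subtractf)
    moreover have "(\<Sum>l\<in>UNIV. e l / (\<mu> l - z)) = e j / (\<mu> j - z) + (\<Sum>l\<in>-{j}. e l / (\<mu> l - z))"
      by (subst sum.remove[of _ j]) (auto simp: Compl_eq_Diff_UNIV)
    ultimately have "(\<mu> j - z) * (e j / (\<mu> j - z) + (\<Sum>l\<in>-{j}. e l / (\<mu> l - z))) = 0" by simp
    then show ?case using zj by (simp add: g_def distrib_left)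
  qed
  then have "(g \<longlongrightarrow> 0) (at (\<mu> j))" by (rule tendsto_eventually)
  then have "e j = 0" using lim by (intro tendsto_unique[of "at (\<mu> j)" g]) auto
  then show ?thesis by (simp add: e_def)
qed

lemma summable_geometric_bounded:
  fixes f :: "nat \<Rightarrow> complex" and \<rho> :: real
  assumes "0 < \<rho>" "\<rho> < 1" "\<And>n. norm (f n) \<le> B"
  shows "summable (\<lambda>n. of_real (\<rho> ^ n) * f n)"
proof (rule summable_comparison_test')
  show "summable (\<lambda>n. \<rho> ^ n * B)" using assms by (intro summable_mult2 summable_geometric) auto
  show "norm (of_real (\<rho> ^ n) * f n) \<le> \<rho> ^ n * B" for n
    using assms by (simp add: norm_mult norm_power mult_left_mono)
qed

locale discounted_ar_model = ar_model V W Q \<alpha> \<mu> M J T lam b x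
  for V W :: "complex ^ 'm ^ 'm" and Q \<alpha> \<mu> and M :: "'w measure" and J T lam b x +
  fixes \<rho> :: real
  assumes \<rho>: "0 < \<rho>" "\<rho> < 1"
    and disjoint: "\<And>n k. 1 \<le> n \<Longrightarrow> of_real (lam ^ n) * \<mu> k \<notin> range \<mu>"
    and phi_nonzero: "\<And>n k. 1 \<le> n \<Longrightarrow> phi (of_real (lam ^ n) * \<mu> k) \<noteq> 0"
begin

text \<open>
  The eigenvalues of the matrices \<open>- lam\<^sup>n Q\<close> for \<open>n \<ge> 1\<close>, at which the functions in the series
  for \<open>\<eta>\<close> and \<open>h\<close> are evaluated.
\<close>

abbreviation node :: "'m \<Rightarrow> nat \<Rightarrow> complex" where
  "node k n \<equiv> of_real (lam ^ Suc n) * \<mu> k"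

lemma regular_eig: "regular (node k n)"
proof -
  have "of_real (lam ^ l) * (node k n) \<notin> range \<mu>" for l
    using disjoint[of "l + Suc n" k] by (simp add: power_add mult_ac)
  then show ?thesis
    using lam01 Re_eig_pos[of k] by (simp add: regular_def)
qed

text \<open>
  By the functional equation of \<open>phi\<close> this quotient is the product of \<open>psi1 psi2\<close> over the first \<open>n\<close>
  nodes, so in an iteration along the nodes it arises as an accumulated factor.
\<close>

definition phi_ratio :: "'m \<Rightarrow> nat \<Rightarrow> complex" where
  "phi_ratio k n = phi (of_real lam * \<mu> k) / phi (node k n)"

lemma phi_ratio_0: "phi_ratio k 0 = 1"
  using phi_nonzero[of 1 k] by (simp add: phi_ratio_def)

lemma phi_ratio_Suc: "phi_ratio k (Suc n) = phi_ratio k n * (psi1 (node k n) * psi2 (node k n))"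
proof -
  let ?z = "of_real (lam ^ Suc n) * \<mu> k"
  have z: "of_real lam * ?z = of_real (lam ^ Suc (Suc n)) * \<mu> k" by simp
  have "phi ?z = psi1 ?z * psi2 ?z * phi (of_real (lam ^ Suc (Suc n)) * \<mu> k)"
    using phi_functional_equation[OF regular_eig[of n k]] unfolding z .
  then have "psi1 ?z * psi2 ?z = phi ?z / phi (of_real (lam ^ Suc (Suc n)) * \<mu> k)"
    using phi_nonzero[of "Suc (Suc n)" k] by simp
  then show ?thesis
    using phi_nonzero[of "Suc n" k] unfolding phi_ratio_def by simp
qed

lemma phi_ratio_bounded: obtains B where "\<And>n. norm (phi_ratio k n) \<le> B"
proof -
  let ?z = "of_real lam * \<mu> k"
  have reg: "regular ?z" using regular_eig[of 0 k] by simp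
  have "phi_ratio k n = (\<Prod>l<n. factor l ?z)" for n
    by (induction n) (simp_all add: phi_ratio_0 phi_ratio_Suc factor_def mult_ac)
  then have "(\<lambda>n. phi_ratio k n) \<longlonglongrightarrow> phi ?z"
    using factor_product_tendsto[OF reg] by simp
  then have "Bseq (phi_ratio k)" by (rule convergent_imp_Bseq[OF convergentI])
  then show thesis using that by (auto simp: Bseq_def)
qed

lemma inverse_phi: "1 / phi (node k n) = phi_ratio k n / phi (of_real lam * \<mu> k)"
  using phi_nonzero[of 1 k] by (simp add: phi_ratio_def)

lemma norm_exp_eig_le: "norm (exp (of_real y * (node k n))) \<le> exp (\<bar>y\<bar> * norm (\<mu> k))"
proof -
  have "lam ^ Suc n \<le> 1" using lam01 by (intro power_le_one) auto
  have "Re (of_real y * (node k n)) \<le> norm (of_real y * (node k n))"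
    by (rule complex_Re_le_cmod)
  also have "\<dots> = \<bar>y\<bar> * (lam ^ Suc n * norm (\<mu> k))" using lam01 by (simp add: norm_mult norm_power)
  also have "\<dots> \<le> \<bar>y\<bar> * (1 * norm (\<mu> k))"
    using \<open>lam ^ Suc n \<le> 1\<close> by (intro mult_left_mono mult_right_mono) auto
  finally show ?thesis by simp
qed

abbreviation h_term :: "'m \<Rightarrow> real \<Rightarrow> nat \<Rightarrow> complex" where
  "h_term k y n \<equiv> of_real (\<rho> ^ n) * (phi_ratio k n * exp (of_real y * node k n))"

abbreviation eta_term :: "'m \<Rightarrow> 'm \<Rightarrow> nat \<Rightarrow> complex" where
  "eta_term i k n \<equiv> of_real (\<rho> ^ n) * (phi_ratio k n * exp (of_real b * node k n) * exp_psi_unit Q i (node k n))"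

lemma summable_h: "summable (h_term k y)"
proof -
  obtain B where B: "\<And>n. norm (phi_ratio k n) \<le> B" using phi_ratio_bounded[of k] by blast
  show ?thesis
  proof (rule summable_geometric_bounded[OF \<rho>])
    show "norm (phi_ratio k n * exp (of_real y * node k n)) \<le> B * exp (\<bar>y\<bar> * norm (\<mu> k))" for n
      unfolding norm_mult[of "phi_ratio k n"] by (intro mult_mono B norm_exp_eig_le order_trans[OF norm_ge_zero B]) auto
  qed
qed

lemma summable_eta: "summable (eta_term i k)"
proof -
  obtain B where B: "\<And>n. norm (phi_ratio k n) \<le> B" using phi_ratio_bounded[of k] by blast
  obtain C where C: "\<And>n. norm (exp_psi_unit Q i (of_real (lam ^ n) * (of_real lam * \<mu> k))) \<le> C"
    using psi_unit_bounded[OF regular_eig[of 0 k], of i] by auto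
  show ?thesis
  proof (rule summable_geometric_bounded[OF \<rho>])
    show "norm (phi_ratio k n * exp (of_real b * node k n) * exp_psi_unit Q i (node k n)) \<le> B * exp (\<bar>b\<bar> * norm (\<mu> k)) * C" for n
      unfolding norm_mult[of "phi_ratio k n"] norm_mult[of "phi_ratio k n * _"]
      using C[of n] by (intro mult_mono B norm_exp_eig_le order_trans[OF norm_ge_zero B] mult_nonneg_nonneg) (auto simp: mult_ac)
  qed
qed

definition h_series :: "'m \<Rightarrow> real \<Rightarrow> complex" where
  "h_series k y = (\<Sum>n. h_term k y n)"

definition eta_series :: "'m \<Rightarrow> 'm \<Rightarrow> complex" where
  "eta_series i k = (\<Sum>n. eta_term i k n)"

definition weight :: "'m \<Rightarrow> complex" where
  "weight k = of_real \<rho> * init_coord k * exit_coord k * exp (- of_real b * \<mu> k) * psi2 (\<mu> k)"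

text \<open>
  The coefficients of the partial fractions of \<open>h\<close> and \<open>\<eta>\<close> after division by \<open>exp (\<delta> b)\<close>.
\<close>

definition h_coeff :: "real \<Rightarrow> 'm \<Rightarrow> complex" where "h_coeff y k = weight k * h_series k y"

definition eta_coeff :: "'m \<Rightarrow> 'm \<Rightarrow> complex" where "eta_coeff i k = V $ i $ k * exit_coord k + weight k * eta_series i k"

lemma minus_Q_D: "- cmat Q = D \<mu>"
  by (simp add: Q_D D_uminus)

lemma minus_scaled_Q_D: "- (c *\<^sub>R cmat Q) = D (\<lambda>k. of_real c * \<mu> k)"
  by (simp add: Q_D D_uminus D_scaleR)

lemma inj_scaled: "c \<noteq> 0 \<Longrightarrow> inj (\<lambda>k. complex_of_real c * \<mu> k)"
  using inj_eig by (auto simp: inj_def)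

lemma fun_calc_psi2_factor:
  assumes "f analytic_on UNIV"
  shows "fun_calc (\<lambda>z. f z * psi2 z) (- cmat Q) = D (\<lambda>k. f (\<mu> k) * psi2 (\<mu> k))"
  unfolding minus_Q_D
  by (rule fun_calc_D[OF inj_eig]) (intro analytic_intros psi2_analytic Re_eig_pos analytic_on_subset[OF assms], simp)

lemma fun_calc_phi: "fun_calc phi (- (lam *\<^sub>R cmat Q)) = D (\<lambda>k. phi (of_real lam * \<mu> k))"
  unfolding minus_scaled_Q_D
  by (rule fun_calc_D) (use lam01 regular_eig[of 0] in \<open>auto intro: inj_scaled phi_analytic\<close>)

lemma fun_calc_series:
  assumes "\<And>k n. f analytic_on {node k n}"
  shows "fun_calc (\<lambda>z. f z / phi z) (- (lam ^ Suc n *\<^sub>R cmat Q)) =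
    D (\<lambda>k. f (node k n) / phi (node k n))"
  unfolding minus_scaled_Q_D
proof (rule fun_calc_D)
  show "inj (\<lambda>k. complex_of_real (lam ^ Suc n) * \<mu> k)" using lam01 by (intro inj_scaled) auto
  show "(\<lambda>z. f z / phi z) analytic_on {node k n}" for k
    by (intro analytic_intros assms phi_analytic regular_eig) (use phi_nonzero[of "Suc n" k] in simp)
qed

lemma h_fun_eq:
  assumes "\<delta> \<notin> range \<mu>"
  shows "h_fun M lam Q \<alpha> T b \<rho> \<delta> y = exp (\<delta> * of_real b) * (\<Sum>k\<in>UNIV. h_coeff y k / (\<mu> k - \<delta>))"
proof -
  have "(\<lambda>n. \<rho> ^ n *\<^sub>R fun_calc (\<lambda>z. exp (of_real y * z) / phi z) (- (lam ^ Suc n *\<^sub>R cmat Q))) sums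
      D (\<lambda>k. h_series k y / phi (of_real lam * \<mu> k))"
  proof -
    have "\<rho> ^ n *\<^sub>R fun_calc (\<lambda>z. exp (of_real y * z) / phi z) (- (lam ^ Suc n *\<^sub>R cmat Q)) =
      D (\<lambda>k. h_term k y n / phi (of_real lam * \<mu> k))" for n
    proof -
      have "exp (of_real y * node k n) / phi (node k n)
         = phi_ratio k n * exp (of_real y * node k n) / phi (of_real lam * \<mu> k)" for k
        using inverse_phi[of n k] by (simp add: divide_inverse mult_ac)
      moreover have "(\<lambda>z. exp (of_real y * z)) analytic_on S" for S by (intro analytic_intros)
      ultimately show ?thesis by (subst fun_calc_series) (simp_all add: D_scaleR del: of_real_power power_Suc)
    qed
    moreover have "(\<lambda>n. h_term k y n / phi (of_real lam * \<mu> k)) sums (h_series k y / phi (of_real lam * \<mu> k))" for k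
      unfolding h_series_def by (intro sums_divide summable_sums summable_h)
    ultimately show ?thesis by (simp only:) (rule D_sums)
  qed
  then have series: "(\<Sum>n. \<rho> ^ n *\<^sub>R fun_calc (\<lambda>z. exp (of_real y * z) / phi z) (- (lam ^ Suc n *\<^sub>R cmat Q))) =
      D (\<lambda>k. h_series k y / phi (of_real lam * \<mu> k))" by (rule sums_unique[symmetric])
  have f1: "fun_calc (\<lambda>z. exp ((\<delta> - z) * of_real b) * psi2 z) (- cmat Q) = D (\<lambda>k. exp ((\<delta> - \<mu> k) * of_real b) * psi2 (\<mu> k))"
    by (rule fun_calc_psi2_factor) (intro analytic_intros)
  have row: "(\<rho> *\<^sub>R (a v* D f)) v* (D g ** D h) = a v* D (\<lambda>k. of_real \<rho> * (f k * (g k * h k)))" for a f g h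
  proof -
    have "(\<rho> *\<^sub>R v) v* A = v v* (\<rho> *\<^sub>R A)" for v :: "complex ^ 'm" and A :: "complex ^ 'm ^ 'm"
      by (simp add: vec_eq_iff vector_matrix_mult_def)
    then show ?thesis by (simp add: D_mult D_scaleR vector_matrix_mul_assoc mult.left_commute)
  qed
  have "h_fun M lam Q \<alpha> T b \<rho> \<delta> y = (\<Sum>k\<in>UNIV. (\<Sum>i\<in>UNIV. cvec \<alpha> $ i * V $ i $ k) *
     (of_real \<rho> * (1 / (\<mu> k - \<delta>) * (exp ((\<delta> - \<mu> k) * of_real b) * psi2 (\<mu> k)) * (phi (of_real lam * \<mu> k) * (h_series k y / phi (of_real lam * \<mu> k))))) * exit_coord k)"
    unfolding h_fun_def Let_def resolvent_D[OF assms] f1 fun_calc_phi series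
    unfolding D_mult[of "\<lambda>k. 1 / (\<mu> k - \<delta>)"] row scalar_product_D ..
  also have "\<dots> = (\<Sum>k\<in>UNIV. exp (\<delta> * of_real b) * (h_coeff y k / (\<mu> k - \<delta>)))"
  proof (intro sum.cong refl)
    fix k
    have "phi (of_real lam * \<mu> k) \<noteq> 0" using phi_nonzero[of 1 k] by simp
    moreover have "exp ((\<delta> - \<mu> k) * of_real b) = exp (\<delta> * of_real b) * exp (- of_real b * \<mu> k)"
      by (simp add: exp_add[symmetric] algebra_simps)
    ultimately show "(\<Sum>i\<in>UNIV. cvec \<alpha> $ i * V $ i $ k) *
     (of_real \<rho> * (1 / (\<mu> k - \<delta>) * (exp ((\<delta> - \<mu> k) * of_real b) * psi2 (\<mu> k)) * (phi (of_real lam * \<mu> k) * (h_series k y / phi (of_real lam * \<mu> k))))) * exit_coord k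
      = exp (\<delta> * of_real b) * (h_coeff y k / (\<mu> k - \<delta>))"
      by (simp add: h_coeff_def weight_def init_coord_def cvec_def)
  qed
  finally show ?thesis by (simp add: sum_distrib_left)
qed

lemma eta_eq:
  assumes "\<delta> \<notin> range \<mu>"
  shows "eta M lam Q \<alpha> T b \<rho> \<delta> i = exp (\<delta> * of_real b) * (\<Sum>k\<in>UNIV. eta_coeff i k / (\<mu> k - \<delta>))"
proof -
  have "(\<lambda>n. \<rho> ^ Suc n *\<^sub>R fun_calc (\<lambda>z. exp (of_real b * z) / phi z * exp_psi_unit Q i z) (- (lam ^ Suc n *\<^sub>R cmat Q))) sums
      D (\<lambda>k. of_real \<rho> * eta_series i k / phi (of_real lam * \<mu> k))"
  proof -
    have "\<rho> ^ Suc n *\<^sub>R fun_calc (\<lambda>z. exp (of_real b * z) / phi z * exp_psi_unit Q i z) (- (lam ^ Suc n *\<^sub>R cmat Q)) =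
      D (\<lambda>k. of_real \<rho> * (eta_term i k n) / phi (of_real lam * \<mu> k))" for n
    proof -
      have "exp (of_real b * node k n) * e / phi (node k n)
         = phi_ratio k n * exp (of_real b * node k n) * e / phi (of_real lam * \<mu> k)" for k e
        using inverse_phi[of n k] by (simp add: divide_inverse mult_ac)
      moreover have "(\<lambda>z. exp (of_real b * z) * exp_psi_unit Q i z) analytic_on {node k n}" for k n
        by (intro analytic_intros psi_unit_analytic regular_notin regular_eig)
      moreover have "(\<lambda>z. exp (of_real b * z) / phi z * exp_psi_unit Q i z) = (\<lambda>z. exp (of_real b * z) * exp_psi_unit Q i z / phi z)"
        by (simp add: fun_eq_iff)
      ultimately show ?thesis
        by (simp only: fun_calc_series D_scaleR) (simp add: mult.assoc del: of_real_power)
    qed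
    moreover have "(\<lambda>n. of_real \<rho> * (eta_term i k n) / phi (of_real lam * \<mu> k)) sums (of_real \<rho> * eta_series i k / phi (of_real lam * \<mu> k))" for k
      unfolding eta_series_def by (intro sums_divide sums_mult summable_sums summable_eta)
    ultimately show ?thesis by (simp only:) (rule D_sums)
  qed
  then have series: "(\<Sum>n. \<rho> ^ Suc n *\<^sub>R fun_calc (\<lambda>z. exp (of_real b * z) / phi z * exp_psi_unit Q i z) (- (lam ^ Suc n *\<^sub>R cmat Q))) =
      D (\<lambda>k. of_real \<rho> * eta_series i k / phi (of_real lam * \<mu> k))" by (rule sums_unique[symmetric])
  have f1: "fun_calc (\<lambda>z. exp (- z * of_real b) * psi2 z) (- cmat Q) = D (\<lambda>k. exp (- \<mu> k * of_real b) * psi2 (\<mu> k))"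
    by (rule fun_calc_psi2_factor) (intro analytic_intros)
  have row: "scalar_product ((e + a v* D f) v* D g) (cvec (exit_rates Q)) =
     (\<Sum>k\<in>UNIV. (\<Sum>i\<in>UNIV. e $ i * V $ i $ k) * g k * exit_coord k) + (\<Sum>k\<in>UNIV. (\<Sum>i\<in>UNIV. a $ i * V $ i $ k) * (f k * g k) * exit_coord k)" for e a f g
  proof -
    have "(e + a v* D f) v* D g = e v* D g + a v* D (\<lambda>k. f k * g k)"
      by (simp add: vector_matrix_mult_add_rdistrib vector_matrix_mul_assoc D_mult vector_matrix_left_distrib)
    then show ?thesis
      unfolding scalar_product_D[symmetric] by (simp add: scalar_product_def distrib_right sum.distrib)
  qed
  have "eta M lam Q \<alpha> T b \<rho> \<delta> i = exp (\<delta> * of_real b) *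
     ((\<Sum>k\<in>UNIV. (\<Sum>j\<in>UNIV. axis i 1 $ j * V $ j $ k) * (1 / (\<mu> k - \<delta>)) * exit_coord k) +
      (\<Sum>k\<in>UNIV. (\<Sum>j\<in>UNIV. cvec \<alpha> $ j * V $ j $ k) * (exp (- \<mu> k * of_real b) * psi2 (\<mu> k) * phi (of_real lam * \<mu> k) * (of_real \<rho> * eta_series i k / phi (of_real lam * \<mu> k)) * (1 / (\<mu> k - \<delta>))) * exit_coord k))"
    unfolding eta_def resolvent_D[OF assms] f1 fun_calc_phi series D_mult row ..
  also have "\<dots> = exp (\<delta> * of_real b) * (\<Sum>k\<in>UNIV. eta_coeff i k / (\<mu> k - \<delta>))"
    unfolding sum.distrib[symmetric]
  proof (intro arg_cong[where f = "\<lambda>s. exp (\<delta> * of_real b) * s"] sum.cong refl)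
    fix k
    have ne: "phi (of_real lam * \<mu> k) \<noteq> 0" using phi_nonzero[of 1 k] by simp
    have ax: "(\<Sum>j\<in>UNIV. axis i 1 $ j * V $ j $ k) = V $ i $ k" by (simp add: axis_def mult_delta_left)
    have lf: "(\<Sum>j\<in>UNIV. cvec \<alpha> $ j * V $ j $ k) = init_coord k" by (simp add: init_coord_def cvec_def)
    show "(\<Sum>j\<in>UNIV. axis i 1 $ j * V $ j $ k) * (1 / (\<mu> k - \<delta>)) * exit_coord k +
      (\<Sum>j\<in>UNIV. cvec \<alpha> $ j * V $ j $ k) * (exp (- \<mu> k * of_real b) * psi2 (\<mu> k) * phi (of_real lam * \<mu> k) * (of_real \<rho> * eta_series i k / phi (of_real lam * \<mu> k)) * (1 / (\<mu> k - \<delta>))) * exit_coord k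
      = eta_coeff i k / (\<mu> k - \<delta>)"
      unfolding ax lf using ne by (simp add: eta_coeff_def weight_def add_divide_distrib mult_ac)
  qed
  finally show ?thesis .
qed

abbreviation crossing :: "'m \<Rightarrow> real" where "crossing i \<equiv> crossing_transform M lam J T b \<rho> x i"

definition disc_transform :: "complex \<Rightarrow> complex" where "disc_transform v = (\<Sum>n. of_real (\<rho> ^ n) * killed_transform n v)"

lemma disc_transform_sums: "0 \<le> Re v \<Longrightarrow> (\<lambda>n. of_real (\<rho> ^ n) * killed_transform n v) sums disc_transform v"
  unfolding disc_transform_def by (rule summable_sums[OF summable_geometric_bounded[OF \<rho> killed_transform_bound]])

lemma disc_transform_bound:
  assumes "0 \<le> Re v" shows "norm (disc_transform v) \<le> exp (Re v * b) / (1 - \<rho>)"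
proof -
  have g: "(\<lambda>n. \<rho> ^ n * exp (Re v * b)) sums (1 / (1 - \<rho>) * exp (Re v * b))"
    using \<rho> by (intro sums_mult2 geometric_sums) auto
  have "norm (disc_transform v) \<le> (\<Sum>n. \<rho> ^ n * exp (Re v * b))"
    unfolding disc_transform_def
  proof (rule norm_suminf_le[OF _ sums_summable[OF g]])
    show "norm (of_real (\<rho> ^ n) * killed_transform n v) \<le> \<rho> ^ n * exp (Re v * b)" for n
      using killed_transform_bound[OF assms, of n] \<rho> by (simp add: norm_mult norm_power mult_left_mono)
  qed
  then show ?thesis using g by (simp add: sums_iff)
qed

lemma crossing_sums: "(\<lambda>n. of_real (\<rho> ^ Suc n * exit_prob n i)) sums complex_of_real (crossing i)"
  by (rule sums_of_real[OF crossing_transform_sums[OF \<rho>]])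

text \<open>
  The discounted sum over \<open>n\<close> of the one-step recursion for \<open>killed_transform\<close>.
\<close>

lemma disc_transform_equation:
  assumes "regular v"
  shows "disc_transform v = exp (v * of_real x) - exp (v * of_real b) * (\<Sum>i\<in>UNIV. exp_psi_unit Q i v * of_real (crossing i))
     + of_real \<rho> * (psi1 v * psi2 v) * disc_transform (of_real lam * v)"
proof -
  have v: "0 \<le> Re v" "v \<notin> range \<mu>" "0 \<le> Re (of_real lam * v)"
    using assms regular_notin[OF assms] lam01 by (simp_all add: regular_def)
  have "(\<lambda>n. of_real \<rho> * (psi1 v * psi2 v) * (of_real (\<rho> ^ n) * killed_transform n (of_real lam * v))
      - exp (v * of_real b) * (\<Sum>i\<in>UNIV. exp_psi_unit Q i v * of_real (\<rho> ^ Suc n * exit_prob n i))) sums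
     (of_real \<rho> * (psi1 v * psi2 v) * disc_transform (of_real lam * v) - exp (v * of_real b) * (\<Sum>i\<in>UNIV. exp_psi_unit Q i v * of_real (crossing i)))"
    by (intro sums_diff sums_mult sums_sum disc_transform_sums v crossing_sums)
  moreover have "of_real \<rho> * (psi1 v * psi2 v) * (of_real (\<rho> ^ n) * killed_transform n (of_real lam * v))
      - exp (v * of_real b) * (\<Sum>i\<in>UNIV. exp_psi_unit Q i v * of_real (\<rho> ^ Suc n * exit_prob n i)) =
      of_real (\<rho> ^ Suc n) * killed_transform (Suc n) v" for n
    unfolding killed_transform_Suc[OF v(1,2)] clock_transform[OF v(1)]
    by (simp add: algebra_simps sum_distrib_left)
  ultimately have "(\<lambda>n. of_real (\<rho> ^ Suc n) * killed_transform (Suc n) v) sums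
     (of_real \<rho> * (psi1 v * psi2 v) * disc_transform (of_real lam * v) - exp (v * of_real b) * (\<Sum>i\<in>UNIV. exp_psi_unit Q i v * of_real (crossing i)))"
    by simp
  moreover have "(\<lambda>n. of_real (\<rho> ^ Suc n) * killed_transform (Suc n) v) sums (disc_transform v - of_real (\<rho> ^ 0) * killed_transform 0 v)"
    using disc_transform_sums[OF v(1)] by (subst sums_Suc_iff) (simp only: diff_add_cancel)
  ultimately show ?thesis by (auto dest: sums_unique2 simp: killed_transform_0 algebra_simps)
qed

lemma crossing_V:
  "(\<Sum>i\<in>UNIV. V $ i $ k * of_real (crossing i)) =
     of_real \<rho> * init_coord k * exp (- of_real b * \<mu> k) * psi2 (\<mu> k) * disc_transform (of_real lam * \<mu> k)"
proof -
  have re: "0 \<le> Re (of_real lam * \<mu> k)" using lam01 Re_eig_pos[of k] by simp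
  have "(\<lambda>n. \<Sum>i\<in>UNIV. V $ i $ k * of_real (\<rho> ^ Suc n * exit_prob n i)) sums (\<Sum>i\<in>UNIV. V $ i $ k * of_real (crossing i))"
    by (intro sums_sum sums_mult crossing_sums)
  moreover have "(\<Sum>i\<in>UNIV. V $ i $ k * of_real (\<rho> ^ Suc n * exit_prob n i)) =
      of_real \<rho> * init_coord k * exp (- of_real b * \<mu> k) * psi2 (\<mu> k) * (of_real (\<rho> ^ n) * killed_transform n (of_real lam * \<mu> k))" for n
  proof -
    have "(\<Sum>i\<in>UNIV. V $ i $ k * of_real (\<rho> ^ Suc n * exit_prob n i)) = of_real (\<rho> ^ Suc n) * (\<Sum>i\<in>UNIV. V $ i $ k * of_real (exit_prob n i))"
      by (simp add: sum_distrib_left mult_ac)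
    then show ?thesis unfolding exit_prob_V by (simp add: mult_ac)
  qed
  ultimately have "(\<lambda>n. of_real \<rho> * init_coord k * exp (- of_real b * \<mu> k) * psi2 (\<mu> k) * (of_real (\<rho> ^ n) * killed_transform n (of_real lam * \<mu> k))) sums (\<Sum>i\<in>UNIV. V $ i $ k * of_real (crossing i))"
    by simp
  moreover have "(\<lambda>n. of_real \<rho> * init_coord k * exp (- of_real b * \<mu> k) * psi2 (\<mu> k) * (of_real (\<rho> ^ n) * killed_transform n (of_real lam * \<mu> k))) sums
     (of_real \<rho> * init_coord k * exp (- of_real b * \<mu> k) * psi2 (\<mu> k) * disc_transform (of_real lam * \<mu> k))"
    by (intro sums_mult disc_transform_sums re)
  ultimately show ?thesis by (rule sums_unique2)
qed

text \<open>
  Iteration of the functional equation along the nodes. The remainder after \<open>N\<close> steps is \<open>\<rho>\<^sup>N\<close> times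
  a bounded quantity.
\<close>

lemma disc_transform_solution: "disc_transform (of_real lam * \<mu> k) = h_series k x - (\<Sum>i\<in>UNIV. eta_series i k * of_real (crossing i))"
proof -
  let ?z = "\<lambda>n. of_real (lam ^ Suc n) * \<mu> k"
  define u where "u n = exp (?z n * of_real x) - exp (?z n * of_real b) * (\<Sum>i\<in>UNIV. exp_psi_unit Q i (?z n) * of_real (crossing i))" for n
  have zS: "of_real lam * ?z n = ?z (Suc n)" for n by simp
  have step: "disc_transform (?z n) = u n + of_real \<rho> * (psi1 (?z n) * psi2 (?z n)) * disc_transform (?z (Suc n))" for n
    using disc_transform_equation[OF regular_eig[of n k]] unfolding zS u_def .
  have partial: "disc_transform (?z 0) = (\<Sum>n<N. of_real (\<rho> ^ n) * (phi_ratio k n * u n)) + of_real (\<rho> ^ N) * (phi_ratio k N * disc_transform (?z N))" for N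
  proof (induction N)
    case (Suc N)
    have "of_real (\<rho> ^ N) * (phi_ratio k N * disc_transform (?z N)) =
        of_real (\<rho> ^ N) * (phi_ratio k N * u N) + of_real (\<rho> ^ Suc N) * (phi_ratio k (Suc N) * disc_transform (?z (Suc N)))"
      unfolding step[of N] phi_ratio_Suc by (simp add: algebra_simps)
    then show ?case unfolding Suc by simp
  qed (simp add: phi_ratio_0)
  obtain B where B: "\<And>n. norm (phi_ratio k n) \<le> B" using phi_ratio_bounded[of k] by blast
  have "(\<lambda>N. of_real (\<rho> ^ N) * (phi_ratio k N * disc_transform (?z N))) \<longlonglongrightarrow> 0"
  proof (rule summable_LIMSEQ_zero, rule summable_geometric_bounded[OF \<rho>])
    fix n
    have "lam ^ Suc n \<le> 1" using lam01 by (intro power_le_one) auto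
    then have "lam ^ Suc n * Re (\<mu> k) \<le> 1 * Re (\<mu> k)" using Re_eig_pos[of k] by (intro mult_right_mono) auto
    then have Re: "0 \<le> Re (?z n)" "Re (?z n) \<le> Re (\<mu> k)" using lam01 Re_eig_pos[of k] by simp_all
    have "norm (disc_transform (?z n)) \<le> exp (Re (?z n) * b) / (1 - \<rho>)" by (rule disc_transform_bound[OF Re(1)])
    also have "\<dots> \<le> exp (Re (\<mu> k) * b) / (1 - \<rho>)"
      using Re \<rho> b_nonneg by (intro divide_right_mono) (auto intro: mult_right_mono simp del: Re_complex_of_real)
    finally show "norm (phi_ratio k n * disc_transform (?z n)) \<le> B * (exp (Re (\<mu> k) * b) / (1 - \<rho>))"
      unfolding norm_mult by (intro mult_mono B order_trans[OF norm_ge_zero B]) auto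
  qed
  then have "(\<lambda>N. disc_transform (?z 0) - of_real (\<rho> ^ N) * (phi_ratio k N * disc_transform (?z N))) \<longlonglongrightarrow> disc_transform (?z 0) - 0"
    by (intro tendsto_intros)
  moreover have "disc_transform (?z 0) - of_real (\<rho> ^ N) * (phi_ratio k N * disc_transform (?z N)) = (\<Sum>n<N. of_real (\<rho> ^ n) * (phi_ratio k n * u n))" for N
    using partial[of N] by simp
  ultimately have "(\<lambda>n. of_real (\<rho> ^ n) * (phi_ratio k n * u n)) sums disc_transform (?z 0)"
    by (simp add: sums_def)
  moreover have "(\<lambda>n. of_real (\<rho> ^ n) * (phi_ratio k n * exp (of_real x * ?z n)) -
      (\<Sum>i\<in>UNIV. of_real (\<rho> ^ n) * (phi_ratio k n * exp (of_real b * ?z n) * exp_psi_unit Q i (?z n)) * of_real (crossing i)))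
     sums (h_series k x - (\<Sum>i\<in>UNIV. eta_series i k * of_real (crossing i)))"
    unfolding h_series_def eta_series_def by (intro sums_diff sums_sum sums_mult2 summable_sums summable_h summable_eta)
  moreover have "of_real (\<rho> ^ n) * (phi_ratio k n * exp (of_real x * ?z n)) -
      (\<Sum>i\<in>UNIV. of_real (\<rho> ^ n) * (phi_ratio k n * exp (of_real b * ?z n) * exp_psi_unit Q i (?z n)) * of_real (crossing i))
     = of_real (\<rho> ^ n) * (phi_ratio k n * u n)" for n
    unfolding u_def right_diff_distrib sum_distrib_left
    by (simp only: mult.commute[of "complex_of_real x"] mult.commute[of "complex_of_real b"] mult.assoc)
  ultimately show ?thesis by (auto dest: sums_unique2)
qed

text \<open>
  \<open>crossing_V\<close> expresses the pairing of the crossing transforms with column \<open>k\<close> of \<open>V\<close> through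
  \<open>disc_transform\<close> at the first node, and \<open>disc_transform_solution\<close> expresses that value again through
  the crossing transforms.
\<close>

lemma linear_system: "(\<Sum>i\<in>UNIV. eta_coeff i k * of_real (crossing i)) = h_coeff x k"
proof -
  have "(\<Sum>i\<in>UNIV. eta_coeff i k * of_real (crossing i)) =
     exit_coord k * (\<Sum>i\<in>UNIV. V $ i $ k * of_real (crossing i)) + weight k * (\<Sum>i\<in>UNIV. eta_series i k * of_real (crossing i))"
    unfolding eta_coeff_def distrib_right sum.distrib sum_distrib_left by (simp add: mult_ac)
  also have "exit_coord k * (\<Sum>i\<in>UNIV. V $ i $ k * of_real (crossing i)) = weight k * disc_transform (of_real lam * \<mu> k)"
    unfolding crossing_V by (simp add: weight_def)
  finally show ?thesis
    unfolding disc_transform_solution by (simp add: h_coeff_def algebra_simps)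
qed

end

theorem theorem3p7:
  fixes M :: "'w measure"
    and J :: "nat \<Rightarrow> real \<Rightarrow> 'w \<Rightarrow> 'm::finite option"
    and T :: "nat \<Rightarrow> 'w \<Rightarrow> real"
    and Q :: "real ^ 'm ^ 'm"
    and \<alpha> :: "real ^ 'm"
    and \<mu> :: "'m \<Rightarrow> complex"
    and lam b \<rho> :: real
  assumes prob: "prob_space M"
    and Q: "phasetype_matrix Q"
    and \<alpha>: "prob_vector \<alpha>"
    and lam: "0 < lam" "lam < 1"
    and chains: "\<And>n. n \<ge> 1 \<Longrightarrow> markov_chain M (hat_generator Q) (hat_initial \<alpha>) (J n)"
    and T_meas: "\<And>n. n \<ge> 1 \<Longrightarrow> T n \<in> borel_measurable M"
    and T_nonneg: "\<And>n. n \<ge> 1 \<Longrightarrow> AE \<omega> in M. 0 \<le> T n \<omega>"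
    and T_ident: "\<And>n. n \<ge> 1 \<Longrightarrow> distr M borel (T n) = distr M borel (T 1)"
    and indep: "chains_indep M J T"
    and log_moment: "integrable M (\<lambda>\<omega>. ln (1 + \<bar>innovation J T 1 \<omega>\<bar>))"
    and disjoint_spectra: "\<And>n::nat. n \<ge> 1 \<Longrightarrow> spectrum (lam ^ n *\<^sub>R cmat Q) \<inter> spectrum (cmat Q) = {}"
    and phi_defined: "\<And>(n::nat) z. n \<ge> 1 \<Longrightarrow> z \<in> spectrum (- (lam ^ n *\<^sub>R cmat Q)) \<Longrightarrow>
                        exp_phi M lam Q \<alpha> T z \<noteq> 0"
    and b: "0 \<le> b"
    and \<rho>: "0 < \<rho>" "\<rho> < 1"
    and eigenvalues: "inj \<mu>" "range \<mu> = spectrum (- cmat Q)"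
  shows "(\<forall>i. rational_with_poles (spectrum (- cmat Q)) {\<delta>. 0 \<le> Re \<delta> \<and> \<delta> \<notin> spectrum (- cmat Q)}
                (\<lambda>\<delta>. exp (- \<delta> * of_real b) * eta M lam Q \<alpha> T b \<rho> \<delta> i)) \<and>
         (\<forall>x<b. rational_with_poles (spectrum (- cmat Q)) {\<delta>. 0 \<le> Re \<delta> \<and> \<delta> \<notin> spectrum (- cmat Q)}
                (\<lambda>\<delta>. exp (- \<delta> * of_real b) * h_fun M lam Q \<alpha> T b \<rho> \<delta> x)) \<and>
         (\<exists>a c. partial_fractions M lam Q \<alpha> T b \<rho> \<mu> a c) \<and>
         (\<forall>a c. partial_fractions M lam Q \<alpha> T b \<rho> \<mu> a c \<longrightarrow>
            (let A = (\<chi> j i. a i j) :: complex ^ 'm ^ 'm in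
               invertible A \<longrightarrow>
               (\<forall>x<b. (\<chi> i. complex_of_real (crossing_transform M lam J T b \<rho> x i)) =
                       matrix_inv A *v c x)))"
proof -
  obtain V W where VW: "V ** W = mat 1" "W ** V = mat 1" and mQ: "- cmat Q = eig_matrix V W \<mu>"
    using eig_matrix_exists[OF eigenvalues] by metis
  interpret eigenbasis V W by unfold_locales (fact VW)+
  have QD: "cmat Q = D (\<lambda>k. - \<mu> k)"
    using arg_cong[OF mQ, of uminus] by (simp add: D_uminus)
  have disj: "of_real (lam ^ n) * \<mu> k \<notin> range \<mu>" if "1 \<le> n" for n k
  proof
    assume "of_real (lam ^ n) * \<mu> k \<in> range \<mu>"
    then obtain l where l: "of_real (lam ^ n) * \<mu> k = \<mu> l" by auto
    have "- \<mu> l \<in> spectrum (lam ^ n *\<^sub>R cmat Q)" unfolding QD D_scaleR spectrum_D using l by (auto intro!: image_eqI[of _ _ k])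
    moreover have "- \<mu> l \<in> spectrum (cmat Q)" unfolding QD spectrum_D by auto
    ultimately show False using disjoint_spectra[OF that] by auto
  qed
  have nz: "exp_phi M lam Q \<alpha> T (of_real (lam ^ n) * \<mu> k) \<noteq> 0" if "1 \<le> n" for n k
  proof (rule phi_defined[OF that])
    show "of_real (lam ^ n) * \<mu> k \<in> spectrum (- (lam ^ n *\<^sub>R cmat Q))"
      unfolding QD D_scaleR D_uminus spectrum_D by auto
  qed
  have model: "discounted_ar_model V W Q \<alpha> \<mu> M J T lam b x \<rho>" if "x < b" for x
    by (intro discounted_ar_model.intro ar_model.intro phase_type.intro eigenbasis.intro
        phase_type_axioms.intro ar_model_axioms.intro discounted_ar_model_axioms.intro)
      (assumption | rule VW WV eigenvalues(1) QD prob Q \<alpha> lam chains T_meas T_nonneg T_ident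
        indep log_moment b that \<rho> disj nz)+
  \<comment> \<open>the starting point does not enter the coefficients, so any point below the barrier serves here\<close>
  interpret m: discounted_ar_model V W Q \<alpha> \<mu> M J T lam b "b - 1" \<rho> by (rule model) simp
  let ?D = "{\<delta>. 0 \<le> Re \<delta> \<and> \<delta> \<notin> spectrum (- cmat Q)}"
  have D: "?D \<inter> range \<mu> = {}" using eigenvalues(2) by auto
  have canc: "exp (- \<delta> * of_real b) * (exp (\<delta> * of_real b) * s) = s" for \<delta> s :: complex
    by (simp add: mult.assoc[symmetric] exp_add[symmetric])
  have notin: "\<delta> \<notin> range \<mu>" if "\<delta> \<in> ?D" for \<delta> using that eigenvalues(2) by auto
  have "rational_with_poles (range \<mu>) ?D (\<lambda>\<delta>. exp (- \<delta> * of_real b) * eta M lam Q \<alpha> T b \<rho> \<delta> i)" for i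
    by (rule rational_partial_fractions[OF D, where c = "m.eta_coeff i"]) (simp only: m.eta_eq[OF notin] canc)
  then have rat_eta: "rational_with_poles (spectrum (- cmat Q)) ?D (\<lambda>\<delta>. exp (- \<delta> * of_real b) * eta M lam Q \<alpha> T b \<rho> \<delta> i)" for i
    unfolding eigenvalues(2) by blast
  have "rational_with_poles (range \<mu>) ?D (\<lambda>\<delta>. exp (- \<delta> * of_real b) * h_fun M lam Q \<alpha> T b \<rho> \<delta> x)" for x
    by (rule rational_partial_fractions[OF D, where c = "m.h_coeff x"]) (simp only: m.h_fun_eq[OF notin] canc)
  then have rat_h: "rational_with_poles (spectrum (- cmat Q)) ?D (\<lambda>\<delta>. exp (- \<delta> * of_real b) * h_fun M lam Q \<alpha> T b \<rho> \<delta> x)" for x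
    unfolding eigenvalues(2) by blast
  have "partial_fractions M lam Q \<alpha> T b \<rho> \<mu> m.eta_coeff (\<lambda>x. \<chi> j. m.h_coeff x j)"
    unfolding partial_fractions_def eigenvalues(2)[symmetric] by (simp add: m.eta_eq m.h_fun_eq)
  moreover have "(\<chi> i. complex_of_real (crossing_transform M lam J T b \<rho> x i)) = matrix_inv (\<chi> j i. a i j) *v c x"
    if pf: "partial_fractions M lam Q \<alpha> T b \<rho> \<mu> a c" and inv: "invertible (\<chi> j i. a i j)" and x: "x < b" for a c x
  proof -
    interpret mx: discounted_ar_model V W Q \<alpha> \<mu> M J T lam b x \<rho> by (rule model[OF x])
    let ?A = "(\<chi> j i. a i j) :: complex ^ 'm ^ 'm"
    let ?v = "(\<chi> i. complex_of_real (crossing_transform M lam J T b \<rho> x i))"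
    have a: "a i j = mx.eta_coeff i j" for i j
      by (rule partial_fractions_unique[OF eigenvalues(1) m.Re_eig_pos])
         (use pf mx.eta_eq in \<open>auto simp: partial_fractions_def eigenvalues(2)[symmetric]\<close>)
    have cx: "c x $ j = mx.h_coeff x j" for j
      by (rule partial_fractions_unique[OF eigenvalues(1) m.Re_eig_pos])
         (use pf x mx.h_fun_eq in \<open>auto simp: partial_fractions_def eigenvalues(2)[symmetric]\<close>)
    have "?A *v ?v = c x"
      using mx.linear_system by (simp add: vec_eq_iff matrix_vector_mult_def a cx)
    moreover obtain B where B: "?A ** B = mat 1" "B ** ?A = mat 1" using inv unfolding invertible_def by blast
    moreover have "matrix_inv ?A = B" by (rule matrix_inv_eqI[OF B])
    ultimately show ?thesis by (metis matrix_vector_mul_assoc matrix_vector_mul_lid)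
  qed
  ultimately show ?thesis
    using rat_eta rat_h unfolding Let_def by blast
qed

end
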